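(* Satisfiability over $\mathbb{R}$ is decidable for the fragment $\mathrm{UF}^{\mathrm{unary}}+\mathrm{IDL}+\mathrm{IRO}$ (defined below), and hence also for its subfragment $\mathrm{UF}^{\mathrm{unary}}+\mathrm{IRO}$. That is, there is an algorithm which, given any formula of either fragment, decides whether it has a model over $\mathbb{R}$.
   Context: Formulas are first-order formulas with equality, built with the usual connectives and quantifiers over variables ranging over $\mathbb{R}$. The signature has uninterpreted unary predicate symbols $P, Q, \dots$ and one interpreted unary predicate "$x \in \mathbb{Z}$", true iff $x$ is an integer. An interpretation has domain $\mathbb{R}$, interprets the arithmetic symbols as usual, assigns a real to each free variable and an arbitrary subset of $\mathbb{R}$ to each uninterpreted predicate. A formula is satisfiable if it has such a model. Atoms are of the forms: $P(x)$ with $P$ uninterpreted; $x \in \mathbb{Z}$; order constraints $x \bowtie y$; difference constraints $x - y \bowtie c$. Here $x,y$ are variables, $c \in \mathbb{Z}$ is a constant, and $\bowtie \in \{<,\le,=,\ge,>\}$. The fragment $\mathrm{UF}^{\mathrm{unary}}+\mathrm{IRO}$ consists of the formulas using only atoms $P(x)$, $x\in\mathbb{Z}$, and order constraints. The fragment $\mathrm{UF}^{\mathrm{unary}}+\mathrm{IDL}+\mathrm{IRO}$ additionally allows difference constraints, but only in a well-guarded way. Each difference constraint $x-y\bowtie c$ must occur in a subformula of the form $x \in \mathbb{Z} \land y \in \mathbb{Z} \land x - y \bowtie c$, or of the form $(x \in \mathbb{Z} \land y \in \mathbb{Z}) \Rightarrow x - y \bowtie c$. *)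

theory Defs
  imports Complex_Main "HOL-Library.Nat_Bijection"
begin

section \<open>Syntax and semantics over the reals\<close>

datatype cmp = Lt | Le | Eq | Ge | Gt

text \<open>Variables and uninterpreted unary predicate symbols are both indexed by natural numbers.
  \<^term>\<open>Diff x r y c\<close> is the difference constraint \<open>x - y r c\<close>.\<close>

datatype fm =
    Pred nat nat
  | IsInt nat
  | Ord nat cmp nat
  | Diff nat cmp nat int
  | Neg fm
  | And fm fm
  | Or fm fm
  | Imp fm fm
  | Iff fm fm
  | All nat fm
  | Ex nat fm

fun cmp_rel :: "cmp \<Rightarrow> real \<Rightarrow> real \<Rightarrow> bool" where
  "cmp_rel Lt a b \<longleftrightarrow> a < b"
| "cmp_rel Le a b \<longleftrightarrow> a \<le> b"
| "cmp_rel Eq a b \<longleftrightarrow> a = b"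
| "cmp_rel Ge a b \<longleftrightarrow> a \<ge> b"
| "cmp_rel Gt a b \<longleftrightarrow> a > b"

primrec satisfies :: "(nat \<Rightarrow> real set) \<Rightarrow> (nat \<Rightarrow> real) \<Rightarrow> fm \<Rightarrow> bool" where
  "satisfies I v (Pred P x) \<longleftrightarrow> v x \<in> I P"
| "satisfies I v (IsInt x) \<longleftrightarrow> v x \<in> \<int>"
| "satisfies I v (Ord x r y) \<longleftrightarrow> cmp_rel r (v x) (v y)"
| "satisfies I v (Diff x r y c) \<longleftrightarrow> cmp_rel r (v x - v y) (of_int c)"
| "satisfies I v (Neg \<phi>) \<longleftrightarrow> \<not> satisfies I v \<phi>"
| "satisfies I v (And \<phi> \<psi>) \<longleftrightarrow> satisfies I v \<phi> \<and> satisfies I v \<psi>"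
| "satisfies I v (Or \<phi> \<psi>) \<longleftrightarrow> satisfies I v \<phi> \<or> satisfies I v \<psi>"
| "satisfies I v (Imp \<phi> \<psi>) \<longleftrightarrow> (satisfies I v \<phi> \<longrightarrow> satisfies I v \<psi>)"
| "satisfies I v (Iff \<phi> \<psi>) \<longleftrightarrow> (satisfies I v \<phi> \<longleftrightarrow> satisfies I v \<psi>)"
| "satisfies I v (All x \<phi>) \<longleftrightarrow> (\<forall>a. satisfies I (v(x := a)) \<phi>)"
| "satisfies I v (Ex x \<phi>) \<longleftrightarrow> (\<exists>a. satisfies I (v(x := a)) \<phi>)"

definition satisfiable :: "fm \<Rightarrow> bool" where
  "satisfiable \<phi> \<longleftrightarrow> (\<exists>I v. satisfies I v \<phi>)"


section \<open>The two fragments\<close>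

inductive_set UF_IRO :: "fm set" where
  "Pred P x \<in> UF_IRO"
| "IsInt x \<in> UF_IRO"
| "Ord x r y \<in> UF_IRO"
| "\<phi> \<in> UF_IRO \<Longrightarrow> Neg \<phi> \<in> UF_IRO"
| "\<phi> \<in> UF_IRO \<Longrightarrow> \<psi> \<in> UF_IRO \<Longrightarrow> And \<phi> \<psi> \<in> UF_IRO"
| "\<phi> \<in> UF_IRO \<Longrightarrow> \<psi> \<in> UF_IRO \<Longrightarrow> Or \<phi> \<psi> \<in> UF_IRO"
| "\<phi> \<in> UF_IRO \<Longrightarrow> \<psi> \<in> UF_IRO \<Longrightarrow> Imp \<phi> \<psi> \<in> UF_IRO"
| "\<phi> \<in> UF_IRO \<Longrightarrow> \<psi> \<in> UF_IRO \<Longrightarrow> Iff \<phi> \<psi> \<in> UF_IRO"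
| "\<phi> \<in> UF_IRO \<Longrightarrow> All x \<phi> \<in> UF_IRO"
| "\<phi> \<in> UF_IRO \<Longrightarrow> Ex x \<phi> \<in> UF_IRO"

text \<open>There is no rule for a bare difference constraint, so each of its occurrences lies in one of
  the guarded subformulas. The ternary conjunction may be bracketed either way.\<close>

inductive_set UF_IDL_IRO :: "fm set" where
  "Pred P x \<in> UF_IDL_IRO"
| "IsInt x \<in> UF_IDL_IRO"
| "Ord x r y \<in> UF_IDL_IRO"
| "And (And (IsInt x) (IsInt y)) (Diff x r y c) \<in> UF_IDL_IRO"
| "And (IsInt x) (And (IsInt y) (Diff x r y c)) \<in> UF_IDL_IRO"
| "Imp (And (IsInt x) (IsInt y)) (Diff x r y c) \<in> UF_IDL_IRO"
| "\<phi> \<in> UF_IDL_IRO \<Longrightarrow> Neg \<phi> \<in> UF_IDL_IRO"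
| "\<phi> \<in> UF_IDL_IRO \<Longrightarrow> \<psi> \<in> UF_IDL_IRO \<Longrightarrow> And \<phi> \<psi> \<in> UF_IDL_IRO"
| "\<phi> \<in> UF_IDL_IRO \<Longrightarrow> \<psi> \<in> UF_IDL_IRO \<Longrightarrow> Or \<phi> \<psi> \<in> UF_IDL_IRO"
| "\<phi> \<in> UF_IDL_IRO \<Longrightarrow> \<psi> \<in> UF_IDL_IRO \<Longrightarrow> Imp \<phi> \<psi> \<in> UF_IDL_IRO"
| "\<phi> \<in> UF_IDL_IRO \<Longrightarrow> \<psi> \<in> UF_IDL_IRO \<Longrightarrow> Iff \<phi> \<psi> \<in> UF_IDL_IRO"
| "\<phi> \<in> UF_IDL_IRO \<Longrightarrow> All x \<phi> \<in> UF_IDL_IRO"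
| "\<phi> \<in> UF_IDL_IRO \<Longrightarrow> Ex x \<phi> \<in> UF_IDL_IRO"

lemma UF_IRO_subset: "UF_IRO \<subseteq> UF_IDL_IRO"
proof
  fix \<phi> assume "\<phi> \<in> UF_IRO"
  then show "\<phi> \<in> UF_IDL_IRO"
    by induction (auto intro: UF_IDL_IRO.intros)
qed


section \<open>Algorithms: partial recursive functions\<close>

datatype recf =
    Zero
  | Succ
  | Proj nat
  | Comp recf "recf list"
  | PrimRec recf recf
  | Mu recf

text \<open>\<^term>\<open>computes p xs y\<close>: the program \<open>p\<close> halts on input \<open>xs\<close> with output \<open>y\<close>. In \<open>Mu\<close> the
  search variable comes first, and the search halts only if all earlier values are defined.\<close>

inductive computes :: "recf \<Rightarrow> nat list \<Rightarrow> nat \<Rightarrow> bool" where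
  Zero: "computes Zero xs 0"
| Succ: "computes Succ [x] (Suc x)"
| Proj: "i < length xs \<Longrightarrow> computes (Proj i) xs (xs ! i)"
| Comp: "list_all2 (\<lambda>g y. computes g xs y) gs ys \<Longrightarrow> computes f ys z
    \<Longrightarrow> computes (Comp f gs) xs z"
| PrimRec_0: "computes f xs y \<Longrightarrow> computes (PrimRec f g) (0 # xs) y"
| PrimRec_Suc: "computes (PrimRec f g) (n # xs) y \<Longrightarrow> computes g (n # y # xs) z
    \<Longrightarrow> computes (PrimRec f g) (Suc n # xs) z"
| Mu: "computes f (n # xs) 0 \<Longrightarrow> (\<forall>m<n. \<exists>y>0. computes f (m # xs) y)
    \<Longrightarrow> computes (Mu f) xs n"

lemma computes_deterministic: "computes p xs y \<Longrightarrow> computes p xs z \<Longrightarrow> y = z"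
proof (induction arbitrary: z rule: computes.induct)
  case (Zero xs)
  then show ?case by (cases rule: computes.cases) auto
next
  case (Succ x)
  then show ?case by (cases rule: computes.cases) auto
next
  case (Proj i xs)
  from Proj.prems show ?case by (cases rule: computes.cases) auto
next
  case (Comp xs gs ys f u)
  from Comp.prems obtain ys' where ys': "list_all2 (\<lambda>g y. computes g xs y) gs ys'"
    and f: "computes f ys' z"
    by (cases rule: computes.cases) auto
  have "ys = ys'"
    using Comp.IH(1) ys' by (auto simp: list_all2_conv_all_nth intro!: nth_equalityI)
  then show ?case using Comp.IH(2) f by blast
next
  case (PrimRec_0 f xs y g)
  from PrimRec_0.prems show ?case
    by (cases rule: computes.cases) (auto intro: PrimRec_0.IH)
next
  case (PrimRec_Suc f g n xs y u)
  from PrimRec_Suc.prems obtain y' where "computes (PrimRec f g) (n # xs) y'"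
    and "computes g (n # y' # xs) z"
    by (cases rule: computes.cases) auto
  then show ?case using PrimRec_Suc.IH by metis
next
  case (Mu f n xs)
  from Mu.prems have z: "computes f (z # xs) 0" "\<forall>m<z. \<exists>y>0. computes f (m # xs) y"
    by (cases rule: computes.cases; auto)+
  show ?case
  proof (rule linorder_cases[of n z])
    assume "n < z"
    then show ?thesis using z(2) Mu.IH(1) by (metis less_irrefl)
  next
    assume "z < n"
    then show ?thesis using z(1) Mu.IH(2) by (metis less_irrefl)
  qed
qed


section \<open>Goedel numbering and decidability\<close>

fun cmp_code :: "cmp \<Rightarrow> nat" where
  "cmp_code Lt = 0"
| "cmp_code Le = 1"
| "cmp_code Eq = 2"
| "cmp_code Ge = 3"
| "cmp_code Gt = 4"

primrec fm_code :: "fm \<Rightarrow> nat" where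
  "fm_code (Pred P x) = prod_encode (0, prod_encode (P, x))"
| "fm_code (IsInt x) = prod_encode (1, x)"
| "fm_code (Ord x r y) = prod_encode (2, prod_encode (x, prod_encode (cmp_code r, y)))"
| "fm_code (Diff x r y c) =
    prod_encode (3, prod_encode (x, prod_encode (cmp_code r, prod_encode (y, int_encode c))))"
| "fm_code (Neg \<phi>) = prod_encode (4, fm_code \<phi>)"
| "fm_code (And \<phi> \<psi>) = prod_encode (5, prod_encode (fm_code \<phi>, fm_code \<psi>))"
| "fm_code (Or \<phi> \<psi>) = prod_encode (6, prod_encode (fm_code \<phi>, fm_code \<psi>))"
| "fm_code (Imp \<phi> \<psi>) = prod_encode (7, prod_encode (fm_code \<phi>, fm_code \<psi>))"
| "fm_code (Iff \<phi> \<psi>) = prod_encode (8, prod_encode (fm_code \<phi>, fm_code \<psi>))"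
| "fm_code (All x \<phi>) = prod_encode (9, prod_encode (x, fm_code \<phi>))"
| "fm_code (Ex x \<phi>) = prod_encode (10, prod_encode (x, fm_code \<phi>))"

lemma cmp_code_inject: "cmp_code r = cmp_code s \<longleftrightarrow> r = s"
  by (cases r; cases s) auto

lemma fm_code_inject: "fm_code \<phi> = fm_code \<psi> \<longleftrightarrow> \<phi> = \<psi>"
proof (induction \<phi> arbitrary: \<psi>)
  case (Pred P x) show ?case by (cases \<psi>) auto
next
  case (IsInt x) show ?case by (cases \<psi>) auto
next
  case (Ord x r y) show ?case by (cases \<psi>) (auto simp: cmp_code_inject)
next
  case (Diff x r y c) show ?case by (cases \<psi>) (auto simp: cmp_code_inject int_encode_eq)
next
  case (Neg \<phi>) then show ?case by (cases \<psi>) auto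
next
  case (And \<phi>1 \<phi>2) then show ?case by (cases \<psi>) auto
next
  case (Or \<phi>1 \<phi>2) then show ?case by (cases \<psi>) auto
next
  case (Imp \<phi>1 \<phi>2) then show ?case by (cases \<psi>) auto
next
  case (Iff \<phi>1 \<phi>2) then show ?case by (cases \<psi>) auto
next
  case (All x \<phi>) then show ?case by (cases \<psi>) auto
next
  case (Ex x \<phi>) then show ?case by (cases \<psi>) auto
qed

text \<open>The program must halt with the correct answer on every formula of \<open>F\<close>; its behaviour on other
  inputs is unconstrained.\<close>

definition decidable_on :: "fm set \<Rightarrow> (fm \<Rightarrow> bool) \<Rightarrow> bool" where
  "decidable_on F A \<longleftrightarrow>
    (\<exists>p. \<forall>\<phi>\<in>F. computes p [fm_code \<phi>] (if A \<phi> then 1 else 0))"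

end

theory Submission
  imports Defs "HOL-Library.Ramsey" "HOL-Analysis.Continuum_Not_Denumerable"
begin

text \<open>The proof uses the composition method. The interpretation of the predicates and of integrality
  is a colouring of the line by finitely many letters. The \<open>n + 1\<close>-type of a coloured set \<open>X\<close> is
  the finite set of triples (\<open>n\<close>-type of the part of \<open>X\<close> below \<open>a\<close>, letter of \<open>a\<close>, \<open>n\<close>-type of
  the part above \<open>a\<close>), \<open>a \<in> X\<close>. Types are hereditarily finite, hence coded by natural numbers; the
  type of a concatenation is computable from the types of its parts, and the type of the line
  determines the truth of every formula whose code is bounded by the level. It remains to compute
  which types occur.

  The types of half-open intervals without integers are the least set closed under concatenation,
  limits \<open>\<omega>\<close> and its reverse of an idempotent type, and shuffles: dense mixtures of finitely many
  types of points and closed intervals in which at least one kind of component is a point.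
  That all types are generated is a condensation argument: call \<open>x, y\<close> equivalent if all intervals
  between them have generated types. By Ramsey's theorem the classes are closed, so inequivalent
  points have further classes between them; where the set of types of classes is minimal the classes
  form a shuffle, and by a Baire-type argument one of them is a point. Conversely shuffles are
  realised by means of a continuous monotone function whose nondegenerate fibres lie over a
  prescribed countable set. The integers cut the line into unit intervals, so one more closure under
  concatenation, followed by one limit in each direction, yields all types of the line.\<close>


section \<open>Computable functions\<close>

text \<open>Since the predicates are free, satisfiability only asks which first-order types coloured
  lines can have; no quantifier over sets is ever evaluated. A type is invariant under order
  isomorphisms, but a difference constraint is not. The guards remove this obstacle: the distance of
  two integers is the number of integers between them, and a type of level \<open>n\<close> counts
  the integers of a set correctly up to \<open>n\<close>. Hence distances may be cut off beyond the
  constants of the formula. Half-open intervals concatenate with neither overlap nor gap; sums that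
  are open on the right are completed by one point. The demand for a point among the components of a
  shuffle expresses completeness of the line: disjoint nondegenerate intervals are countably many,
  so a dense mixture of them alone would leave cuts unfilled. The integers get a closure of their
  own because the closure for intervals could not force them to be discrete and unbounded. One
  number, the code of the formula, bounds its quantifier depth, variables, predicates and constants,
  so every parameter of the search is computable from it.\<close>

definition ncomp :: "nat \<Rightarrow> (nat list \<Rightarrow> nat) \<Rightarrow> bool" where
  "ncomp k f \<longleftrightarrow> (\<exists>p. \<forall>xs. length xs = k \<longrightarrow> computes p xs (f xs))"

lemma ncomp_cong:
  assumes "ncomp k f" "\<And>xs. length xs = k \<Longrightarrow> f xs = g xs"
  shows "ncomp k g"
  using assms unfolding ncomp_def by metis

lemma ncomp_nth: "i < k \<Longrightarrow> ncomp k (\<lambda>xs. xs ! i)"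
  unfolding ncomp_def by (metis computes.Proj)

lemma ncomp_subst:
  assumes h: "ncomp (length gs) h" and gs: "\<And>g. g \<in> set gs \<Longrightarrow> ncomp k g"
  shows "ncomp k (\<lambda>xs. h (map (\<lambda>g. g xs) gs))"
proof -
  obtain p where p: "\<And>xs. length xs = length gs \<Longrightarrow> computes p xs (h xs)"
    using h unfolding ncomp_def by auto
  have "\<forall>g. \<exists>q. g \<in> set gs \<longrightarrow> (\<forall>xs. length xs = k \<longrightarrow> computes q xs (g xs))"
    using gs unfolding ncomp_def by blast
  then obtain Q where Q: "\<And>g xs. g \<in> set gs \<Longrightarrow> length xs = k \<Longrightarrow> computes (Q g) xs (g xs)"
    by metis
  have "computes (Comp p (map Q gs)) xs (h (map (\<lambda>g. g xs) gs))" if "length xs = k" for xs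
    by (rule computes.Comp[where ys = "map (\<lambda>g. g xs) gs"])
      (auto simp: list_all2_conv_all_nth Q that intro!: p)
  then show ?thesis unfolding ncomp_def by blast
qed

lemma ncomp_subst1:
  assumes "ncomp 1 h" "ncomp k f"
  shows "ncomp k (\<lambda>xs. h [f xs])"
  using ncomp_subst[of "[f]" h k] assms by simp

lemma ncomp_Suc:
  assumes "ncomp k f"
  shows "ncomp k (\<lambda>xs. Suc (f xs))"
proof -
  have "ncomp 1 (\<lambda>xs. Suc (xs ! 0))"
    unfolding ncomp_def by (rule exI[of _ Succ]) (auto simp: length_Suc_conv intro: computes.Succ)
  from ncomp_subst1[OF this assms] show ?thesis by simp
qed

lemma ncomp_const: "ncomp k (\<lambda>xs. c)"
proof (induction c)
  case 0
  show ?case unfolding ncomp_def using computes.Zero by blast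
next
  case (Suc c)
  then show ?case by (rule ncomp_Suc)
qed

text \<open>\<open>PrimRec\<close> hands the counter and the previous value to its step function in
  front of the parameters; a step that ignores both is obtained by substituting projections.\<close>

lemma ncomp_drop2:
  assumes "ncomp k f"
  shows "ncomp (Suc (Suc k)) (\<lambda>xs. f (drop 2 xs))"
proof -
  have "ncomp (Suc (Suc k)) (\<lambda>xs. f (map (\<lambda>g. g xs) (map (\<lambda>i xs. xs ! (i + 2)) [0..<k])))"
    using assms by (intro ncomp_subst) (auto intro: ncomp_nth)
  then show ?thesis
  proof (rule ncomp_cong)
    fix xs :: "nat list"
    assume "length xs = Suc (Suc k)"
    then have "map (\<lambda>g. g xs) (map (\<lambda>i xs. xs ! (i + 2)) [0..<k]) = drop 2 xs"
      by (intro nth_equalityI) (auto simp: add.commute)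
    then show "f (map (\<lambda>g. g xs) (map (\<lambda>i xs. xs ! (i + 2)) [0..<k])) = f (drop 2 xs)" by simp
  qed
qed

lemma ncomp_rec:
  assumes f: "ncomp k f" and g: "ncomp (Suc (Suc k)) g" and m: "ncomp k m"
  shows "ncomp k (\<lambda>xs. rec_nat (f xs) (\<lambda>n r. g (n # r # xs)) (m xs))"
proof -
  obtain p q where p: "\<And>xs. length xs = k \<Longrightarrow> computes p xs (f xs)"
    and q: "\<And>xs. length xs = Suc (Suc k) \<Longrightarrow> computes q xs (g xs)"
    using f g unfolding ncomp_def by blast
  have "computes (PrimRec p q) (n # xs) (rec_nat (f xs) (\<lambda>n r. g (n # r # xs)) n)"
    if "length xs = k" for n xs
  proof (induction n)
    case 0
    show ?case using computes.PrimRec_0[OF p[OF that]] by simp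
  next
    case (Suc n)
    show ?case using computes.PrimRec_Suc[OF Suc q] that by simp
  qed
  then have "computes (PrimRec p q) ys (rec_nat (f (tl ys)) (\<lambda>n r. g (n # r # tl ys)) (hd ys))"
    if "length ys = Suc k" for ys
    using that by (cases ys) auto
  then have "ncomp (Suc k) (\<lambda>ys. rec_nat (f (tl ys)) (\<lambda>n r. g (n # r # tl ys)) (hd ys))"
    unfolding ncomp_def by blast
  \<comment> \<open>\<open>PrimRec\<close> recurses on its first argument, so the computed bound
    \<open>m xs\<close> is put in front of a copy of all arguments.\<close>
  then have "ncomp k (\<lambda>xs. (\<lambda>ys. rec_nat (f (tl ys)) (\<lambda>n r. g (n # r # tl ys)) (hd ys))
      (map (\<lambda>g. g xs) (m # map (\<lambda>i xs. xs ! i) [0..<k])))"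
    using m by (intro ncomp_subst) (auto intro: ncomp_nth)
  then show ?thesis
  proof (rule ncomp_cong)
    fix xs :: "nat list"
    assume "length xs = k"
    then have "map (\<lambda>x. xs ! x) [0..<k] = xs"
      using map_nth[of xs] by simp
    then show "(\<lambda>ys. rec_nat (f (tl ys)) (\<lambda>n r. g (n # r # tl ys)) (hd ys))
      (map (\<lambda>g. g xs) (m # map (\<lambda>i xs. xs ! i) [0..<k])) =
      rec_nat (f xs) (\<lambda>n r. g (n # r # xs)) (m xs)"
      by (simp add: comp_def)
  qed
qed

lemma ncomp_add:
  assumes "ncomp k f" "ncomp k g"
  shows "ncomp k (\<lambda>xs. f xs + g xs)"
proof -
  have "ncomp k (\<lambda>xs. rec_nat (f xs) (\<lambda>n r. (\<lambda>ys. Suc (ys ! 1)) (n # r # xs)) (g xs))"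
    by (intro ncomp_rec assms ncomp_Suc ncomp_nth) simp
  moreover have "rec_nat a (\<lambda>n. Suc) b = a + b" for a b by (induction b) auto
  ultimately show ?thesis by simp
qed

lemma ncomp_diff:
  assumes "ncomp k f" "ncomp k g"
  shows "ncomp k (\<lambda>xs. f xs - g xs)"
proof -
  have P: "ncomp j (\<lambda>xs. h xs - 1)" if "ncomp j h" for j h
  proof -
    have "ncomp j (\<lambda>xs. rec_nat 0 (\<lambda>n r. (\<lambda>ys. ys ! 0) (n # r # xs)) (h xs))"
      by (intro ncomp_rec that ncomp_const ncomp_nth) simp
    moreover have "rec_nat 0 (\<lambda>n r. n) b = b - 1" for b by (induction b) auto
    ultimately show ?thesis by simp
  qed
  have "ncomp k (\<lambda>xs. rec_nat (f xs) (\<lambda>n r. (\<lambda>ys. ys ! 1 - 1) (n # r # xs)) (g xs))"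
    by (intro ncomp_rec assms P ncomp_nth) simp
  moreover have "rec_nat a (\<lambda>n r. r - 1) b = a - b" for a b by (induction b) auto
  ultimately show ?thesis by simp
qed

lemma ncomp_triangle:
  assumes "ncomp k f"
  shows "ncomp k (\<lambda>xs. triangle (f xs))"
proof -
  have "ncomp k (\<lambda>xs. rec_nat 0 (\<lambda>n r. (\<lambda>ys. ys ! 1 + Suc (ys ! 0)) (n # r # xs)) (f xs))"
    by (intro ncomp_rec assms ncomp_add ncomp_Suc ncomp_const ncomp_nth) simp_all
  moreover have "rec_nat 0 (\<lambda>n r. r + Suc n) b = triangle b" for b
    by (induction b) auto
  ultimately show ?thesis by simp
qed

lemma ncomp_if_zero:
  assumes "ncomp k f" "ncomp k g" "ncomp k h"
  shows "ncomp k (\<lambda>xs. if f xs = 0 then g xs else h xs)"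
proof -
  have "ncomp k (\<lambda>xs. rec_nat (g xs) (\<lambda>n r. (\<lambda>ys. h (drop 2 ys)) (n # r # xs)) (f xs))"
    by (intro ncomp_rec assms ncomp_drop2)
  moreover have "rec_nat a (\<lambda>n r. b) c = (if c = 0 then a else b)" for a b :: nat and c
    by (cases c) auto
  ultimately show ?thesis by simp
qed

section \<open>The Cantor pairing and its projections\<close>

definition pair :: "nat \<Rightarrow> nat \<Rightarrow> nat" where "pair a b = prod_encode (a, b)"
definition pfst :: "nat \<Rightarrow> nat" where "pfst z = fst (prod_decode z)"
definition psnd :: "nat \<Rightarrow> nat" where "psnd z = snd (prod_decode z)"

lemma pfst_pair [simp]: "pfst (pair a b) = a" and psnd_pair [simp]: "psnd (pair a b) = b"
  by (simp_all add: pair_def pfst_def psnd_def)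

lemma pair_pfst_psnd [simp]: "pair (pfst z) (psnd z) = z"
  by (simp add: pair_def pfst_def psnd_def)

lemma pair_eq_iff [simp]: "pair a b = pair c d \<longleftrightarrow> a = c \<and> b = d"
  by (simp add: pair_def)

lemma pair_triangle: "pair a b = triangle (a + b) + a"
  by (simp add: pair_def prod_encode_def)

lemma triangle_ge: "n \<le> triangle n"
  by (induction n) auto

lemma triangle_mono: "m \<le> n \<Longrightarrow> triangle m \<le> triangle n"
  by (rule lift_Suc_mono_le[of triangle]) auto

lemma pair_ge: "a \<le> pair a b" "b \<le> pair a b" "a + b \<le> pair a b"
  using triangle_ge[of "a + b"] by (auto simp: pair_triangle)

lemma pfst_le: "pfst z \<le> z" and psnd_le: "psnd z \<le> z"
  using pair_ge[of "pfst z" "psnd z"] by auto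

lemma psnd_less: "0 < pfst z \<Longrightarrow> psnd z < z"
  using pair_ge(3)[of "pfst z" "psnd z"] by auto

lemma pair_mono: "a \<le> c \<Longrightarrow> b \<le> d \<Longrightarrow> pair a b \<le> pair c d"
  using triangle_mono[of "a + b" "c + d"] by (auto simp: pair_triangle)

lemma ncomp_pair: "ncomp k f \<Longrightarrow> ncomp k g \<Longrightarrow> ncomp k (\<lambda>xs. pair (f xs) (g xs))"
  unfolding pair_triangle by (intro ncomp_add ncomp_triangle)

text \<open>The index of the antidiagonal of the Cantor pairing on which a number lies. Scanning
  upwards, it grows by one exactly when the next triangular number is reached; the truncated
  difference expresses this comparison as a test for zero.\<close>

definition diagonal :: "nat \<Rightarrow> nat" where
  "diagonal = rec_nat 0 (\<lambda>n r. if triangle (Suc r) - Suc n = 0 then Suc r else r)"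

lemma diagonal_bounds: "triangle (diagonal z) \<le> z \<and> z < triangle (Suc (diagonal z))"
  unfolding diagonal_def by (induction z) auto

lemma diagonal_pair: "diagonal (pair a b) = a + b"
proof -
  let ?s = "diagonal (pair a b)"
  have 1: "triangle (a + b) \<le> pair a b" "pair a b < triangle (Suc (a + b))"
    by (auto simp: pair_triangle)
  have "\<not> ?s < a + b"
    using triangle_mono[of "Suc ?s" "a + b"] diagonal_bounds[of "pair a b"] 1 by force
  moreover have "\<not> a + b < ?s"
    using triangle_mono[of "Suc (a + b)" ?s] diagonal_bounds[of "pair a b"] 1 by force
  ultimately show ?thesis by simp
qed

lemma pfst_diagonal: "pfst z = z - triangle (diagonal z)"
  using diagonal_pair[of "pfst z" "psnd z"] pair_triangle[of "pfst z" "psnd z"] by simp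

lemma psnd_diagonal: "psnd z = diagonal z - (z - triangle (diagonal z))"
  using diagonal_pair[of "pfst z" "psnd z"] unfolding pfst_diagonal[symmetric] by simp

lemma ncomp_diagonal:
  assumes "ncomp k f"
  shows "ncomp k (\<lambda>xs. diagonal (f xs))"
proof -
  have "ncomp k (\<lambda>xs. rec_nat 0 (\<lambda>n r. (\<lambda>ys. if triangle (Suc (ys ! 1)) - Suc (ys ! 0) = 0
      then Suc (ys ! 1) else ys ! 1) (n # r # xs)) (f xs))"
    by (intro ncomp_rec assms ncomp_if_zero ncomp_diff ncomp_triangle ncomp_Suc ncomp_const ncomp_nth)
      simp_all
  then show ?thesis by (simp only: diagonal_def nth_Cons_0 nth_Cons_Suc One_nat_def)
qed

lemma ncomp_pfst: "ncomp k f \<Longrightarrow> ncomp k (\<lambda>xs. pfst (f xs))"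
  unfolding pfst_diagonal by (intro ncomp_diff ncomp_triangle ncomp_diagonal)

lemma ncomp_psnd: "ncomp k f \<Longrightarrow> ncomp k (\<lambda>xs. psnd (f xs))"
  unfolding psnd_diagonal by (intro ncomp_diff ncomp_triangle ncomp_diagonal)

section \<open>Unary computable functions and decidable predicates\<close>

definition computable :: "(nat \<Rightarrow> nat) \<Rightarrow> bool" where
  "computable f \<longleftrightarrow> (\<exists>p. \<forall>x. computes p [x] (f x))"

definition dec :: "(nat \<Rightarrow> bool) \<Rightarrow> bool" where
  "dec P \<longleftrightarrow> computable (\<lambda>x. if P x then 1 else 0)"

named_theorems comp_intros

lemma computable_ncomp: "computable f \<longleftrightarrow> ncomp 1 (\<lambda>xs. f (xs ! 0))"
proof
  assume "computable f"
  then obtain p where p: "\<And>x. computes p [x] (f x)" unfolding computable_def by blast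
  have "computes p xs (f (xs ! 0))" if "length xs = 1" for xs
    using that p by (auto simp: length_Suc_conv)
  then show "ncomp 1 (\<lambda>xs. f (xs ! 0))" unfolding ncomp_def by blast
next
  assume "ncomp 1 (\<lambda>xs. f (xs ! 0))"
  then obtain p where p: "\<And>xs. length xs = 1 \<Longrightarrow> computes p xs (f (xs ! 0))"
    unfolding ncomp_def by blast
  have "computes p [x] (f x)" for x using p[of "[x]"] by simp
  then show "computable f" unfolding computable_def by blast
qed

lemma computable_comp: "computable f \<Longrightarrow> computable g \<Longrightarrow> computable (\<lambda>x. f (g x))"
  unfolding computable_ncomp
  using ncomp_subst1[of "\<lambda>xs. f (xs ! 0)" 1 "\<lambda>xs. g (xs ! 0)"] by simp

lemma computable_id [comp_intros]: "computable (\<lambda>x. x)"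
  and computable_const [comp_intros]: "computable (\<lambda>x. c)"
  and computable_Suc [comp_intros]: "computable f \<Longrightarrow> computable (\<lambda>x. Suc (f x))"
  and computable_add [comp_intros]:
    "computable f \<Longrightarrow> computable g \<Longrightarrow> computable (\<lambda>x. f x + g x)"
  and computable_diff [comp_intros]:
    "computable f \<Longrightarrow> computable g \<Longrightarrow> computable (\<lambda>x. f x - g x)"
  and computable_pair [comp_intros]:
    "computable f \<Longrightarrow> computable g \<Longrightarrow> computable (\<lambda>x. pair (f x) (g x))"
  and computable_pfst [comp_intros]: "computable f \<Longrightarrow> computable (\<lambda>x. pfst (f x))"
  and computable_psnd [comp_intros]: "computable f \<Longrightarrow> computable (\<lambda>x. psnd (f x))"
  unfolding computable_ncomp
  by (intro ncomp_nth ncomp_const ncomp_Suc ncomp_add ncomp_diff ncomp_pair ncomp_pfst ncomp_psnd;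
      simp)+

text \<open>Several arguments are packed into one by pairing. The premise uncurries \<open>F\<close>
  with \<open>pfst\<close> and \<open>psnd\<close>, the form in which the rules in
  \<open>comp_intros\<close> present a bound variable to the body; thus \<open>intro\<close> can
  pass below binders.\<close>

lemma computable_app2:
  assumes "computable (\<lambda>z. F (pfst z) (psnd z))" "computable f" "computable g"
  shows "computable (\<lambda>x. F (f x) (g x))"
  using computable_comp[OF assms(1), of "\<lambda>x. pair (f x) (g x)"] assms(2,3)
  by (simp add: computable_pair)

lemma computable_app3:
  assumes "computable (\<lambda>z. F (pfst z) (pfst (psnd z)) (psnd (psnd z)))"
    "computable f" "computable g" "computable h"
  shows "computable (\<lambda>x. F (f x) (g x) (h x))"
  using computable_comp[OF assms(1), of "\<lambda>x. pair (f x) (pair (g x) (h x))"] assms(2-)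
  by (simp add: computable_pair)

lemma computable_app4:
  assumes "computable (\<lambda>z. F (pfst z) (pfst (psnd z)) (pfst (psnd (psnd z))) (psnd (psnd (psnd z))))"
    "computable f" "computable g" "computable h" "computable k"
  shows "computable (\<lambda>x. F (f x) (g x) (h x) (k x))"
  using computable_comp[OF assms(1), of "\<lambda>x. pair (f x) (pair (g x) (pair (h x) (k x)))"] assms(2-)
  by (simp add: computable_pair)

lemma dec_comp: "dec P \<Longrightarrow> computable g \<Longrightarrow> dec (\<lambda>x. P (g x))"
  unfolding dec_def using computable_comp[of "\<lambda>x. if P x then 1 else 0" g] by simp

lemma dec_app2:
  assumes "dec (\<lambda>z. P (pfst z) (psnd z))" "computable f" "computable g"
  shows "dec (\<lambda>x. P (f x) (g x))"
  using dec_comp[OF assms(1), of "\<lambda>x. pair (f x) (g x)"] assms(2-) by (simp add: computable_pair)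

lemma dec_app3:
  assumes "dec (\<lambda>z. P (pfst z) (pfst (psnd z)) (psnd (psnd z)))"
    "computable f" "computable g" "computable h"
  shows "dec (\<lambda>x. P (f x) (g x) (h x))"
  using dec_comp[OF assms(1), of "\<lambda>x. pair (f x) (pair (g x) (h x))"] assms(2-)
  by (simp add: computable_pair)

lemma computable_rec [comp_intros]:
  assumes a: "computable a" and m: "computable m"
    and g: "computable (\<lambda>z. g (pfst z) (pfst (psnd z)) (psnd (psnd z)))"
  shows "computable (\<lambda>x. rec_nat (a x) (g x) (m x))"
proof -
  have "ncomp (Suc (Suc 1)) (\<lambda>ys. g (ys ! 2) (ys ! 0) (ys ! 1))"
    using ncomp_subst1[OF g[unfolded computable_ncomp],
        where f = "\<lambda>ys. pair (ys ! 2) (pair (ys ! 0) (ys ! 1))"]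
    by (simp add: ncomp_pair ncomp_nth)
  from ncomp_rec[OF a[unfolded computable_ncomp] this m[unfolded computable_ncomp]]
  show ?thesis unfolding computable_ncomp by simp
qed

lemma computable_Least:
  assumes P: "dec (\<lambda>z. P (pfst z) (psnd z))" and ex: "\<And>x. \<exists>y. P x y"
  shows "computable (\<lambda>x. LEAST y. P x y)"
proof -
  \<comment> \<open>\<open>Mu\<close> looks for a zero and passes its search variable first, hence
    the negated characteristic function and, below, the swapped pair.\<close>
  let ?f = "\<lambda>z. 1 - (if P (pfst z) (psnd z) then 1 else 0)"
  have "computable ?f"
    using P unfolding dec_def by (intro comp_intros)
  then have "ncomp 2 (\<lambda>ys. ?f (pair (ys ! 1) (ys ! 0)))"
    unfolding computable_ncomp
    using ncomp_subst1[of "\<lambda>xs. ?f (xs ! 0)" 2 "\<lambda>ys. pair (ys ! 1) (ys ! 0)"]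
    by (simp add: ncomp_pair ncomp_nth)
  then obtain p where p: "\<And>ys. length ys = 2 \<Longrightarrow> computes p ys (?f (pair (ys ! 1) (ys ! 0)))"
    unfolding ncomp_def by blast
  have q: "computes p [m, x] (if P x m then 0 else 1)" for m x
    using p[of "[m, x]"] by (auto split: if_splits)
  have "computes (Mu p) [x] (LEAST y. P x y)" for x
  proof (rule computes.Mu)
    have "P x (LEAST y. P x y)" using ex by (metis LeastI)
    then show "computes p [LEAST y. P x y, x] 0"
      using q[of "LEAST y. P x y" x] by simp
    show "\<forall>m<LEAST y. P x y. \<exists>y>0. computes p [m, x] y"
    proof (intro allI impI)
      fix m
      assume "m < (LEAST y. P x y)"
      then have "\<not> P x m" using not_less_Least by blast
      then show "\<exists>y>0. computes p [m, x] y" using q[of m x] by auto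
    qed
  qed
  then show ?thesis unfolding computable_def by blast
qed

lemma computable_if_zero:
  assumes "computable f" "computable g" "computable h"
  shows "computable (\<lambda>x. if f x = 0 then g x else h x)"
  using assms unfolding computable_ncomp by (rule ncomp_if_zero)

lemma computable_if [comp_intros]:
  assumes "dec P" "computable f" "computable g"
  shows "computable (\<lambda>x. if P x then f x else g x)"
  using computable_if_zero[OF assms(1)[unfolded dec_def] assms(3,2)]
  by (rule back_subst[of computable]) auto

lemma dec_const [comp_intros]: "dec (\<lambda>x. b)"
  unfolding dec_def by (rule comp_intros)

lemma dec_not [comp_intros]: "dec P \<Longrightarrow> dec (\<lambda>x. \<not> P x)"
  using computable_if[of P "\<lambda>_. 0" "\<lambda>_. 1"] unfolding dec_def[of "\<lambda>x. \<not> P x"]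
  by (auto simp: if_distrib computable_const cong: if_cong elim!: back_subst[of computable])

lemma dec_if [comp_intros]:
  assumes "dec P" "dec Q" "dec R"
  shows "dec (\<lambda>x. if P x then Q x else R x)"
  using computable_if[OF assms(1) assms(2,3)[unfolded dec_def]] unfolding dec_def
  by (rule back_subst[of computable]) auto

lemma dec_conj [comp_intros]: "dec P \<Longrightarrow> dec Q \<Longrightarrow> dec (\<lambda>x. P x \<and> Q x)"
  using dec_if[of P Q "\<lambda>x. False"]
  by (rule back_subst[of dec]) (auto intro: dec_const)

lemma dec_disj [comp_intros]: "dec P \<Longrightarrow> dec Q \<Longrightarrow> dec (\<lambda>x. P x \<or> Q x)"
  using dec_not[OF dec_conj[of "\<lambda>x. \<not> P x" "\<lambda>x. \<not> Q x"]] by (simp add: dec_not)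

lemma dec_imp [comp_intros]: "dec P \<Longrightarrow> dec Q \<Longrightarrow> dec (\<lambda>x. P x \<longrightarrow> Q x)"
  unfolding imp_conv_disj by (intro comp_intros)

lemma dec_le [comp_intros]:
  assumes "computable f" "computable g"
  shows "dec (\<lambda>x. f x \<le> g x)"
  unfolding dec_def using computable_if_zero[OF computable_diff[OF assms], of "\<lambda>_. 1" "\<lambda>_. 0"]
  by (simp add: computable_const)

lemma dec_less [comp_intros]: "computable f \<Longrightarrow> computable g \<Longrightarrow> dec (\<lambda>x. f x < g x)"
  unfolding not_le[symmetric] by (intro comp_intros)

lemma dec_eq [comp_intros]: "computable f \<Longrightarrow> computable g \<Longrightarrow> dec (\<lambda>x. f x = g x)"
  unfolding order_eq_iff by (intro comp_intros)

lemma dec_iff [comp_intros]: "dec P \<Longrightarrow> dec Q \<Longrightarrow> dec (\<lambda>x. P x \<longleftrightarrow> Q x)"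
  unfolding iff_conv_conj_imp by (intro comp_intros)

lemma dec_bex [comp_intros]:
  assumes f: "computable f" and P: "dec (\<lambda>z. P (pfst z) (psnd z))"
  shows "dec (\<lambda>x. \<exists>i. i < f x \<and> P x i)"
proof -
  have P': "dec (\<lambda>x. P (g x) (h x))" if "computable g" "computable h" for g h
    by (rule dec_app2[OF P that])
  let ?r = "\<lambda>x n. rec_nat 0 (\<lambda>n r. if P x n then 1 else r) n"
  have eq: "?r x n = (if \<exists>i<n. P x i then 1 else 0)" for x n
    by (induction n) (auto simp: less_Suc_eq)
  have "computable (\<lambda>x. ?r x (f x))"
    by (intro comp_intros f P')
  then show ?thesis unfolding dec_def eq .
qed

lemma dec_ball [comp_intros]:
  assumes "computable f" "dec (\<lambda>z. P (pfst z) (psnd z))"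
  shows "dec (\<lambda>x. \<forall>i. i < f x \<longrightarrow> P x i)"
  using dec_not[OF dec_bex[OF assms(1) dec_not[OF assms(2)]]] by simp

lemma dec_bex_le [comp_intros]:
  "computable f \<Longrightarrow> dec (\<lambda>z. P (pfst z) (psnd z)) \<Longrightarrow> dec (\<lambda>x. \<exists>i. i \<le> f x \<and> P x i)"
  unfolding less_Suc_eq_le[symmetric] by (intro comp_intros)

lemma dec_ball_le [comp_intros]:
  "computable f \<Longrightarrow> dec (\<lambda>z. P (pfst z) (psnd z)) \<Longrightarrow> dec (\<lambda>x. \<forall>i. i \<le> f x \<longrightarrow> P x i)"
  unfolding less_Suc_eq_le[symmetric] by (intro comp_intros)

lemma computable_mult [comp_intros]:
  assumes "computable f" "computable g"
  shows "computable (\<lambda>x. f x * g x)"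
proof -
  have "computable (\<lambda>x. rec_nat 0 (\<lambda>n r. r + f x) (g x))"
    by (intro comp_intros computable_comp[OF assms(1)] assms(2))
  moreover have "rec_nat 0 (\<lambda>n r. r + a) b = a * b" for a b :: nat by (induction b) auto
  ultimately show ?thesis by simp
qed

lemma computable_power2 [comp_intros]:
  assumes "computable f"
  shows "computable (\<lambda>x. 2 ^ f x)"
proof -
  have "computable (\<lambda>x. rec_nat 1 (\<lambda>n r. r * 2) (f x))"
    by (intro comp_intros assms)
  moreover have "rec_nat 1 (\<lambda>n r. r * 2) b = (2 ^ b :: nat)" for b by (induction b) auto
  ultimately show ?thesis by simp
qed

lemma computable_sum [comp_intros]:
  assumes m: "computable m" and f: "computable (\<lambda>z. f (pfst z) (psnd z))"
  shows "computable (\<lambda>x. \<Sum>i<m x. f x i)"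
proof -
  have f': "computable (\<lambda>x. f (g x) (h x))" if "computable g" "computable h" for g h
    by (rule computable_app2[OF f that])
  have "computable (\<lambda>x. rec_nat 0 (\<lambda>n r. r + f x n) (m x))"
    by (intro comp_intros m f')
  moreover have "rec_nat 0 (\<lambda>n r. r + f x n) b = (\<Sum>i<b. f x i)" for x b by (induction b) auto
  ultimately show ?thesis by simp
qed

text \<open>\<open>q\<close> and \<open>r\<close> come from the quotient, which is odd, and the
  remainder of \<open>s\<close> by \<open>2 ^ i\<close>. With both searches bounded, membership
  reduces to arithmetic already known to be computable.\<close>

lemma mem_set_decode: "i \<in> set_decode s \<longleftrightarrow> (\<exists>q. q < Suc s \<and> (\<exists>r. r < 2 ^ i \<and> s = (2 * q + 1) * 2 ^ i + r))"
proof
  assume "i \<in> set_decode s"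
  then have "odd (s div 2 ^ i)" by (simp add: set_decode_def)
  then obtain q where q: "s div 2 ^ i = 2 * q + 1" by (rule oddE)
  have "s = (2 * q + 1) * 2 ^ i + s mod 2 ^ i"
    using div_mult_mod_eq[of s "2 ^ i"] q by simp
  moreover have "q < Suc s"
  proof -
    have "2 * q + 1 \<le> s" using q by (metis div_le_dividend)
    then show ?thesis by simp
  qed
  ultimately show "\<exists>q. q < Suc s \<and> (\<exists>r. r < 2 ^ i \<and> s = (2 * q + 1) * 2 ^ i + r)"
    by (meson mod_less_divisor zero_less_numeral zero_less_power)
next
  assume "\<exists>q. q < Suc s \<and> (\<exists>r. r < 2 ^ i \<and> s = (2 * q + 1) * 2 ^ i + r)"
  then obtain q r where "r < 2 ^ i" "s = (2 * q + 1) * 2 ^ i + r" by blast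
  then have "s div 2 ^ i = 2 * q + 1" by (intro div_nat_eqI) (simp_all add: algebra_simps)
  then show "i \<in> set_decode s" by (simp add: set_decode_def)
qed

lemma dec_mem [comp_intros]:
  assumes "computable f" "computable g"
  shows "dec (\<lambda>x. f x \<in> set_decode (g x))"
  by (rule dec_app2[OF _ assms]) (unfold mem_set_decode, intro comp_intros)

lemma set_decode_less:
  assumes "i \<in> set_decode s" shows "i < s"
proof -
  from assms obtain q r where "s = (2 * q + 1) * 2 ^ i + r" unfolding mem_set_decode by blast
  then have "(2::nat) ^ i \<le> s" by simp
  then show ?thesis using less_exp[of i] by linarith
qed

lemma dec_bex_set [comp_intros]:
  "computable f \<Longrightarrow> dec (\<lambda>z. P (pfst z) (psnd z)) \<Longrightarrow> dec (\<lambda>x. \<exists>i\<in>set_decode (f x). P x i)"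
proof -
  assume *: "computable f" "dec (\<lambda>z. P (pfst z) (psnd z))"
  have "dec (\<lambda>x. \<exists>i. i < f x \<and> (i \<in> set_decode (f x) \<and> P x i))"
    by (intro comp_intros * computable_comp[OF *(1)])
  then show ?thesis
    by (rule back_subst[of dec]) (auto dest: set_decode_less)
qed

lemma dec_ball_set [comp_intros]:
  "computable f \<Longrightarrow> dec (\<lambda>z. P (pfst z) (psnd z)) \<Longrightarrow> dec (\<lambda>x. \<forall>i\<in>set_decode (f x). P x i)"
  using dec_not[OF dec_bex_set[of f "\<lambda>x i. \<not> P x i"]] by (simp add: dec_not)

definition simage :: "(nat \<Rightarrow> nat) \<Rightarrow> nat \<Rightarrow> nat" where
  "simage f s = set_encode (f ` set_decode s)"

lemma set_decode_simage [simp]: "set_decode (simage f s) = f ` set_decode s"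
  by (simp add: simage_def)

lemma computable_set_encode [comp_intros]:
  assumes m: "computable m" and P: "dec (\<lambda>z. P (pfst z) (psnd z))"
  shows "computable (\<lambda>x. set_encode {i. i < m x \<and> P x i})"
proof -
  have P': "dec (\<lambda>x. P (g x) (h x))" if "computable g" "computable h" for g h
    by (rule dec_app2[OF P that])
  have "(\<Sum>i<n. if P x i then 2 ^ i else 0) = set_encode {i. i < n \<and> P x i}" for x n
    by (simp add: set_encode_def sum.If_cases Int_def)
  moreover have "computable (\<lambda>x. \<Sum>i<m x. if P x i then 2 ^ i else 0)"
    by (intro comp_intros m P')
  ultimately show ?thesis by simp
qed

lemma computable_set_union [comp_intros]:
  assumes "computable f" "computable g"
  shows "computable (\<lambda>x. set_encode (set_decode (f x) \<union> set_decode (g x)))"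
proof -
  have "computable (\<lambda>x. set_encode {i. i < f x + g x \<and> (i \<in> set_decode (f x) \<or> i \<in> set_decode (g x))})"
    by (intro comp_intros assms computable_comp[OF assms(1)] computable_comp[OF assms(2)])
  moreover have "{i. i < a + b \<and> (i \<in> set_decode a \<or> i \<in> set_decode b)} = set_decode a \<union> set_decode b"
    for a b by (auto dest: set_decode_less)
  ultimately show ?thesis by simp
qed

lemma computable_simage [comp_intros]:
  assumes s: "computable s" and f: "computable (\<lambda>z. f (pfst z) (psnd z))"
  shows "computable (\<lambda>x. simage (f x) (s x))"
proof -
  have f': "computable (\<lambda>x. f (g x) (h x))" if "computable g" "computable h" for g h
    by (rule computable_app2[OF f that])
  have s': "computable (\<lambda>x. s (g x))" if "computable g" for g by (rule computable_comp[OF s that])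
  \<comment> \<open>The image is accumulated as a sum of powers of two; the membership test prevents
    a value that \<open>f x\<close> takes twice from being added twice.\<close>
  let ?r = "\<lambda>x. rec_nat 0 (\<lambda>n r. if n \<in> set_decode (s x) \<and> \<not> f x n \<in> set_decode r
     then r + 2 ^ f x n else r)"
  have c: "computable (\<lambda>x. ?r x (s x))"
    by (intro comp_intros f' s' s)
  have "?r x n = set_encode (f x ` {i. i < n \<and> i \<in> set_decode (s x)})" for x n
  proof (induction n)
    case (Suc n)
    have *: "{i. i < Suc n \<and> i \<in> set_decode (s x)} =
      (if n \<in> set_decode (s x) then insert n {i. i < n \<and> i \<in> set_decode (s x)}
       else {i. i < n \<and> i \<in> set_decode (s x)})"
      by (auto simp: less_Suc_eq)
    show ?case
      using Suc by (auto simp: * set_encode_insert insert_absorb)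
  qed simp
  moreover have "{i. i < n \<and> i \<in> set_decode n} = set_decode n" for n by (auto dest: set_decode_less)
  ultimately have "?r x (s x) = simage (f x) (s x)" for x by (simp add: simage_def)
  with c show ?thesis by simp
qed

section \<open>Finite functions as sets of pairs\<close>

definition tab :: "nat \<Rightarrow> (nat \<Rightarrow> nat) \<Rightarrow> nat" where
  "tab n f = set_encode ((\<lambda>i. pair i (f i)) ` {..<n})"

text \<open>The alternative \<open>T \<le> v\<close> makes the search total. It does not disturb
  values stored in the table, since those lie below \<open>T\<close>.\<close>

definition look :: "nat \<Rightarrow> nat \<Rightarrow> nat" where
  "look T i = (LEAST v. pair i v \<in> set_decode T \<or> T \<le> v)"

lemma look_eq:
  assumes "pair i v \<in> set_decode T" "\<And>u. pair i u \<in> set_decode T \<Longrightarrow> u = v"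
  shows "look T i = v"
  unfolding look_def
proof (rule Least_equality)
  have "v < T" using set_decode_less[OF assms(1)] pair_ge(2)[of v i] by linarith
  then show "v \<le> y" if "pair i y \<in> set_decode T \<or> T \<le> y" for y using that assms(2) by auto
qed (use assms(1) in simp)

lemma look_tab [simp]: "i < n \<Longrightarrow> look (tab n f) i = f i"
  by (rule look_eq) (auto simp: tab_def)

lemma set_decode_range: "set_decode (2 ^ n - 1) = {..<n}"
proof -
  have "set_encode {..<n} = 2 ^ n - 1"
    by (induction n) (simp_all add: lessThan_Suc)
  then show ?thesis by (metis finite_lessThan set_encode_inverse)
qed

lemma computable_tab [comp_intros]:
  assumes "computable n" "computable (\<lambda>z. f (pfst z) (psnd z))"
  shows "computable (\<lambda>x. tab (n x) (f x))"
proof -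
  have "computable (\<lambda>x. simage (\<lambda>i. pair i (f x i)) (2 ^ n x - 1))"
    by (intro comp_intros assms)
  then show ?thesis
    by (simp only: simage_def set_decode_range tab_def)
qed

lemma computable_look [comp_intros]:
  assumes "computable f" "computable g"
  shows "computable (\<lambda>x. look (f x) (g x))"
proof -
  have "computable (\<lambda>z. look (pfst z) (psnd z))"
    unfolding look_def by (intro computable_Least comp_intros) auto
  from computable_app2[OF this assms] show ?thesis .
qed

text \<open>Well-founded recursion: the value is read off a finite table of argument-value pairs that is
  closed under the recursive calls and locally consistent; such a table is found by search.\<close>

lemma computable_wfrec:
  assumes D: "computable D" and G: "computable (\<lambda>z. G (pfst z) (psnd z))"
    and less: "\<And>x d. d \<in> set_decode (D x) \<Longrightarrow> m d < (m x :: nat)"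
    and rec: "\<And>x T. (\<And>d. d \<in> set_decode (D x) \<Longrightarrow> look T d = f d) \<Longrightarrow> G x T = f x"
  shows "computable f"
proof -
  \<comment> \<open>A table passing this local test can only store true values, by induction on the
    measure. The bound \<open>v<T\<close>, automatic for a stored pair, makes the test
    decidable.\<close>
  define ok where "ok T \<longleftrightarrow> (\<forall>e\<in>set_decode T. psnd e = G (pfst e) T \<and>
    (\<forall>d\<in>set_decode (D (pfst e)). \<exists>v<T. pair d v \<in> set_decode T))" for T
  define P where "P x T \<longleftrightarrow> ok T \<and> (\<exists>v. v < T \<and> pair x v \<in> set_decode T)" for x T
  have D': "computable (\<lambda>x. D (h x))" if "computable h" for h by (rule computable_comp[OF D that])
  have G': "computable (\<lambda>x. G (h x) (k x))" if "computable h" "computable k" for h k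
    by (rule computable_app2[OF G that])
  have dP: "dec (\<lambda>z. P (pfst z) (psnd z))"
    unfolding P_def ok_def by (intro comp_intros D' G')
  have ok_f: "v = f x" if "ok T" "pair x v \<in> set_decode T" for T x v
    using that(2)
  proof (induction "m x" arbitrary: x v rule: less_induct)
    case less
    have *: "v = G x T" "\<forall>d\<in>set_decode (D x). \<exists>v<T. pair d v \<in> set_decode T"
      using \<open>ok T\<close> less.prems unfolding ok_def by force+
    have "look T d = f d" if d: "d \<in> set_decode (D x)" for d
    proof -
      obtain v where "pair d v \<in> set_decode T" using *(2) d by blast
      moreover have "u = f d" if "pair d u \<in> set_decode T" for u
        using less.hyps[OF assms(3)[OF d] that] .
      ultimately show ?thesis by (intro look_eq) auto
    qed
    then have "G x T = f x" by (rule rec)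
    with *(1) show ?case by (rule trans)
  qed
  have ex: "\<exists>T. P x T" for x
  proof -
    \<comment> \<open>Each argument has finitely many calls and the measure decreases, so the
      arguments reachable from \<open>x\<close> form a finite set; the graph of \<open>f\<close> on
      such a set is a valid table.\<close>
    have "\<exists>S. finite S \<and> x \<in> S \<and> (\<forall>y\<in>S. set_decode (D y) \<subseteq> S)"
    proof (induction "m x" arbitrary: x rule: less_induct)
      case less
      have "\<exists>S. finite S \<and> d \<in> S \<and> (\<forall>y\<in>S. set_decode (D y) \<subseteq> S)"
        if "d \<in> set_decode (D x)" for d
        by (rule less.hyps[OF assms(3)[OF that]])
      then have "\<forall>d\<in>set_decode (D x). \<exists>S. finite S \<and> d \<in> S \<and> (\<forall>y\<in>S. set_decode (D y) \<subseteq> S)"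
        by blast
      from bchoice[OF this] obtain S where S: "\<forall>d\<in>set_decode (D x).
          finite (S d) \<and> d \<in> S d \<and> (\<forall>y\<in>S d. set_decode (D y) \<subseteq> S d)" ..
      let ?U = "insert x (\<Union>d\<in>set_decode (D x). S d)"
      have "finite ?U" using S by simp
      moreover have "set_decode (D y) \<subseteq> ?U" if y: "y \<in> ?U" for y
      proof (cases "y = x")
        case True
        then show ?thesis using S by auto
      next
        case False
        then obtain d where "d \<in> set_decode (D x)" "y \<in> S d" using y by blast
        then show ?thesis using S by blast
      qed
      ultimately show ?case by blast
    qed
    then obtain S where S: "finite S" "x \<in> S" "\<And>y. y \<in> S \<Longrightarrow> set_decode (D y) \<subseteq> S" by blast
    define T where "T = set_encode ((\<lambda>y. pair y (f y)) ` S)"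
    have T: "set_decode T = (\<lambda>y. pair y (f y)) ` S" using S(1) by (simp add: T_def)
    have l: "look T y = f y" if "y \<in> S" for y
      by (rule look_eq) (use that in \<open>auto simp: T\<close>)
    have b: "f y < T" if "y \<in> S" for y
      using set_decode_less[of "pair y (f y)" T] pair_ge(2)[of "f y" y] that by (auto simp: T)
    have "psnd e = G (pfst e) T \<and> (\<forall>d\<in>set_decode (D (pfst e)). \<exists>v<T. pair d v \<in> set_decode T)"
      if "e \<in> set_decode T" for e
    proof -
      obtain y where y: "e = pair y (f y)" "y \<in> S" using \<open>e \<in> set_decode T\<close> unfolding T by blast
      have "G y T = f y" by (rule rec) (use l S(3)[OF y(2)] in blast)
      moreover have "\<forall>d\<in>set_decode (D y). f d < T \<and> pair d (f d) \<in> set_decode T"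
        using S(3)[OF y(2)] b by (auto simp: T)
      ultimately show ?thesis unfolding y(1) by auto
    qed
    then have "ok T" unfolding ok_def by blast
    moreover have "f x < T \<and> pair x (f x) \<in> set_decode T" using S(2) b by (auto simp: T)
    ultimately have "P x T" unfolding P_def by blast
    then show ?thesis by (rule exI)
  qed
  have "look (LEAST T. P x T) x = f x" for x
  proof -
    have "P x (LEAST T. P x T)" by (rule LeastI_ex[OF ex])
    then obtain v where "pair x v \<in> set_decode (LEAST T. P x T)" "ok (LEAST T. P x T)"
      unfolding P_def by blast
    moreover from this have "pair x (f x) \<in> set_decode (LEAST T. P x T)" using ok_f by metis
    ultimately show ?thesis by (intro look_eq ok_f)
  qed
  moreover have "computable (\<lambda>x. look (LEAST T. P x T) x)"
    by (intro comp_intros computable_Least dP ex)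
  ultimately show ?thesis by simp
qed


section \<open>Types of coloured subsets of the line\<close>

definition pr3 :: "nat \<Rightarrow> nat \<Rightarrow> nat \<Rightarrow> nat" where "pr3 x l y = pair x (pair l y)"
definition fst3 :: "nat \<Rightarrow> nat" where "fst3 e = pfst e"
definition snd3 :: "nat \<Rightarrow> nat" where "snd3 e = pfst (psnd e)"
definition trd3 :: "nat \<Rightarrow> nat" where "trd3 e = psnd (psnd e)"

lemma pr3_simps [simp]: "fst3 (pr3 x l y) = x" "snd3 (pr3 x l y) = l" "trd3 (pr3 x l y) = y"
  "pr3 x l y = pr3 x' l' y' \<longleftrightarrow> x = x' \<and> l = l' \<and> y = y'"
  by (auto simp: pr3_def fst3_def snd3_def trd3_def)

definition uni :: "nat \<Rightarrow> nat \<Rightarrow> nat" where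
  "uni s t = set_encode (set_decode s \<union> set_decode t)"

lemma set_decode_uni [simp]: "set_decode (uni s t) = set_decode s \<union> set_decode t"
  by (simp add: uni_def)

text \<open>A letter codes a finite set: bit \<open>0\<close> says that the point is an integer (so integers have odd
  letters), bit \<open>Suc P\<close> that it belongs to the predicate \<open>P\<close>. The empty set has code \<open>0\<close> at every
  level.\<close>

primrec ty :: "(real \<Rightarrow> nat) \<Rightarrow> nat \<Rightarrow> real set \<Rightarrow> nat" where
  "ty c 0 X = 0"
| "ty c (Suc n) X =
    set_encode ((\<lambda>a. pr3 (ty c n (X \<inter> {..<a})) (c a) (ty c n (X \<inter> {a<..}))) ` X)"

lemma ty_empty [simp]: "ty c n {} = 0"
  by (cases n) auto

text \<open>A tower that exceeds every type of level \<open>n\<close> over letters below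
  \<open>L\<close>. It bounds the searches over types, and \<open>2 ^ tbound L n\<close> those over
  sets of types, in the decision procedure.\<close>

primrec tbound :: "nat \<Rightarrow> nat \<Rightarrow> nat" where
  "tbound L 0 = 1"
| "tbound L (Suc n) = 2 ^ pr3 (tbound L n) L (tbound L n)"

lemma set_encode_less:
  assumes "A \<subseteq> {..<k}" shows "set_encode A < 2 ^ k"
proof -
  have "set_encode A \<le> set_encode {..<k}"
    unfolding set_encode_def using assms by (intro sum_mono2) auto
  moreover have "set_encode {..<k} < 2 ^ k"
    by (metis finite_lessThan set_decode_range set_encode_inverse set_decode_inverse
        diff_less zero_less_one zero_less_power zero_less_numeral)
  ultimately show ?thesis by simp
qed

lemma pr3_less:
  assumes "x < a" "l < b" "y < d" shows "pr3 x l y < pr3 a b d"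
proof -
  have "pr3 x l y \<le> pr3 a b d"
    unfolding pr3_def using assms by (intro pair_mono) auto
  then show ?thesis using assms by (metis le_neq_implies_less pr3_simps(4) less_irrefl)
qed

lemma ty_less:
  assumes "range c \<subseteq> {..<L}" shows "ty c n X < tbound L n"
proof (induction n arbitrary: X)
  case (Suc n)
  have "(\<lambda>a. pr3 (ty c n (X \<inter> {..<a})) (c a) (ty c n (X \<inter> {a<..}))) ` X
      \<subseteq> {..<pr3 (tbound L n) L (tbound L n)}"
    using Suc assms by (auto intro!: pr3_less)
  from set_encode_less[OF this] show ?case by simp
qed simp

lemma set_decode_ty:
  assumes "finite (range c)"
  shows "set_decode (ty c (Suc n) X) =
    (\<lambda>a. pr3 (ty c n (X \<inter> {..<a})) (c a) (ty c n (X \<inter> {a<..}))) ` X"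
proof -
  obtain L where L: "range c \<subseteq> {..<L}" using assms by (auto simp: finite_nat_set_iff_bounded)
  have "(\<lambda>a. pr3 (ty c n (X \<inter> {..<a})) (c a) (ty c n (X \<inter> {a<..}))) ` X
      \<subseteq> {..<pr3 (tbound L n) L (tbound L n)}"
    using L ty_less[OF L] by (auto intro!: pr3_less)
  then have "finite ((\<lambda>a. pr3 (ty c n (X \<inter> {..<a})) (c a) (ty c n (X \<inter> {a<..}))) ` X)"
    using finite_subset by blast
  then show ?thesis by simp
qed

text \<open>This invariance allows colourings to be scaled and translated; no metric information
  survives in a type.\<close>

lemma ty_iso:
  assumes "\<And>a b. a \<in> X \<Longrightarrow> b \<in> X \<Longrightarrow> a < b \<Longrightarrow> f a < f b" "\<And>a. a \<in> X \<Longrightarrow> c' (f a) = c a"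
  shows "ty c' n (f ` X) = ty c n X"
  using assms
proof (induction n arbitrary: X)
  case (Suc n)
  have lt: "f b < f a \<longleftrightarrow> b < a" if "a \<in> X" "b \<in> X" for a b
    using Suc.prems(1)[of a b] Suc.prems(1)[of b a] that by (metis linorder_neqE less_asym)
  have "f ` X \<inter> {..<f a} = f ` (X \<inter> {..<a}) \<and> f ` X \<inter> {f a<..} = f ` (X \<inter> {a<..})"
    if "a \<in> X" for a
    using lt that by blast
  moreover have "ty c' n (f ` (X \<inter> Y)) = ty c n (X \<inter> Y)" for Y
    by (rule Suc.IH) (use Suc.prems in auto)
  ultimately show ?case
    using Suc.prems(2) by (simp add: image_image cong: image_cong_simp)
qed simp

lemma ty_cong: "(\<And>a. a \<in> X \<Longrightarrow> c' a = c a) \<Longrightarrow> ty c' n X = ty c n X"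
  using ty_iso[of X id c' c n] by simp

text \<open>The arguments may be types of any level at least \<open>n\<close>; the result is the type at level \<open>n\<close>. In
  particular \<open>cat n s 0\<close> truncates \<open>s\<close> to level \<open>n\<close>.\<close>

primrec cat :: "nat \<Rightarrow> nat \<Rightarrow> nat \<Rightarrow> nat" where
  "cat 0 s t = 0"
| "cat (Suc n) s t =
    uni (simage (\<lambda>e. pr3 (cat n 0 (fst3 e)) (snd3 e) (cat n (trd3 e) t)) s)
        (simage (\<lambda>e. pr3 (cat n s (fst3 e)) (snd3 e) (cat n (trd3 e) 0)) t)"

text \<open>The triples contributed by the points of a block of type \<open>E\<close> that sits in a
  larger set, with a part of type \<open>p\<close> below it and one of type \<open>q\<close> above.
  The infinite sums below are unions of such contributions.\<close>

definition ext :: "nat \<Rightarrow> nat \<Rightarrow> nat \<Rightarrow> nat \<Rightarrow> nat" where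
  "ext n p q E = simage (\<lambda>e. pr3 (cat n p (fst3 e)) (snd3 e) (cat n (trd3 e) q)) E"

text \<open>The limits are only meaningful for idempotent \<open>e\<close>: then a finite nonempty initial part of the
  sum again has type \<open>e\<close>. The argument \<open>E\<close> of a shuffle is the union of the types of its components,
  which are read as sets of triples.\<close>

primrec omega :: "nat \<Rightarrow> nat \<Rightarrow> nat" where
  "omega 0 e = 0"
| "omega (Suc n) e = uni (ext n 0 (omega n e) e) (ext n e (omega n e) e)"

primrec omega_rev :: "nat \<Rightarrow> nat \<Rightarrow> nat" where
  "omega_rev 0 e = 0"
| "omega_rev (Suc n) e = uni (ext n (omega_rev n e) 0 e) (ext n (omega_rev n e) e e)"

primrec shuffle :: "nat \<Rightarrow> nat \<Rightarrow> nat" where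
  "shuffle 0 E = 0"
| "shuffle (Suc n) E = ext n (shuffle n E) (shuffle n E) E"

text \<open>A triple of a type of level \<open>Suc m\<close> carries types of level
  \<open>m\<close>, and lowering the level changes the code. Allowing any level from
  \<open>n\<close> upwards avoids explicit truncations in the inductions.\<close>

definition rep :: "(real \<Rightarrow> nat) \<Rightarrow> nat \<Rightarrow> nat \<Rightarrow> real set \<Rightarrow> bool" where
  "rep c n t X \<longleftrightarrow> (\<exists>m\<ge>n. t = ty c m X)"

lemma rep_ty: "n \<le> m \<Longrightarrow> rep c n (ty c m X) X"
  unfolding rep_def by blast

lemma rep_empty [simp]: "rep c n 0 {}"
  unfolding rep_def by auto

lemma rep_mono: "rep c n t X \<Longrightarrow> m \<le> n \<Longrightarrow> rep c m t X"
  unfolding rep_def by (metis order_trans)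

lemma rep_SucE:
  assumes "rep c (Suc n) t X"
  obtains m where "n \<le> m" "t = ty c (Suc m) X"
  using assms unfolding rep_def by (metis Suc_le_D Suc_le_mono)

definition below :: "real set \<Rightarrow> real set \<Rightarrow> bool" where
  "below X Y \<longleftrightarrow> (\<forall>a\<in>X. \<forall>b\<in>Y. a < b)"

lemma below_empty [simp]: "below {} X" "below X {}"
  by (auto simp: below_def)

section \<open>Correctness of the operations on types\<close>

context
  fixes c :: "real \<Rightarrow> nat"
  assumes fin: "finite (range c)"
begin

text \<open>Removing a point of \<open>X\<close> from \<open>X \<union> Y\<close> leaves a part of
  \<open>X\<close> below it and a part of \<open>X\<close> followed by \<open>Y\<close> above it,
  and similarly for a point of \<open>Y\<close>; these are again concatenations, at one level
  less.\<close>

lemma cat_ty: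
  assumes "rep c n s X" "rep c n t Y" "below X Y"
  shows "cat n s t = ty c n (X \<union> Y)"
  using assms
proof (induction n arbitrary: s t X Y)
  case (Suc n)
  obtain k where k: "n \<le> k" "s = ty c (Suc k) X" using Suc.prems(1) by (rule rep_SucE)
  obtain m where m: "n \<le> m" "t = ty c (Suc m) Y" using Suc.prems(2) by (rule rep_SucE)
  have s: "rep c n s X" and t: "rep c n t Y" using Suc.prems by (auto intro: rep_mono)
  have 1: "pr3 (cat n 0 (ty c k (X \<inter> {..<a}))) (c a) (cat n (ty c k (X \<inter> {a<..})) t) =
      pr3 (ty c n ((X \<union> Y) \<inter> {..<a})) (c a) (ty c n ((X \<union> Y) \<inter> {a<..}))" if "a \<in> X" for a
  proof -
    have "(X \<union> Y) \<inter> {..<a} = {} \<union> (X \<inter> {..<a})" "(X \<union> Y) \<inter> {a<..} = (X \<inter> {a<..}) \<union> Y"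
      using Suc.prems(3) that unfolding below_def by fastforce+
    moreover have "cat n 0 (ty c k (X \<inter> {..<a})) = ty c n ({} \<union> (X \<inter> {..<a}))"
      by (rule Suc.IH) (auto simp: k rep_ty)
    moreover have "cat n (ty c k (X \<inter> {a<..})) t = ty c n ((X \<inter> {a<..}) \<union> Y)"
      by (rule Suc.IH[OF rep_ty[OF k(1)] t]) (use Suc.prems(3) in \<open>auto simp: below_def\<close>)
    ultimately show ?thesis by simp
  qed
  have 2: "pr3 (cat n s (ty c m (Y \<inter> {..<a}))) (c a) (cat n (ty c m (Y \<inter> {a<..})) 0) =
      pr3 (ty c n ((X \<union> Y) \<inter> {..<a})) (c a) (ty c n ((X \<union> Y) \<inter> {a<..}))" if "a \<in> Y" for a
  proof -
    have "(X \<union> Y) \<inter> {a<..} = (Y \<inter> {a<..}) \<union> {}" "(X \<union> Y) \<inter> {..<a} = X \<union> (Y \<inter> {..<a})"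
      using Suc.prems(3) that unfolding below_def by fastforce+
    moreover have "cat n (ty c m (Y \<inter> {a<..})) 0 = ty c n ((Y \<inter> {a<..}) \<union> {})"
      by (rule Suc.IH) (auto simp: m rep_ty)
    moreover have "cat n s (ty c m (Y \<inter> {..<a})) = ty c n (X \<union> (Y \<inter> {..<a}))"
      by (rule Suc.IH[OF s rep_ty[OF m(1)]]) (use Suc.prems(3) in \<open>auto simp: below_def\<close>)
    ultimately show ?thesis by simp
  qed
  have "set_decode (cat (Suc n) s t) = set_decode (ty c (Suc n) (X \<union> Y))"
    by (simp add: k(2) m(2) set_decode_ty[OF fin] image_Un image_image
        1[unfolded m(2)] 2[unfolded k(2)] cong: image_cong_simp del: ty.simps)
  then show ?case by (metis set_decode_inverse)
qed simp

text \<open>A point of block \<open>k\<close> has below it \<open>P k\<close> and the lower part of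
  its block, above it the upper part and \<open>Q k\<close>, so its triple is determined by its
  triple in the block and the two surrounding types. The index set may list a block repeatedly;
  \<open>ty_shuffle\<close> exploits this by indexing fibres by their points.\<close>

lemma ty_blocks:
  assumes X: "X = (\<Union>k\<in>K. B k)"
    and split: "\<And>k. k \<in> K \<Longrightarrow> X = P k \<union> B k \<union> Q k"
    and below: "\<And>k. k \<in> K \<Longrightarrow> below (P k) (B k)" "\<And>k. k \<in> K \<Longrightarrow> below (B k) (Q k)"
    and rep: "\<And>k. k \<in> K \<Longrightarrow> rep c n (p k) (P k)" "\<And>k. k \<in> K \<Longrightarrow> rep c n (q k) (Q k)"
      "\<And>k. k \<in> K \<Longrightarrow> rep c (Suc n) (t k) (B k)"
  shows "set_decode (ty c (Suc n) X) = (\<Union>k\<in>K. set_decode (ext n (p k) (q k) (t k)))"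
proof -
  have "(\<lambda>a. pr3 (ty c n (X \<inter> {..<a})) (c a) (ty c n (X \<inter> {a<..}))) ` B k =
      set_decode (ext n (p k) (q k) (t k))" if k: "k \<in> K" for k
  proof -
    obtain m where m: "n \<le> m" "t k = ty c (Suc m) (B k)" using rep(3)[OF k] by (rule rep_SucE)
    have "ty c n (X \<inter> {..<a}) = cat n (p k) (ty c m (B k \<inter> {..<a})) \<and>
        ty c n (X \<inter> {a<..}) = cat n (ty c m (B k \<inter> {a<..})) (q k)" if a: "a \<in> B k" for a
    proof -
      have "X \<inter> {..<a} = P k \<union> (B k \<inter> {..<a})" "X \<inter> {a<..} = (B k \<inter> {a<..}) \<union> Q k"
        using below[OF k] a split[OF k] by (force simp: below_def)+
      moreover have "cat n (p k) (ty c m (B k \<inter> {..<a})) = ty c n (P k \<union> (B k \<inter> {..<a}))"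
        by (rule cat_ty[OF rep(1)[OF k] rep_ty[OF m(1)]]) (use below[OF k] in \<open>auto simp: below_def\<close>)
      moreover have "cat n (ty c m (B k \<inter> {a<..})) (q k) = ty c n ((B k \<inter> {a<..}) \<union> Q k)"
        by (rule cat_ty[OF rep_ty[OF m(1)] rep(2)[OF k]]) (use below[OF k] in \<open>auto simp: below_def\<close>)
      ultimately show ?thesis by simp
    qed
    then show ?thesis
      by (simp add: ext_def m(2) set_decode_ty[OF fin] image_image cong: image_cong_simp del: ty.simps)
  qed
  moreover have "set_decode (ty c (Suc n) X) =
      (\<Union>k\<in>K. (\<lambda>a. pr3 (ty c n (X \<inter> {..<a})) (c a) (ty c n (X \<inter> {a<..}))) ` B k)"
  proof -
    have "F ` X = (\<Union>k\<in>K. F ` B k)" for F :: "real \<Rightarrow> nat" unfolding X by (rule image_UN)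
    then show ?thesis by (simp only: set_decode_ty[OF fin])
  qed
  ultimately show ?thesis by simp
qed

text \<open>Cut the sum into consecutive blocks: before the first block there is nothing, before
  every later one a segment of type \<open>e\<close>, and behind each block again an infinite sum of
  the same kind, handled by the induction hypothesis at a lower level.\<close>

lemma ty_omega:
  fixes x :: "nat \<Rightarrow> real"
  assumes x: "strict_mono x" and e: "\<And>i j. i < j \<Longrightarrow> ty c N {x i<..x j} = e" and "n \<le> N"
  shows "ty c n (\<Union>j. {x i<..x j}) = omega n e"
  using assms(3)
proof (induction n arbitrary: i)
  case (Suc n)
  let ?X = "\<lambda>i. \<Union>j. {x i<..x j}" and ?B = "\<lambda>j. {x j<..x (Suc j)}"
  have le: "x i \<le> x j \<longleftrightarrow> i \<le> j" for i j using x by (simp add: strict_mono_less_eq)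
  have ge: "\<exists>j\<ge>i. a \<in> ?B j" if "a \<in> ?X i" for a i
  proof -
    define k where "k = (LEAST k. a \<le> x k)"
    have k: "a \<le> x k" using that unfolding k_def by (auto intro: LeastI)
    have "x i < a" using that by auto
    then have "i < k" using k le[of k i] by linarith
    then obtain j where j: "k = Suc j" "i \<le> j" by (metis Suc_le_D Suc_leI Suc_le_mono)
    then have "\<not> a \<le> x j" using not_less_Least[of j "\<lambda>k. a \<le> x k"] by (simp add: k_def)
    then show ?thesis using j k by auto
  qed
  have sub: "?B j \<subseteq> ?X i" "{x i<..x j} \<subseteq> ?X i" "?X j \<subseteq> ?X i" if "i \<le> j" for i j
    using that le[of i j] by force+
  have "set_decode (ty c (Suc n) (?X i)) =
      (\<Union>j\<in>{i..}. set_decode (ext n (if j = i then 0 else e) (omega n e) e))"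
  proof (rule ty_blocks[where B = ?B and P = "\<lambda>j. {x i<..x j}" and Q = "\<lambda>j. ?X (Suc j)"])
    show "?X i = (\<Union>j\<in>{i..}. ?B j)"
    proof (intro equalityI subsetI)
      fix a assume "a \<in> ?X i"
      from ge[OF this] show "a \<in> (\<Union>j\<in>{i..}. ?B j)" by auto
    next
      fix a assume "a \<in> (\<Union>j\<in>{i..}. ?B j)"
      then obtain j where "i \<le> j" "a \<in> ?B j" by auto
      then show "a \<in> ?X i" using sub(1) by blast
    qed
    show "?X i = {x i<..x j} \<union> ?B j \<union> ?X (Suc j)" if "j \<in> {i..}" for j
    proof
      show "?X i \<subseteq> {x i<..x j} \<union> ?B j \<union> ?X (Suc j)"
      proof
        fix a assume "a \<in> ?X i"
        then obtain k where "x i < a" "a \<le> x k" by auto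
        then show "a \<in> {x i<..x j} \<union> ?B j \<union> ?X (Suc j)"
          by (cases "a \<le> x j"; cases "a \<le> x (Suc j)") auto
      qed
      show "{x i<..x j} \<union> ?B j \<union> ?X (Suc j) \<subseteq> ?X i"
        using that by (intro Un_least sub) auto
    qed
    show "rep c n (if j = i then 0 else e) {x i<..x j}" if "j \<in> {i..}" for j
      using that e[of i j] rep_ty[of n N c "{x i<..x j}"] Suc.prems by auto
    show "rep c n (omega n e) (?X (Suc j))" for j
      using rep_ty[of n n c "?X (Suc j)"] Suc by simp
    show "rep c (Suc n) e (?B j)" for j
      using rep_ty[OF Suc.prems, of c "?B j"] e[of j "Suc j"] by simp
  qed (auto simp: below_def)
  also have "\<dots> = set_decode (omega (Suc n) e)"
  proof -
    have "(\<Union>j\<in>{i..}. F (if j = i then 0 else e)) = F 0 \<union> F e" for F :: "nat \<Rightarrow> nat set"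
    proof -
      have "{i..} = insert i {Suc i..}" by auto
      moreover have "(\<Union>j\<in>{Suc i..}. F (if j = i then 0 else e)) = F e" by auto
      ultimately show ?thesis by simp
    qed
    from this[of "\<lambda>p. set_decode (ext n p (omega n e) e)"] show ?thesis by simp
  qed
  finally show ?case by (metis set_decode_inverse)
qed simp

lemma ty_omega_rev:
  fixes x :: "nat \<Rightarrow> real"
  assumes x: "\<And>i j. i < j \<Longrightarrow> x j < x i"
    and e: "\<And>i j. i < j \<Longrightarrow> ty c N {x j<..x i} = e" and "n \<le> N"
  shows "ty c n (\<Union>j. {x j<..x i}) = omega_rev n e"
  using assms(3)
proof (induction n arbitrary: i)
  case (Suc n)
  let ?X = "\<lambda>i. \<Union>j. {x j<..x i}" and ?B = "\<lambda>j. {x (Suc j)<..x j}"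
  have le: "x j \<le> x i \<longleftrightarrow> i \<le> j" for i j
    using x[of i j] x[of j i] by (cases i j rule: linorder_cases) auto
  have ge: "\<exists>j\<ge>i. a \<in> ?B j" if "a \<in> ?X i" for a i
  proof -
    define k where "k = (LEAST k. x k < a)"
    have k: "x k < a" using that unfolding k_def by (auto intro: LeastI)
    have "a \<le> x i" using that by auto
    then have "i < k" using k le[of i k] by (meson leI le not_le order_trans)
    then obtain j where j: "k = Suc j" "i \<le> j" by (metis Suc_le_D Suc_leI Suc_le_mono)
    then have "\<not> x j < a" using not_less_Least[of j "\<lambda>k. x k < a"] by (simp add: k_def)
    then show ?thesis using j k by auto
  qed
  have sub: "?B j \<subseteq> ?X i" "{x j<..x i} \<subseteq> ?X i" "?X j \<subseteq> ?X i" if "i \<le> j" for i j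
    using that le[of j i] by force+
  have "set_decode (ty c (Suc n) (?X i)) =
      (\<Union>j\<in>{i..}. set_decode (ext n (omega_rev n e) (if j = i then 0 else e) e))"
  proof (rule ty_blocks[where B = ?B and Q = "\<lambda>j. {x j<..x i}" and P = "\<lambda>j. ?X (Suc j)"])
    show "?X i = (\<Union>j\<in>{i..}. ?B j)"
    proof (intro equalityI subsetI)
      fix a assume "a \<in> ?X i"
      from ge[OF this] show "a \<in> (\<Union>j\<in>{i..}. ?B j)" by auto
    next
      fix a assume "a \<in> (\<Union>j\<in>{i..}. ?B j)"
      then obtain j where "i \<le> j" "a \<in> ?B j" by auto
      then show "a \<in> ?X i" using sub(1) by blast
    qed
    show "?X i = ?X (Suc j) \<union> ?B j \<union> {x j<..x i}" if "j \<in> {i..}" for j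
    proof
      show "?X i \<subseteq> ?X (Suc j) \<union> ?B j \<union> {x j<..x i}"
      proof
        fix a assume "a \<in> ?X i"
        then obtain k where "a \<le> x i" "x k < a" by auto
        then show "a \<in> ?X (Suc j) \<union> ?B j \<union> {x j<..x i}"
          by (cases "x j < a"; cases "x (Suc j) < a") auto
      qed
      show "?X (Suc j) \<union> ?B j \<union> {x j<..x i} \<subseteq> ?X i"
        using that by (intro Un_least sub) auto
    qed
    show "rep c n (if j = i then 0 else e) {x j<..x i}" if "j \<in> {i..}" for j
      using that e[of i j] rep_ty[of n N c "{x j<..x i}"] Suc.prems by auto
    show "rep c n (omega_rev n e) (?X (Suc j))" for j
      using rep_ty[of n n c "?X (Suc j)"] Suc by simp
    show "rep c (Suc n) e (?B j)" for j
      using rep_ty[OF Suc.prems, of c "?B j"] e[of j "Suc j"] by simp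
  qed (auto simp: below_def)
  also have "\<dots> = set_decode (omega_rev (Suc n) e)"
  proof -
    have "(\<Union>j\<in>{i..}. F (if j = i then 0 else e)) = F 0 \<union> F e" for F :: "nat \<Rightarrow> nat set"
    proof -
      have "{i..} = insert i {Suc i..}" by auto
      moreover have "(\<Union>j\<in>{Suc i..}. F (if j = i then 0 else e)) = F e" by auto
      ultimately show ?thesis by simp
    qed
    from this[of "\<lambda>q. set_decode (ext n (omega_rev n e) q e)"] show ?thesis by simp
  qed
  finally show ?case by (metis set_decode_inverse)
qed simp

text \<open>The components are the fibres of \<open>g\<close>. Cutting at one of them leaves two
  open stretches with the same set of component types, so both have the same shuffle type by
  induction. \<open>lo\<close> and \<open>hi\<close> restrict the density hypothesis to the part of
  the line where the condensation argument can guarantee it.\<close>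

lemma ty_shuffle:
  fixes g :: "real \<Rightarrow> real"
  assumes g: "mono g"
    and E: "\<And>u v. lo \<le> u \<Longrightarrow> v \<le> hi \<Longrightarrow> g u < g v \<Longrightarrow>
      (\<Union>x\<in>{x. g u < g x \<and> g x < g v}. set_decode (ty c N (g -` {g x}))) = set_decode E"
    and "n \<le> N" "lo \<le> u" "v \<le> hi" "g u < g v"
  shows "ty c n {x. g u < g x \<and> g x < g v} = shuffle n E"
  using assms(3-)
proof (induction n arbitrary: u v)
  case (Suc n)
  let ?X = "\<lambda>u v. {x. g u < g x \<and> g x < g v}" and ?B = "\<lambda>x. g -` {g x}"
  have lt: "x < y" if "g x < g y" for x y using that g by (meson leI monoD not_le)
  have "set_decode (ty c (Suc n) (?X u v)) =
      (\<Union>x\<in>?X u v. set_decode (ext n (shuffle n E) (shuffle n E) (ty c N (?B x))))"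
  proof (rule ty_blocks[where B = ?B and P = "\<lambda>x. ?X u x" and Q = "\<lambda>x. ?X x v"])
    show "rep c n (shuffle n E) (?X u x)" if "x \<in> ?X u v" for x
      using Suc.IH[of u x] Suc.prems lt[of x v] that rep_ty[of n n c "?X u x"] by auto
    show "rep c n (shuffle n E) (?X x v)" if "x \<in> ?X u v" for x
      using Suc.IH[of x v] Suc.prems lt[of u x] that rep_ty[of n n c "?X x v"] by auto
    show "rep c (Suc n) (ty c N (?B x)) (?B x)" for x
      using Suc.prems by (auto intro: rep_ty)
  qed (auto simp: below_def intro: lt)
  also have "\<dots> = (\<lambda>e. pr3 (cat n (shuffle n E) (fst3 e)) (snd3 e) (cat n (trd3 e) (shuffle n E))) `
      (\<Union>x\<in>?X u v. set_decode (ty c N (?B x)))"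
    by (simp add: ext_def image_UN)
  also have "\<dots> = set_decode (shuffle (Suc n) E)"
    by (subst E) (use Suc.prems in \<open>simp_all add: ext_def\<close>)
  finally show ?case by (metis set_decode_inverse)
qed simp

end

definition point_type :: "nat \<Rightarrow> nat" where
  "point_type l = set_encode {pr3 0 l 0}"

lemma ty_singleton: "ty c (Suc n) {a} = point_type (c a)"
  by (simp add: point_type_def)


section \<open>Types of intervals lie in every closed set\<close>

text \<open>An omega sum and a shuffle have no right end, so a point is appended to obtain a type of
  \<open>{a<..b}\<close>; a reversed omega sum already has one. For a shuffle, \<open>D\<close> is
  the set of component types: a point, or a point followed by a half-open interval, that is, a
  closed interval. The coded set handed to \<open>shuffle\<close> is the union of the members of
  \<open>D\<close>, whose elements are automatically below \<open>D\<close>.\<close>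

definition interval_closed :: "nat \<Rightarrow> nat \<Rightarrow> nat \<Rightarrow> bool" where
  "interval_closed N L S \<longleftrightarrow>
    (\<forall>s\<in>set_decode S. \<forall>t\<in>set_decode S. cat N s t \<in> set_decode S) \<and>
    (\<forall>s\<in>set_decode S. cat N s s = s \<longrightarrow> omega_rev N s \<in> set_decode S \<and>
      (\<forall>l. l < L \<longrightarrow> even l \<longrightarrow> cat N (omega N s) (point_type l) \<in> set_decode S)) \<and>
    (\<forall>D. D < 2 ^ tbound L N \<longrightarrow>
      (\<forall>d\<in>set_decode D. \<exists>l. l < L \<and> even l \<and> (d = point_type l \<or> (\<exists>s\<in>set_decode S. d = cat N (point_type l) s))) \<longrightarrow>
      (\<exists>l. l < L \<and> even l \<and> point_type l \<in> set_decode D) \<longrightarrow>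
      (\<forall>l. l < L \<longrightarrow> even l \<longrightarrow>
        cat N (shuffle N (set_encode {e. e < D \<and> (\<exists>d\<in>set_decode D. e \<in> set_decode d)})) (point_type l) \<in> set_decode S))"

lemma homogeneous_subsequence:
  fixes t :: "nat \<Rightarrow> nat \<Rightarrow> nat"
  assumes "\<And>i j. i < j \<Longrightarrow> t i j < B"
  obtains f :: "nat \<Rightarrow> nat" and e where "strict_mono f" "\<forall>i j. i < j \<longrightarrow> t (f i) (f j) = e"
proof -
  have "\<forall>x\<in>UNIV. \<forall>y\<in>UNIV. x \<noteq> y \<longrightarrow> (\<lambda>X. t (Min X) (Max X)) {x, y} < B"
    using assms by (auto simp: min_def max_def)
  from Ramsey2[OF infinite_UNIV_nat this]
  obtain Y e where Y: "infinite Y" "\<forall>x\<in>Y. \<forall>y\<in>Y. x \<noteq> y \<longrightarrow> t (Min {x, y}) (Max {x, y}) = e"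
    by auto
  have sm: "strict_mono (enumerate Y)"
    using Y(1) by (auto simp: strict_mono_def)
  have "t (enumerate Y i) (enumerate Y j) = e" if "i < j" for i j
  proof -
    have "enumerate Y i < enumerate Y j" using sm that by (simp add: strict_mono_def)
    then show ?thesis
      using Y(2) enumerate_in_set[OF Y(1), of i] enumerate_in_set[OF Y(1), of j]
      by (fastforce simp: min_def max_def)
  qed
  with sm show ?thesis by (intro that) auto
qed

text \<open>Choose nested intervals whose values under \<open>g\<close> shrink strictly at both
  ends, step \<open>n\<close> avoiding the value at the \<open>n\<close>-th rational. A common point
  lies in no fibre containing a rational, and a fibre of a monotone function with two points would
  contain one.\<close>

lemma singleton_fibre:
  fixes g :: "real \<Rightarrow> real"
  assumes g: "mono g" and dense: "\<And>u v. g u < g v \<Longrightarrow> \<exists>x. g u < g x \<and> g x < g v"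
    and uv: "g u < g v"
  shows "\<exists>x. g u < g x \<and> g x < g v \<and> g -` {g x} = {x}"
proof -
  have lt: "x < y" if "g x < g y" for x y using that g by (meson leI monoD not_le)
  define q :: "nat \<Rightarrow> real" where "q n = of_rat (nat_to_rat_surj n)" for n
  have step: "\<exists>w'. g (fst w') < g (snd w') \<and> g u < g (fst w') \<and> g (snd w') < g v \<and>
      (g r < g (fst w') \<or> g (snd w') < g r)"
    if uv: "g u < g v" for u v r
  proof -
    obtain z2 where z2: "g u < g z2" "g z2 < g v" using dense[OF uv] by blast
    show ?thesis
    proof (cases "g r < g z2")
      case True
      obtain z3 where "g z2 < g z3" "g z3 < g v" using dense[OF z2(2)] by blast
      then show ?thesis using z2 True by (intro exI[of _ "(z2, z3)"]) auto
    next
      case False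
      obtain z1 where z1: "g u < g z1" "g z1 < g z2" using dense[OF z2(1)] by blast
      obtain z0 where "g u < g z0" "g z0 < g z1" using dense[OF z1(1)] by blast
      then show ?thesis using False z1 z2 by (intro exI[of _ "(z0, z1)"]) auto
    qed
  qed
  have "\<exists>w. \<forall>n. (g (fst (w n)) < g (snd (w n)) \<and> (n = 0 \<longrightarrow> w n = (u, v))) \<and>
      (g (fst (w n)) < g (fst (w (Suc n))) \<and> g (snd (w (Suc n))) < g (snd (w n)) \<and>
       (g (q n) < g (fst (w (Suc n))) \<or> g (snd (w (Suc n))) < g (q n)))"
  proof (rule dependent_nat_choice)
    show "\<exists>w. g (fst w) < g (snd w) \<and> ((0::nat) = 0 \<longrightarrow> w = (u, v))" using uv by auto
  next
    fix w :: "real \<times> real" and n :: nat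
    assume "g (fst w) < g (snd w) \<and> (n = 0 \<longrightarrow> w = (u, v))"
    from step[OF conjunct1[OF this], of "q n"] obtain w' where
      "g (fst w') < g (snd w')" "g (fst w) < g (fst w')" "g (snd w') < g (snd w)"
      "g (q n) < g (fst w') \<or> g (snd w') < g (q n)"
      by (elim exE conjE)
    then show "\<exists>w'. (g (fst w') < g (snd w') \<and> (Suc n = 0 \<longrightarrow> w' = (u, v))) \<and>
      g (fst w) < g (fst w') \<and> g (snd w') < g (snd w) \<and> (g (q n) < g (fst w') \<or> g (snd w') < g (q n))"
      by (intro exI[of _ w']) simp
  qed
  then obtain w where w: "\<And>n. g (fst (w n)) < g (snd (w n))" "w 0 = (u, v)"
    "\<And>n. g (fst (w n)) < g (fst (w (Suc n)))" "\<And>n. g (snd (w (Suc n))) < g (snd (w n))"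
    "\<And>n. g (q n) < g (fst (w (Suc n))) \<or> g (snd (w (Suc n))) < g (q n)"
    by metis
  have a: "g (fst (w m)) \<le> g (fst (w n))" and b: "g (snd (w n)) \<le> g (snd (w m))" if "m \<le> n" for m n
    using that lift_Suc_mono_le[of "\<lambda>n. g (fst (w n))" m n]
      lift_Suc_antimono_le[of "\<lambda>n. g (snd (w n))" m n] w(3,4) by (simp_all add: less_imp_le)
  have ab: "fst (w m) \<le> snd (w n)" for m n
  proof -
    have "g (fst (w m)) < g (snd (w n))"
      using a[of m "max m n"] b[of n "max m n"] w(1)[of "max m n"] by simp
    then show ?thesis using lt by (simp add: less_imp_le)
  qed
  define x where "x = (SUP n. fst (w n))"
  have x: "fst (w n) \<le> x" "x \<le> snd (w n)" for n
    unfolding x_def using ab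
    by (auto intro!: cSUP_upper cSUP_least bdd_aboveI2[of _ _ "snd (w 0)"])
  have gx: "g (fst (w n)) \<le> g x" "g x \<le> g (snd (w n))" for n
    using g x by (auto simp: mono_def)
  have "g u < g x" using w(2) w(3)[of 0] gx(1)[of 1] by simp
  moreover have "g x < g v" using w(2) w(4)[of 0] gx(2)[of 1] by simp
  moreover have "y = x" if y: "g y = g x" for y
  proof (rule ccontr)
    assume "y \<noteq> x"
    then have "min x y < max x y" by (simp add: min_def max_def)
    from Rats_dense_in_real[OF this] obtain r where r: "r \<in> \<rat>" "min x y < r" "r < max x y"
      by blast
    have "g (min x y) = g x" "g (max x y) = g x" using y by (auto simp: min_def max_def)
    moreover have "g (min x y) \<le> g r" "g r \<le> g (max x y)" using g r by (auto simp: mono_def)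
    ultimately have "g r = g x" by simp
    moreover obtain s where "r = of_rat s" using r(1) by (rule Rats_cases)
    moreover obtain n where "s = nat_to_rat_surj n"
      using surj_nat_to_rat_surj by (rule surjE)
    ultimately have "g (q n) = g x" by (simp add: q_def)
    then show False using w(5)[of n] gx[of "Suc n"] by simp
  qed
  ultimately show ?thesis by blast
qed

lemma divide_less_self: "0 < d / (real i + 2) \<and> d / (real i + 2) < d" if "0 < d" for d :: real
  using divide_strict_left_mono[of 1 "real i + 2" d] that by auto

text \<open>\<open>S\<close> is an arbitrary closed set; showing that it contains all interval types
  of the colouring puts them into the least one.\<close>

locale closed_types =
  fixes c :: "real \<Rightarrow> nat" and L N S :: nat
  assumes colour: "range c \<subseteq> {..<L}" and even: "\<And>x. even (c x)"
    and N: "0 < N" and closed: "interval_closed N L S"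
begin

lemma fin: "finite (range c)"
  using colour finite_subset by blast

lemma colour_less: "c x < L"
  using colour by auto

lemma cat_closed: "s \<in> set_decode S \<Longrightarrow> t \<in> set_decode S \<Longrightarrow> cat N s t \<in> set_decode S"
  using closed[unfolded interval_closed_def, THEN conjunct1] by blast

lemma omega_rev_closed: "s \<in> set_decode S \<Longrightarrow> cat N s s = s \<Longrightarrow> omega_rev N s \<in> set_decode S"
  using closed[unfolded interval_closed_def, THEN conjunct2, THEN conjunct1] by blast

lemma omega_closed:
  "s \<in> set_decode S \<Longrightarrow> cat N s s = s \<Longrightarrow> cat N (omega N s) (point_type (c x)) \<in> set_decode S"
  using closed[unfolded interval_closed_def, THEN conjunct2, THEN conjunct1] even colour_less by blast

abbreviation "typ \<equiv> ty c N"
abbreviation "inS X \<equiv> typ X \<in> set_decode S"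

lemma typ_Un: "below X Y \<Longrightarrow> typ (X \<union> Y) = cat N (typ X) (typ Y)"
  by (rule cat_ty[OF fin, symmetric]) (auto intro: rep_ty)

lemma inS_Un: "inS X \<Longrightarrow> inS Y \<Longrightarrow> below X Y \<Longrightarrow> inS (X \<union> Y)"
  by (simp add: typ_Un cat_closed)

lemma typ_singleton: "typ {x} = point_type (c x)"
  using N ty_singleton by (metis Suc_pred)

text \<open>The condensation relation. Asking for all subintervals, not only for the whole one,
  makes its classes convex.\<close>

definition good :: "real \<Rightarrow> real \<Rightarrow> bool" where
  "good a b \<longleftrightarrow> (\<forall>a' b'. a \<le> a' \<longrightarrow> a' < b' \<longrightarrow> b' \<le> b \<longrightarrow> inS {a'<..b'})"

lemma good_mono: "good a b \<Longrightarrow> a \<le> a' \<Longrightarrow> b' \<le> b \<Longrightarrow> good a' b'"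
  unfolding good_def by (meson order_trans)

lemma good_refl: "good a a"
  unfolding good_def by auto

lemma split_interval: "a \<le> b \<Longrightarrow> b \<le> d \<Longrightarrow> {a<..d} = {a<..b} \<union> {b<..(d::real)}"
  by auto

lemma below_interval: "below {a<..b} {b<..d}"
  by (auto simp: below_def)

lemma good_trans:
  assumes "good a b" "good b d" shows "good a d"
  unfolding good_def
proof (intro allI impI)
  fix a' b' assume *: "a \<le> a'" "a' < b'" "b' \<le> d"
  show "inS {a'<..b'}"
  proof (cases "b' \<le> b \<or> b \<le> a'")
    case True
    then show ?thesis using * assms unfolding good_def by blast
  next
    case False
    then have "inS {a'<..b}" "inS {b<..b'}" using * assms unfolding good_def by auto
    then show ?thesis
      using False inS_Un[OF _ _ below_interval, of a' b b'] split_interval[of a' b b'] by simp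
  qed
qed

lemma homogeneous:
  assumes "\<And>i j. i < j \<Longrightarrow> inS (I i j)"
  obtains f :: "nat \<Rightarrow> nat" and e where "strict_mono f"
    "\<forall>i j. i < j \<longrightarrow> typ (I (f i) (f j)) = e" "e \<in> set_decode S"
proof -
  obtain f :: "nat \<Rightarrow> nat" and e where f: "strict_mono f" "\<forall>i j. i < j \<longrightarrow> typ (I (f i) (f j)) = e"
  proof (rule homogeneous_subsequence[of "\<lambda>i j. typ (I i j)" "tbound L N"])
    show "typ (I i j) < tbound L N" for i j by (rule ty_less[OF colour])
  qed
  have "inS (I (f 0) (f 1))" using assms f(1) by (simp add: strict_mono_def)
  moreover have "typ (I (f 0) (f 1)) = e" using f(2) by simp
  ultimately show ?thesis using f by (intro that) simp_all
qed

text \<open>Ramsey's theorem gives a sequence increasing to \<open>b\<close> whose segments all have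
  one type, necessarily idempotent. The interval is then an initial segment, an omega sum and the
  point \<open>b\<close>.\<close>

lemma good_limit_right:
  assumes "\<And>b'. b' < b \<Longrightarrow> good a b'"
  shows "good a b"
  unfolding good_def
proof (intro allI impI)
  fix a' b' assume *: "a \<le> a'" "a' < b'" "b' \<le> b"
  show "inS {a'<..b'}"
  proof (cases "b' < b")
    case True
    then show ?thesis using assms[OF True] * unfolding good_def by blast
  next
    case False
    then have b: "b' = b" using * by simp
    \<comment> \<open>The shift by 2 keeps \<open>x 0\<close> strictly above
      \<open>a'\<close>.\<close>
    define x where "x i = b - (b - a') / (real i + 2)" for i
    have d: "b - a' > 0" using * b by simp
    have x: "x i < b" "a' < x i" for i
      using divide_less_self[OF d, of i] by (simp_all add: x_def)
    have xm: "x i < x j" if "i < j" for i j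
      unfolding x_def using that d by (simp add: frac_less2)
    have xS: "inS {u<..x j}" if "a' \<le> u" "u < x j" for u j
      using assms[OF x(1)[of j]] that * unfolding good_def by (meson order_refl order_trans)
    have "inS {x i<..x j}" if "i < j" for i j
      using xS[of "x i" j] xm[OF that] x(2)[of i] by simp
    then obtain f :: "nat \<Rightarrow> nat" and e where
      f: "strict_mono f" and e0: "\<forall>i j. i < j \<longrightarrow> typ {x (f i)<..x (f j)} = e" and eS: "e \<in> set_decode S"
      by (rule homogeneous)
    have e: "typ {x (f i)<..x (f j)} = e" if "i < j" for i j using e0 that by simp
    have xf: "strict_mono (\<lambda>i. x (f i))"
      using f xm by (simp add: strict_mono_def)
    have e01: "typ {x (f 0)<..x (f 1)} = e" and e12: "typ {x (f 1)<..x (f 2)} = e"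
      and e02: "typ {x (f 0)<..x (f 2)} = e" by (rule e, simp)+
    have x01: "x (f 0) \<le> x (f 1)" and x12: "x (f 1) \<le> x (f 2)"
      using strict_monoD[OF xf, of 0 1] strict_monoD[OF xf, of 1 2] by linarith+
    have "cat N e e = typ ({x (f 0)<..x (f 1)} \<union> {x (f 1)<..x (f 2)})"
      unfolding typ_Un[OF below_interval] e01 e12 ..
    also have "\<dots> = e" unfolding split_interval[OF x01 x12, symmetric] e02 ..
    finally have idem: "cat N e e = e" .
    let ?U = "\<Union>j. {x (f 0)<..x (f j)}"
    have U: "?U = {x (f 0)<..<b}"
    proof (intro equalityI subsetI)
      fix y assume y: "y \<in> {x (f 0)<..<b}"
      obtain j where "(b - a') / (b - y) < real j" using reals_Archimedean2 by blast
      then have "b - a' < real j * (b - y)" using y by (simp add: field_simps)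
      moreover have "0 \<le> 2 * (b - y)" using y by simp
      ultimately have "b - a' \<le> (b - y) * (real j + 2)" by (simp only: ring_distribs mult.commute)
      then have "(b - a') / (real j + 2) \<le> b - y" by (simp add: pos_divide_le_eq)
      moreover have "x j \<le> x (f j)"
        using xm[of j "f j"] seq_suble[OF f, of j] by (cases "j = f j") auto
      ultimately have "y \<le> x (f j)" by (simp add: x_def)
      then show "y \<in> ?U" using y by auto
    qed (use x in \<open>auto intro: le_less_trans\<close>)
    have "typ ({x (f 0)<..<b} \<union> {b}) = cat N (omega N e) (point_type (c b))"
      using ty_omega[OF fin xf e order_refl, of 0]
      by (subst typ_Un) (auto simp: below_def U typ_singleton)
    then have A: "inS ({x (f 0)<..<b} \<union> {b})" using omega_closed[OF eS idem] by simp
    have B: "inS {a'<..x (f 0)}" using xS x by simp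
    have "below {a'<..x (f 0)} ({x (f 0)<..<b} \<union> {b})"
      using x[of "f 0"] by (auto simp: below_def)
    from inS_Un[OF B A this] have "inS ({a'<..x (f 0)} \<union> ({x (f 0)<..<b} \<union> {b}))" .
    moreover have "{a'<..x (f 0)} \<union> ({x (f 0)<..<b} \<union> {b}) = {a'<..b'}"
      using x[of "f 0"] b by auto
    ultimately show ?thesis by simp
  qed
qed

text \<open>The mirror image, except that the limit \<open>a\<close> does not belong to the
  interval, so no point has to be added to the reversed omega sum.\<close>

lemma good_limit_left:
  assumes "\<And>a'. a < a' \<Longrightarrow> good a' b"
  shows "good a b"
  unfolding good_def
proof (intro allI impI)
  fix a' b' assume *: "a \<le> a'" "a' < b'" "b' \<le> b"
  show "inS {a'<..b'}"
  proof (cases "a < a'")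
    case True
    then show ?thesis using assms[OF True] * unfolding good_def by blast
  next
    case False
    then have a: "a' = a" using * by simp
    define x where "x i = a + (b' - a) / (real i + 2)" for i
    have d: "b' - a > 0" using * a by simp
    have x: "a < x i" "x i < b'" for i
      using divide_less_self[OF d, of i] by (simp_all add: x_def)
    have xm: "x j < x i" if "i < j" for i j
      unfolding x_def using that d by (simp add: frac_less2)
    have xS: "inS {x j<..u}" if "u \<le> b'" "x j < u" for u j
      using assms[OF x(1)[of j]] that * unfolding good_def by (meson order_refl order_trans)
    have "inS {x j<..x i}" if "i < j" for i j
      using xS[of "x i" j] xm[OF that] x(2)[of i] by simp
    then obtain f :: "nat \<Rightarrow> nat" and e where
      f: "strict_mono f" and e0: "\<forall>i j. i < j \<longrightarrow> typ {x (f j)<..x (f i)} = e" and eS: "e \<in> set_decode S"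
      by (rule homogeneous)
    have e: "typ {x (f j)<..x (f i)} = e" if "i < j" for i j using e0 that by simp
    have xf: "x (f j) < x (f i)" if "i < j" for i j
      using f xm that by (simp add: strict_mono_def)
    have e01: "typ {x (f 1)<..x (f 0)} = e" and e12: "typ {x (f 2)<..x (f 1)} = e"
      and e02: "typ {x (f 2)<..x (f 0)} = e" by (rule e, simp)+
    have x01: "x (f 1) \<le> x (f 0)" and x12: "x (f 2) \<le> x (f 1)"
      using xf[of 0 1] xf[of 1 2] by linarith+
    have "cat N e e = typ ({x (f 2)<..x (f 1)} \<union> {x (f 1)<..x (f 0)})"
      unfolding typ_Un[OF below_interval] e01 e12 ..
    also have "\<dots> = e" unfolding split_interval[OF x12 x01, symmetric] e02 ..
    finally have idem: "cat N e e = e" .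
    let ?U = "\<Union>j. {x (f j)<..x (f 0)}"
    have U: "?U = {a<..x (f 0)}"
    proof (intro equalityI subsetI)
      fix y assume y: "y \<in> {a<..x (f 0)}"
      obtain j where "(b' - a) / (y - a) < real j" using reals_Archimedean2 by blast
      then have "b' - a < real j * (y - a)" using y by (simp add: field_simps)
      moreover have "0 \<le> 2 * (y - a)" using y by simp
      ultimately have "b' - a < (y - a) * (real j + 2)" by (simp only: ring_distribs mult.commute)
      then have "(b' - a) / (real j + 2) < y - a" by (simp add: pos_divide_less_eq)
      moreover have "x (f j) \<le> x j"
        using xm[of j "f j"] seq_suble[OF f, of j] by (cases "j = f j") auto
      ultimately have "x (f j) < y" by (simp add: x_def)
      then show "y \<in> ?U" using y by auto
    qed (use x in \<open>auto intro: less_trans\<close>)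
    have "inS {a<..x (f 0)}"
      using ty_omega_rev[where x = "\<lambda>i. x (f i)" and i = 0, OF fin xf e order_refl] omega_rev_closed[OF eS idem] by (simp add: U)
    moreover have "inS {x (f 0)<..b'}" using xS x by simp
    ultimately have "inS ({a<..x (f 0)} \<union> {x (f 0)<..b'})"
      by (rule inS_Un[OF _ _ below_interval])
    then show ?thesis using split_interval[of a "x (f 0)" b'] x[of "f 0"] a by simp
  qed
qed

lemma good_trivial: "b \<le> a \<Longrightarrow> good a b"
  unfolding good_def by auto

text \<open>Inside a hypothetical bad interval, choose a stretch where the set of types of classes
  is minimal. There the classes form a shuffle, so a smaller stretch inside it is good and collapses
  to a single class, although its ends were chosen inequivalent.\<close>

lemma good_all: "good a b"
proof (rule ccontr)
  assume bad: "\<not> good a b"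
  then have ab: "a < b" using good_trivial by (metis not_le)
  \<comment> \<open>\<open>p\<close> clamps to the interval and \<open>g x\<close> is the right end
    of the class of \<open>p x\<close>, attained by \<open>good_limit_right\<close>. Points of the
    interval are equivalent iff \<open>g\<close> agrees on them, so the classes become fibres of a
    monotone function.\<close>
  define p where "p x = max a (min b x)" for x
  define g where "g x = Sup {y. p x \<le> y \<and> y \<le> b \<and> good (p x) y}" for x
  have p: "a \<le> p x" "p x \<le> b" for x using ab by (auto simp: p_def)
  have p_id: "p x = x" if "a \<le> x" "x \<le> b" for x using that by (auto simp: p_def)
  have p_mono: "p x \<le> p y" if "x \<le> y" for x y using that by (auto simp: p_def)
  have bdd: "bdd_above {y. p x \<le> y \<and> y \<le> b \<and> good (p x) y}" for x
    by (rule bdd_aboveI[of _ b]) auto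
  have mem: "p x \<in> {y. p x \<le> y \<and> y \<le> b \<and> good (p x) y}" for x
    using p good_refl by auto
  have g_ge: "p x \<le> g x" for x
    unfolding g_def by (rule cSup_upper[OF mem bdd])
  have g_le: "g x \<le> b" for x
    unfolding g_def by (rule cSup_least) (use mem in auto)
  have g_good: "good (p x) (g x)" for x
  proof (rule good_limit_right)
    fix b' assume "b' < g x"
    then obtain y where "good (p x) y" "b' < y"
      unfolding g_def using less_cSupD[of "{y. p x \<le> y \<and> y \<le> b \<and> good (p x) y}" b'] mem[of x] by auto
    then show "good (p x) b'" using good_mono by (meson less_imp_le order_refl)
  qed
  have g_upper: "y \<le> g x" if "p x \<le> y" "y \<le> b" "good (p x) y" for x y
    unfolding g_def by (rule cSup_upper[OF _ bdd]) (use that in auto)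
  have merge: "g x = g y" if "p x \<le> p y" "p y \<le> g x" for x y
  proof (rule antisym)
    show "g x \<le> g y"
      using g_upper[OF that(2) g_le] good_mono[OF g_good[of x] that(1) order_refl] by simp
    have "good (p x) (p y)" using good_mono[OF g_good[of x] order_refl that(2)] .
    then have "good (p x) (g y)" using good_trans g_good by blast
    then show "g y \<le> g x" using g_upper g_le that(1) g_ge[of y] by (meson order_trans)
  qed
  have g: "mono g"
  proof (rule monoI)
    fix x y :: real assume "x \<le> y"
    then show "g x \<le> g y"
      using merge[of x y] p_mono[of x y] g_ge[of y] by (cases "p y \<le> g x") auto
  qed
  have lt: "x < y" if "g x < g y" for x y using that g by (meson leI monoD not_le)
  have iff: "g x = g y \<longleftrightarrow> good (p x) (p y)" if "p x \<le> p y" for x y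
    using merge[OF that] g_ge[of y] good_mono[OF g_good[of x] order_refl] g_upper[OF that p(2)] by auto
  have p_g: "p (g x) = g x" for x
    using p_id[of "g x"] g_le g_ge[of x] p(1)[of x] by simp
  have gg: "g (g x) = g x" for x
    using merge[of x "g x"] p_g g_ge by simp
  have gp: "g (p x) = g x" for x
    using p_id[OF p] by (simp add: g_def)
  \<comment> \<open>Without a class in between, every point above \<open>g u\<close> and up to
    \<open>p v\<close> would lie in the class of \<open>v\<close>; letting such points tend to
    \<open>g u\<close> puts \<open>g u\<close> there as well.\<close>
  have dense: "\<exists>x. g u < g x \<and> g x < g v" if uv: "g u < g v" for u v
  proof (rule ccontr)
    assume none: "\<nexists>x. g u < g x \<and> g x < g v"
    have pv: "g u < p v"
      using merge[of u v] p_mono[of u v] lt[OF uv] uv by force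
    have "good x (p v)" if "g u < x" for x
    proof (cases "x \<le> p v")
      case True
      have px: "p x = x"
        using True that p(2)[of v] p(1)[of u] g_ge[of u] by (intro p_id) simp_all
      have "g u < g x" using that g_ge[of x] px by simp
      then have "g v \<le> g x" using none by (meson not_le)
      moreover have "g x \<le> g v" using g True gp[of v] by (metis monoD)
      ultimately have "g x = g v" by simp
      then show ?thesis using iff[of x v] px True by simp
    qed (auto intro: good_trivial)
    then have "good (g u) (p v)" by (rule good_limit_left)
    then have "g (g u) = g v" using iff[of "g u" v] p_g pv by simp
    then show False using gg uv by simp
  qed
  \<comment> \<open>\<open>p\<close> sends everything outside the interval to its ends, so the
    extreme fibres are unbounded; requiring classes on both sides keeps the fibre where
    \<open>p\<close> is the identity.\<close>
  have fibre: "\<exists>m. g -` {g x} = {m..g x} \<and> m \<le> g x \<and> good m (g x)"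
    if x: "a \<le> u" "v \<le> b" "g u < g x" "g x < g v" for x u v
  proof -
    let ?F = "g -` {g x}" and ?m = "Inf (g -` {g x})"
    have F: "a \<le> y" "y \<le> b" "p y = y" "u \<le> y" if "g y = g x" for y
      using lt[of u y] lt[of y v] p_id[of y] x that by auto
    have bb: "bdd_below ?F" using F(4) by (intro bdd_belowI[of _ u]) auto
    have m_le: "?m \<le> y" if "g y = g x" for y using cInf_lower[OF _ bb] that by simp
    have am: "a \<le> ?m" using F(1) by (intro cInf_greatest) auto
    have "good ?m (g x)"
    proof (rule good_limit_left)
      fix a' assume "?m < a'"
      then obtain y where y: "g y = g x" "y < a'" using cInf_lessD[of ?F a'] by auto
      then have "good y (g x)" using g_good[of y] F(3) by simp
      then show "good a' (g x)" using good_mono y(2) by (meson less_imp_le order_refl)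
    qed
    moreover have m: "?m \<le> g x" using m_le[OF gg] .
    moreover have "g ?m = g x"
      using iff[of ?m "g x"] p_g[of x] p_id[of ?m] am m g_le[of x] gg[of x] \<open>good ?m (g x)\<close> by simp
    moreover have "?F = {?m..g x}"
    proof (intro equalityI subsetI)
      fix y assume "y \<in> ?F"
      then show "y \<in> {?m..g x}" using m_le[of y] F(3)[of y] g_ge[of y] by simp
    next
      fix y assume "y \<in> {?m..g x}"
      then have "g ?m \<le> g y" "g y \<le> g (g x)" using g by (auto simp: mono_def)
      then show "y \<in> ?F" using \<open>g ?m = g x\<close> gg by simp
    qed
    ultimately show ?thesis by blast
  qed
  \<comment> \<open>The types of the classes strictly between those of \<open>u\<close> and
    \<open>v\<close>. Shrinking the stretch can only shrink this finite set, so at minimal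
    cardinality it is the same for every substretch: this is the density that
    \<open>ty_shuffle\<close> needs.\<close>
  define Ds where "Ds u v = (\<lambda>x. typ (g -` {g x})) ` {x. g u < g x \<and> g x < g v}" for u v
  have Ds_less: "Ds u v \<subseteq> {..<tbound L N}" for u v
    unfolding Ds_def using ty_less[OF colour] by auto
  then have Ds_fin: "finite (Ds u v)" for u v by (meson finite_lessThan finite_subset)
  have "g a \<noteq> g b" using iff[of a b] ab bad by (simp add: p_def)
  then have "g a < g b" using g ab by (metis less_imp_le monoD order_le_less)
  then have "a \<le> fst (a, b) \<and> snd (a, b) \<le> b \<and> g (fst (a, b)) < g (snd (a, b))" by simp
  from ex_has_least_nat[of "\<lambda>w. a \<le> fst w \<and> snd w \<le> b \<and> g (fst w) < g (snd w)", OF this,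
      of "\<lambda>w. card (Ds (fst w) (snd w))"]
  obtain u v where uv: "a \<le> u" "v \<le> b" "g u < g v"
    and least: "\<And>u' v'. a \<le> u' \<Longrightarrow> v' \<le> b \<Longrightarrow> g u' < g v' \<Longrightarrow> card (Ds u v) \<le> card (Ds u' v')"
    by auto
  have Ds_eq: "Ds u' v' = Ds u v" if "u \<le> u'" "v' \<le> v" "g u' < g v'" for u' v'
  proof (rule card_seteq[OF Ds_fin])
    have "g u \<le> g u'" "g v' \<le> g v" using g that by (auto simp: mono_def)
    then show "Ds u' v' \<subseteq> Ds u v" unfolding Ds_def by (intro image_mono) auto
    show "card (Ds u v) \<le> card (Ds u' v')" using least that uv by simp
  qed
  define D where "D = set_encode (Ds u v)"
  define E where "E = set_encode {e. e < D \<and> (\<exists>d\<in>set_decode D. e \<in> set_decode d)}"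
  have D: "set_decode D = Ds u v" using Ds_fin by (simp add: D_def)
  have E: "set_decode E = (\<Union>d\<in>Ds u v. set_decode d)"
    unfolding E_def using D by (auto dest: set_decode_less intro: less_trans)
  have D_less: "D < 2 ^ tbound L N" unfolding D_def by (rule set_encode_less[OF Ds_less])
  have legal: "\<exists>l. l < L \<and> even l \<and> (d = point_type l \<or> (\<exists>s\<in>set_decode S. d = cat N (point_type l) s))"
    if "d \<in> set_decode D" for d
  proof -
    from that obtain x where d: "d = typ (g -` {g x})" and x: "g u < g x" "g x < g v"
      unfolding D Ds_def by auto
    from fibre[OF uv(1,2) x] obtain m where m: "g -` {g x} = {m..g x}" "m \<le> g x" "good m (g x)"
      by blast
    show ?thesis
    proof (cases "m = g x")
      case True
      then have "d = point_type (c m)" using d m by (simp add: typ_singleton)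
      then show ?thesis using colour_less even by blast
    next
      case False
      have "{m..g x} = {m} \<union> {m<..g x}" using m(2) by auto
      moreover have "typ ({m} \<union> {m<..g x}) = cat N (point_type (c m)) (typ {m<..g x})"
        by (subst typ_Un) (auto simp: below_def typ_singleton)
      ultimately have "d = cat N (point_type (c m)) (typ {m<..g x})" using d m(1) by simp
      moreover have "inS {m<..g x}" using m(2,3) False unfolding good_def by simp
      ultimately show ?thesis using colour_less even by blast
    qed
  qed
  \<comment> \<open>This supplies the point component that \<open>interval_closed\<close> demands of
    a shuffle.\<close>
  obtain x where x: "g u < g x" "g x < g v" "g -` {g x} = {x}"
    using singleton_fibre[OF g dense uv(3)] by blast
  then have "point_type (c x) \<in> set_decode D"
    unfolding D Ds_def using typ_singleton[of x] by (intro image_eqI[of _ _ x]) simp_all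
  then have "\<exists>l. l < L \<and> even l \<and> point_type l \<in> set_decode D" using colour_less even by blast
  from closed[unfolded interval_closed_def, THEN conjunct2, THEN conjunct2, rule_format,
      OF D_less legal this colour_less even, folded E_def]
  have sh: "cat N (shuffle N E) (point_type (c y)) \<in> set_decode S" for y .
  \<comment> \<open>Moving inside puts the class of every point up to \<open>v'\<close> strictly
    below that of \<open>v\<close>, so that \<open>fibre\<close> applies to the class of
    \<open>b'\<close>.\<close>
  obtain u' where u': "g u < g u'" "g u' < g v" using dense[OF uv(3)] by blast
  obtain v' where v': "g u' < g v'" "g v' < g v" using dense[OF u'(2)] by blast
  have bounds: "a \<le> u'" "v' \<le> b" "u \<le> u'" "v' \<le> v" "u' \<le> v'"
    using lt[OF u'(1)] lt[OF v'(2)] lt[OF v'(1)] uv by auto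
  have "good u' v'"
    unfolding good_def
  proof (intro allI impI)
    fix a' b' assume *: "u' \<le> a'" "a' < b'" "b' \<le> v'"
    have pa: "p a' = a'" and pb: "p b' = b'" using * bounds by (auto intro: p_id)
    have ga: "g u' \<le> g a'" and gb: "g b' \<le> g v'" and gab: "g a' \<le> g b'"
      using g * by (auto simp: mono_def)
    show "inS {a'<..b'}"
    proof (cases "g a' = g b'")
      case True
      then have "good a' b'" using iff[of a' b'] pa pb * by simp
      then show ?thesis using * unfolding good_def by simp
    next
      case False
      then have gab: "g a' < g b'" using gab by simp
      obtain m where m: "g -` {g b'} = {m..g b'}" "m \<le> g b'" "good m (g b')"
        using fibre[OF uv(1,2), of b'] gab ga gb u' v' by auto
      have mb: "m \<le> b'" "b' \<le> g b'" using m(1) by auto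
      have gm: "g m = g b'" using m(1,2) by auto
      have am: "a' < m" using lt gm gab by simp
      have gab': "g a' < b'" using merge[of a' b'] pa pb * gab by force
      \<comment> \<open>The interval splits into the rest of the class of \<open>a'\<close>, the
        shuffle \<open>?M\<close> of all classes in between, the first point \<open>m\<close> of the
        class of \<open>b'\<close>, which closes the shuffle, and the remainder of that class up to
        \<open>b'\<close>. The outer pieces may be empty.\<close>
      let ?M = "{x. g a' < g x \<and> g x < g b'}"
      have M: "typ ?M = shuffle N E"
      proof (rule ty_shuffle[OF fin g _ order_refl])
        show "u \<le> a'" "b' \<le> v" using * bounds by auto
        show "g a' < g b'" by fact
        show "(\<Union>x\<in>{x. g u'' < g x \<and> g x < g v''}. set_decode (typ (g -` {g x}))) = set_decode E"
          if "u \<le> u''" "v'' \<le> v" "g u'' < g v''" for u'' v''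
          unfolding E Ds_eq[OF that, symmetric] by (simp add: Ds_def)
      qed
      have bM: "below ?M {m}" using gm lt by (auto simp: below_def)
      have A: "inS (?M \<union> {m})" unfolding typ_Un[OF bM] typ_singleton M by (rule sh)
      have B: "inS ((?M \<union> {m}) \<union> {m<..b'})"
      proof (cases "m = b'")
        case False
        then have "inS {m<..b'}" using m(3) mb unfolding good_def by simp
        then show ?thesis
          by (rule inS_Un[OF A]) (use bM in \<open>fastforce simp: below_def\<close>)
      qed (use A in simp)
      have C: "inS ({a'<..g a'} \<union> ((?M \<union> {m}) \<union> {m<..b'}))"
      proof (cases "a' = g a'")
        case False
        then have "inS {a'<..g a'}"
          using g_good[of a'] g_ge[of a'] pa unfolding good_def by simp
        moreover have "below {a'<..g a'} ((?M \<union> {m}) \<union> {m<..b'})"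
        proof -
          have "g a' < y" if "g a' < g y" for y
            using that gg[of a'] lt[of "g a'" y] by simp
          moreover have "g a' < m" using lt[of "g a'" m] gg gm gab by simp
          ultimately show ?thesis by (fastforce simp: below_def)
        qed
        ultimately show ?thesis using inS_Un B by blast
      qed (use B in simp)
      have "{a'<..g a'} \<union> ((?M \<union> {m}) \<union> {m<..b'}) = {a'<..b'}"
      proof (intro equalityI subsetI)
        fix y assume "y \<in> {a'<..g a'} \<union> ((?M \<union> {m}) \<union> {m<..b'})"
        then show "y \<in> {a'<..b'}" using gab' am mb lt[of a' y] lt[of y b'] by auto
      next
        fix y assume y: "y \<in> {a'<..b'}"
        then have py: "p y = y" using * bounds by (auto intro: p_id)
        have "g a' \<le> g y" "g y \<le> g b'" using g y by (auto simp: mono_def)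
        then consider "g y = g a'" | "y \<in> ?M" | "g y = g b'" by fastforce
        then show "y \<in> {a'<..g a'} \<union> ((?M \<union> {m}) \<union> {m<..b'})"
        proof cases
          case 1
          then show ?thesis using g_ge[of y] py y by auto
        next
          case 3
          then have "y \<in> {m..g b'}" using m(1) by auto
          then show ?thesis using y by auto
        qed simp
      qed
      then show ?thesis using C by simp
    qed
  qed
  then have "g u' = g v'" using iff[of u' v'] bounds p_id by auto
  then show False using v' by simp
qed

theorem inS_interval: "x < y \<Longrightarrow> inS {x<..y}"
  using good_all[of x y] unfolding good_def by simp

end


section \<open>Colourings and a staircase function\<close>

text \<open>Assembles a colouring from witnesses chosen separately for each block. \<open>P\<close>
  is a pointwise constraint, such as a bound and a parity for the letter; off the blocks it is met
  by an arbitrary choice.\<close>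

lemma glue:
  fixes B :: "'i \<Rightarrow> real set" and C :: "'i \<Rightarrow> real \<Rightarrow> nat"
  assumes disj: "\<And>i j x. x \<in> B i \<Longrightarrow> x \<in> B j \<Longrightarrow> i = j"
    and P: "\<And>x. \<exists>l. P x l" and C: "\<And>i x. x \<in> B i \<Longrightarrow> P x (C i x)"
  obtains c where "\<And>x. P x (c x)" "\<And>i x. x \<in> B i \<Longrightarrow> c x = C i x"
proof -
  define c where "c x = (if \<exists>i. x \<in> B i then C (THE i. x \<in> B i) x else SOME l. P x l)" for x
  have c: "c x = C i x" if "x \<in> B i" for i x
  proof -
    have "(THE i. x \<in> B i) = i" using that disj by blast
    then show ?thesis using that by (auto simp: c_def)
  qed
  moreover have "P x (c x)" for x
  proof (cases "\<exists>i. x \<in> B i")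
    case True
    then show ?thesis using c C by metis
  next
    case False
    then show ?thesis using someI_ex[OF P] by (auto simp: c_def)
  qed
  ultimately show ?thesis using that by blast
qed

text \<open>A new value is placed on a translate of the rationals that avoids the countably many
  points already coloured differently from \<open>d0\<close>. So every value stays dense, and
  \<open>d0\<close> keeps all but countably many points.\<close>

lemma dense_colouring:
  assumes "finite D"
  shows "\<exists>k :: real \<Rightarrow> 'a. (\<forall>x. k x \<in> insert d0 D) \<and> countable {x. k x \<noteq> d0} \<and>
    (\<forall>a b. a < b \<longrightarrow> (\<forall>d\<in>insert d0 D. \<exists>x. a < x \<and> x < b \<and> k x = d))"
  using assms
proof (induction D)
  case empty
  have "\<exists>x. a < x \<and> x < b" if "a < b" for a b :: real using dense[OF that] .
  then show ?case by (intro exI[of _ "\<lambda>_. d0"]) auto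
next
  case (insert d D)
  obtain k :: "real \<Rightarrow> 'a" where k: "\<And>x. k x \<in> insert d0 D" "countable {x. k x \<noteq> d0}"
    "\<And>a b d. a < b \<Longrightarrow> d \<in> insert d0 D \<Longrightarrow> \<exists>x. a < x \<and> x < b \<and> k x = d"
    using insert.IH by blast
  show ?case
  proof (cases "d = d0")
    case True
    then show ?thesis using k by (intro exI[of _ k]) auto
  next
    case False
    let ?C = "{x. k x \<noteq> d0}"
    have "countable ((\<lambda>(x, r). x - r) ` (?C \<times> \<rat>))"
      using k(2) countable_rat by (intro countable_image countable_SIGMA) auto
    then obtain t where t: "t \<notin> (\<lambda>(x, r). x - r) ` (?C \<times> \<rat>)"
      using uncountable_UNIV_real by (metis UNIV_eq_I)
    define Q where "Q = (\<lambda>r. r + t) ` \<rat>"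
    have Q: "k x = d0" if "x \<in> Q" for x
    proof (rule ccontr)
      assume "k x \<noteq> d0"
      moreover from that obtain r where "r \<in> \<rat>" "x = r + t" by (auto simp: Q_def)
      ultimately have "(x, r) \<in> ?C \<times> \<rat>" "t = (\<lambda>(x, r). x - r) (x, r)" by auto
      then show False using t by (metis imageI)
    qed
    have cQ: "countable Q" unfolding Q_def using countable_rat by (rule countable_image)
    let ?k = "\<lambda>x. if x \<in> Q then d else k x"
    have "{x. ?k x \<noteq> d0} \<subseteq> ?C \<union> Q" by auto
    then have "countable {x. ?k x \<noteq> d0}" using k(2) cQ by (meson countable_Un countable_subset)
    moreover have "\<exists>x. a < x \<and> x < b \<and> ?k x = e" if ab: "a < b" and e: "e \<in> insert d0 (insert d D)" for a b e
    proof -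
      consider "e = d0" | "e = d" | "e \<in> D" "e \<noteq> d0" "e \<noteq> d" using e by blast
      then show ?thesis
      proof cases
        case 1
        have "\<not> {a<..<b} \<subseteq> ?C \<union> Q"
          using k(2) cQ uncountable_open_interval[of a b] ab by (meson countable_Un countable_subset)
        then obtain x where "x \<in> {a<..<b}" "x \<notin> ?C \<union> Q" unfolding subset_eq by blast
        then show ?thesis using 1 by (intro exI[of _ x]) auto
      next
        case 2
        obtain r where "r \<in> \<rat>" "a - t < r" "r < b - t"
          using Rats_dense_in_real[of "a - t" "b - t"] ab by auto
        then have "r + t \<in> Q" "a < r + t" "r + t < b" by (auto simp: Q_def)
        then show ?thesis using 2 by (intro exI[of _ "r + t"]) auto
      next
        case 3
        then obtain x where "a < x" "x < b" "k x = e" using k(3)[OF ab] by blast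
        then show ?thesis using 3 Q by (intro exI[of _ x]) auto
      qed
    qed
    moreover have "?k x \<in> insert d0 (insert d D)" for x using k(1) by auto
    ultimately show ?thesis by (intro exI[of _ ?k]) blast
  qed
qed

text \<open>The total height of the jumps indexed by \<open>A\<close>, the jump of index
  \<open>n\<close> having height \<open>(1 / 2) ^ n\<close>. Summability lets a monotone function
  jump at all points of a countable set.\<close>

definition dyadic_sum :: "nat set \<Rightarrow> real" where
  "dyadic_sum A = (\<Sum>n. if n \<in> A then (1 / 2) ^ n else 0)"

lemma summable_dyadic: "summable (\<lambda>n. if n \<in> A then (1 / 2 :: real) ^ n else 0)"
  by (rule summable_comparison_test'[of "\<lambda>n. (1 / 2) ^ n" 0]) (auto simp: summable_geometric)

lemma dyadic_sum_mono: "A \<subseteq> B \<Longrightarrow> dyadic_sum A \<le> dyadic_sum B"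
  unfolding dyadic_sum_def by (intro suminf_le summable_dyadic) auto

lemma dyadic_sum_nonneg: "0 \<le> dyadic_sum A"
  unfolding dyadic_sum_def by (intro suminf_nonneg summable_dyadic) auto

lemma dyadic_sum_le: "dyadic_sum A \<le> 2"
proof -
  have "dyadic_sum A \<le> (\<Sum>n. (1 / 2) ^ n)"
    unfolding dyadic_sum_def by (intro suminf_le summable_dyadic summable_geometric) auto
  also have "\<dots> = 2" by (subst suminf_geometric) auto
  finally show ?thesis .
qed

lemma dyadic_sum_insert:
  assumes "n \<notin> A" shows "dyadic_sum (insert n A) = dyadic_sum A + (1 / 2) ^ n"
proof -
  have "(\<lambda>m. if m \<in> insert n A then (1 / 2 :: real) ^ m else 0) =
    (\<lambda>m. (if m \<in> A then (1 / 2) ^ m else 0) + (if m = n then (1 / 2) ^ m else 0))"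
    using assms by (auto simp: fun_eq_iff)
  moreover have "(\<lambda>m. if m = n then (1 / 2 :: real) ^ m else 0) sums (1 / 2) ^ n"
    by (rule sums_single)
  ultimately show ?thesis
    unfolding dyadic_sum_def using suminf_add[OF summable_dyadic, of "\<lambda>m. if m = n then (1 / 2) ^ m else 0" A]
    by (simp add: sums_iff)
qed

text \<open>All jumps from index \<open>m\<close> on have total height at most
  \<open>2 * (1 / 2) ^ m\<close>, so near a point only the finitely many earlier ones
  matter.\<close>

lemma dyadic_sum_tail: "dyadic_sum A \<le> dyadic_sum (A \<inter> {..<m}) + 2 * (1 / 2) ^ m"
proof -
  let ?f = "\<lambda>n. if m \<le> n then (1 / 2 :: real) ^ n else 0"
  have s: "?f sums (2 * (1 / 2) ^ m)"
  proof -
    have "(\<lambda>n. (1 / 2 :: real) ^ m * (1 / 2) ^ n) sums ((1 / 2) ^ m * (1 / (1 - 1 / 2)))"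
      by (intro sums_mult geometric_sums) auto
    then have "(\<lambda>n. ?f (n + m)) sums (2 * (1 / 2) ^ m)" by (simp add: power_add mult.commute)
    then show ?thesis by (subst (asm) sums_iff_shift) simp
  qed
  have "dyadic_sum A \<le> (\<Sum>n. (if n \<in> A \<inter> {..<m} then (1 / 2) ^ n else 0) + ?f n)"
    unfolding dyadic_sum_def
    by (intro suminf_le summable_dyadic summable_add sums_summable[OF s]) auto
  also have "\<dots> = dyadic_sum (A \<inter> {..<m}) + 2 * (1 / 2) ^ m"
    unfolding dyadic_sum_def using suminf_add[OF summable_dyadic sums_summable[OF s], of "A \<inter> {..<m}"] s
    by (simp add: sums_iff)
  finally show ?thesis .
qed

lemma finite_gap_left:
  fixes x :: real
  assumes "finite S" "0 < e"
  obtains x' where "x - e < x'" "x' < x" "\<And>s. s \<in> S \<Longrightarrow> s < x \<Longrightarrow> s < x'"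
proof -
  let ?M = "Max (insert (x - e) {s \<in> S. s < x})"
  have "?M < x" using assms by (subst Max_less_iff) auto
  moreover have "x - e \<le> ?M" "\<And>s. s \<in> S \<Longrightarrow> s < x \<Longrightarrow> s \<le> ?M"
    using assms by (auto intro!: Max_ge)
  ultimately show ?thesis by (intro that[of "(?M + x) / 2"]) fastforce+
qed

lemma finite_gap_right:
  fixes x :: real
  assumes "finite S" "0 < e"
  obtains x' where "x' < x + e" "x < x'" "\<And>s. s \<in> S \<Longrightarrow> x < s \<Longrightarrow> x' < s"
proof -
  obtain y where "- x - e < y" "y < - x" "\<And>s. s \<in> uminus ` S \<Longrightarrow> s < - x \<Longrightarrow> s < y"
    using finite_gap_left[of "uminus ` S" e "- x"] assms by blast
  then show ?thesis by (intro that[of "- y"]) force+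
qed

text \<open>A continuous surjection collapsing a prescribed countable set of fibres from intervals: the
  inverse of a function that jumps exactly at the points of \<open>E\<close>.\<close>

lemma staircase:
  assumes E: "countable (E :: real set)"
  obtains g lo hi where "mono g" "\<And>x. g -` {x} = {lo x..hi x :: real}" "\<And>x. lo x \<le> hi x"
    "\<And>x. lo x < hi x \<longleftrightarrow> x \<in> (E :: real set)"
proof -
  let ?n = "to_nat_on E"
  have inj: "?n x = ?n y \<Longrightarrow> x = y" if "x \<in> E" "y \<in> E" for x y
    using inj_on_to_nat_on[OF E] that by (auto simp: inj_on_def)
  \<comment> \<open>\<open>lo\<close> and \<open>hi\<close> are the left and right values at
    \<open>x\<close> of the identity plus all jumps up to there: \<open>A\<close> collects the
    indices of the jumps strictly before \<open>x\<close>, \<open>A'\<close> also that of a jump at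
    \<open>x\<close>.\<close>
  define A where "A x = ?n ` (E \<inter> {..<x})" for x
  define A' where "A' x = ?n ` (E \<inter> {..x})" for x
  define lo where "lo x = x + dyadic_sum (A x)" for x
  define hi where "hi x = x + dyadic_sum (A' x)" for x
  have le: "lo x \<le> hi x" for x
    unfolding lo_def hi_def A_def A'_def by (auto intro!: dyadic_sum_mono)
  have iff: "lo x < hi x \<longleftrightarrow> x \<in> E" for x
  proof (cases "x \<in> E")
    case True
    then have "E \<inter> {..x} = insert x (E \<inter> {..<x})" by auto
    then have "A' x = insert (?n x) (A x)" by (simp add: A_def A'_def)
    moreover have "?n x \<notin> A x" using inj True by (auto simp: A_def)
    ultimately show ?thesis using True by (simp add: lo_def hi_def dyadic_sum_insert)
  next
    case False
    then have "E \<inter> {..x} = E \<inter> {..<x}" by (auto simp: less_le)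
    then have "A' x = A x" by (simp add: A_def A'_def)
    then show ?thesis using False by (simp add: lo_def hi_def)
  qed
  have hi_lo: "hi x < lo y" if "x < y" for x y
  proof -
    have "A' x \<subseteq> A y" using that by (auto simp: A_def A'_def)
    then show ?thesis using that dyadic_sum_mono by (simp add: lo_def hi_def add_less_le_mono)
  qed
  have fin: "finite {s \<in> E. ?n s < m}" for m
    using inj by (intro inj_on_finite[of ?n _ "{..<m}"]) (auto simp: inj_on_def)
  have small: "\<exists>m. 2 * (1 / 2) ^ m < e" if "0 < e" for e :: real
    using real_arch_pow_inv[of "e / 2" "1 / 2"] that by (auto simp: mult.commute)
  \<comment> \<open>Left continuity of \<open>lo\<close>: a point close enough to \<open>x\<close>
    has the same finitely many large jumps below it, and the small ones add less than any given
    error. \<open>le_hi\<close> is the corresponding approach to \<open>hi\<close> from the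
    right.\<close>
  have lo_le: "lo x \<le> y" if y: "\<And>x'. x' < x \<Longrightarrow> lo x' \<le> y" for x y
  proof (rule field_le_epsilon)
    fix e :: real assume "0 < e"
    then obtain m where m: "2 * (1 / 2) ^ m < e / 2" using small[of "e / 2"] by auto
    obtain x' where x': "x - e / 2 < x'" "x' < x" "\<And>s. s \<in> {s \<in> E. ?n s < m} \<Longrightarrow> s < x \<Longrightarrow> s < x'"
      using finite_gap_left[OF fin, of "e / 2" x m] \<open>0 < e\<close> by auto
    have "A x \<inter> {..<m} \<subseteq> A x'" using x'(3) by (auto simp: A_def)
    then have "dyadic_sum (A x) \<le> dyadic_sum (A x') + 2 * (1 / 2) ^ m"
      using dyadic_sum_tail[of "A x" m] dyadic_sum_mono by (meson add_mono order_refl order_trans)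
    then show "lo x \<le> y + e" using y[OF x'(2)] x'(1) m by (simp add: lo_def)
  qed
  have le_hi: "y \<le> hi x" if y: "\<And>x'. x < x' \<Longrightarrow> y \<le> lo x'" for x y
  proof (rule field_le_epsilon)
    fix e :: real assume "0 < e"
    then obtain m where m: "2 * (1 / 2) ^ m < e / 2" using small[of "e / 2"] by auto
    obtain x' where x': "x' < x + e / 2" "x < x'" "\<And>s. s \<in> {s \<in> E. ?n s < m} \<Longrightarrow> x < s \<Longrightarrow> x' < s"
      using finite_gap_right[OF fin, of "e / 2" x m] \<open>0 < e\<close> by auto
    have "A x' \<inter> {..<m} \<subseteq> A' x" using x'(3) by (force simp: A_def A'_def)
    then have "dyadic_sum (A x') \<le> dyadic_sum (A' x) + 2 * (1 / 2) ^ m"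
      using dyadic_sum_tail[of "A x'" m] dyadic_sum_mono by (meson add_mono order_refl order_trans)
    then show "y \<le> hi x + e" using y[OF x'(2)] x'(1) m by (simp add: lo_def hi_def)
  qed
  define g where "g y = Sup {x. lo x \<le> y}" for y
  \<comment> \<open>All jumps together have height at most 2, so \<open>y - 2\<close>
    qualifies.\<close>
  have ne: "{x. lo x \<le> y} \<noteq> {}" for y
    using dyadic_sum_le[of "A (y - 2)"] by (auto simp: lo_def intro!: exI[of _ "y - 2"])
  have bdd: "bdd_above {x. lo x \<le> y}" for y
  proof (rule bdd_aboveI[of _ y])
    fix x assume "x \<in> {x. lo x \<le> y}"
    then show "x \<le> y" using dyadic_sum_nonneg[of "A x"] by (simp add: lo_def)
  qed
  have lo_mono: "lo x \<le> lo y" if "x \<le> y" for x y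
    using that hi_lo[of x y] le[of x] by (cases "x = y") auto
  have g1: "lo (g y) \<le> y" for y
  proof (rule lo_le)
    fix x' assume "x' < g y"
    then obtain x where "lo x \<le> y" "x' < x"
      using less_cSupD[OF ne, of x' y] unfolding g_def by auto
    then show "lo x' \<le> y" using lo_mono[of x' x] by simp
  qed
  have g2: "y \<le> hi (g y)" for y
  proof (rule le_hi)
    fix x' assume "g y < x'"
    then have "\<not> lo x' \<le> y" using cSup_upper[OF _ bdd, of x' y] unfolding g_def by auto
    then show "y \<le> lo x'" by simp
  qed
  have uniq: "g y = x" if "lo x \<le> y" "y \<le> hi x" for x y
    using that g1[of y] g2[of y] hi_lo[of x "g y"] hi_lo[of "g y" x] by (metis linorder_neqE not_le order_trans)
  show ?thesis
  proof (rule that[of g lo hi])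
    show "mono g"
    proof (rule monoI)
      fix x y :: real assume "x \<le> y"
      then show "g x \<le> g y"
        using g1[of x] g2[of y] hi_lo[of "g y" "g x"] by (meson leI le_less_trans not_le order_trans)
    qed
    show "g -` {x} = {lo x..hi x}" for x using uniq g1 g2 by auto
  qed (use le iff in auto)
qed


section \<open>Every generated type is realised\<close>

definition noninteger_colouring :: "nat \<Rightarrow> (real \<Rightarrow> nat) \<Rightarrow> bool" where
  "noninteger_colouring L c \<longleftrightarrow> (\<forall>x. c x < L \<and> even (c x))"

text \<open>One interval suffices, since affine maps carry colourings of \<open>{0<..1}\<close> to
  any other interval and back.\<close>

definition interval_types :: "nat \<Rightarrow> nat \<Rightarrow> nat set" where
  "interval_types L N = {ty c N {0<..1} | c. noninteger_colouring L c}"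

text \<open>Membership in the least closed set of codes. The bound on \<open>S\<close> makes it decidable and loses
  nothing, since all types of level \<open>N\<close> are below \<open>tbound L N\<close>.\<close>

definition interval_type :: "nat \<Rightarrow> nat \<Rightarrow> nat \<Rightarrow> bool" where
  "interval_type N L h \<longleftrightarrow> (\<forall>S. S < 2 ^ tbound L N \<longrightarrow> interval_closed N L S \<longrightarrow> h \<in> set_decode S)"

section \<open>Scaling and gluing colourings\<close>

lemma range_bounded: "(\<And>x. c x < L) \<Longrightarrow> range c \<subseteq> {..<L}"
  by auto

lemma finite_range_bounded: "(\<And>x. c x < (L::nat)) \<Longrightarrow> finite (range c)"
  by (rule finite_subset[OF range_bounded]) auto

lemma affine_image: "a < b \<Longrightarrow> (\<lambda>x. a + (b - a) * x) ` {0<..1} = {a<..b}" for a b :: real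
proof (intro equalityI subsetI)
  fix y assume ab: "a < b" and y: "y \<in> {a<..b}"
  then have "y = a + (b - a) * ((y - a) / (b - a))" "(y - a) / (b - a) \<in> {0<..1}"
    by (auto simp: field_simps)
  then show "y \<in> (\<lambda>x. a + (b - a) * x) ` {0<..1}" by (rule image_eqI)
next
  fix y assume ab: "a < b" and "y \<in> (\<lambda>x. a + (b - a) * x) ` {0<..1}"
  then obtain x where x: "0 < x" "x \<le> 1" "y = a + (b - a) * x" by auto
  have "0 < (b - a) * x" "(b - a) * x \<le> (b - a) * 1"
    using ab x by (auto intro: mult_left_mono)
  then show "y \<in> {a<..b}" using x(3) by simp
qed

lemma interval_types_interval:
  assumes "noninteger_colouring L c" "a < b" shows "ty c N {a<..b} \<in> interval_types L N"
proof -
  let ?f = "\<lambda>x. a + (b - a) * x"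
  have "ty c N (?f ` {0<..1}) = ty (\<lambda>x. c (?f x)) N {0<..1}"
    by (rule ty_iso) (use assms(2) in auto)
  moreover have "noninteger_colouring L (\<lambda>x. c (?f x))" using assms(1) by (simp add: noninteger_colouring_def)
  ultimately show ?thesis unfolding interval_types_def affine_image[OF assms(2)] by blast
qed

lemma interval_types_on:
  assumes "h \<in> interval_types L N" "a < b" shows "\<exists>c. noninteger_colouring L c \<and> ty c N {a<..b} = h"
proof -
  obtain c where c: "noninteger_colouring L c" "h = ty c N {0<..1}" using assms(1) unfolding interval_types_def by blast
  let ?f = "\<lambda>x. a + (b - a) * x" and ?c = "\<lambda>y. c ((y - a) / (b - a))"
  have "ty ?c N (?f ` {0<..1}) = ty c N {0<..1}"
    by (rule ty_iso) (use assms(2) in auto)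
  moreover have "noninteger_colouring L ?c" using c(1) by (simp add: noninteger_colouring_def)
  ultimately show ?thesis unfolding affine_image[OF assms(2)] c(2) by blast
qed

lemma ty_Un: "finite (range c) \<Longrightarrow> below X Y \<Longrightarrow> ty c N (X \<union> Y) = cat N (ty c N X) (ty c N Y)"
  by (rule cat_ty[symmetric]) (auto intro: rep_ty)

lemma ty_interval_Un:
  assumes "finite (range c)" "a \<le> b" "b \<le> d"
  shows "ty c N {a<..d} = cat N (ty c N {a<..b}) (ty c N {b<..d})"
proof -
  have "{a<..d} = {a<..b} \<union> {b<..d}" using assms by auto
  moreover have "below {a<..b} {b<..d}" by (auto simp: below_def)
  ultimately show ?thesis using ty_Un[OF assms(1)] by simp
qed

lemma ty_singleton_pos: "0 < N \<Longrightarrow> ty c N {a} = point_type (c a)"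
  using ty_singleton by (metis Suc_pred)

lemma less_Suc_interval:
  fixes x :: "nat \<Rightarrow> real"
  assumes "strict_mono x" "y \<in> {x i<..x (Suc i)}" "y \<in> {x j<..x (Suc j)}" shows "i = j"
proof (rule ccontr)
  have le: "x a \<le> x b" if "a \<le> b" for a b using assms(1) that by (simp add: strict_mono_less_eq)
  assume "i \<noteq> j"
  then have "Suc i \<le> j \<or> Suc j \<le> i" by auto
  then show False using le[of "Suc i" j] le[of "Suc j" i] assms(2,3) by auto
qed

text \<open>Each block brings its own colouring. After gluing, neighbouring blocks merge by
  idempotence, so every segment has type \<open>e\<close>, as \<open>ty_omega\<close>
  requires.\<close>

lemma glue_omega:
  fixes x :: "nat \<Rightarrow> real"
  assumes x: "strict_mono x" and bound: "\<And>y l. P y l \<Longrightarrow> l < L"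
    and blocks: "\<And>i. \<exists>C. (\<forall>y. P y (C y)) \<and> ty C N {x i<..x (Suc i)} = e"
    and e: "cat N e e = e"
  obtains c where "\<And>y. P y (c y)" "ty c N (\<Union>j. {x 0<..x j}) = omega N e"
proof -
  have "\<forall>i. \<exists>C. (\<forall>y. P y (C y)) \<and> ty C N {x i<..x (Suc i)} = e" using blocks by blast
  from choice[OF this] obtain C where
    C: "\<And>i y. P y (C i y)" "\<And>i. ty (C i) N {x i<..x (Suc i)} = e" by blast
  obtain c where c: "\<And>y. P y (c y)" "\<And>i y. y \<in> {x i<..x (Suc i)} \<Longrightarrow> c y = C i y"
    by (rule glue[of "\<lambda>i. {x i<..x (Suc i)}" P C]) (use less_Suc_interval[OF x] C(1) in blast)+
  have fin: "finite (range c)" using bound[OF c(1)] by (rule finite_range_bounded)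
  have "ty c N {x i<..x j} = e" if "i < j" for i j
    using that
  proof (induction rule: less_Suc_induct)
    case (1 i)
    have "ty c N {x i<..x (Suc i)} = ty (C i) N {x i<..x (Suc i)}" by (rule ty_cong[OF c(2)])
    then show ?case using C(2) by simp
  next
    case (2 i j k)
    have "x i \<le> x j" "x j \<le> x k" using x 2 by (simp_all add: strict_mono_less_eq)
    then show ?case using ty_interval_Un[OF fin, of "x i" "x j" "x k" N] 2 e by simp
  qed
  then have "ty c N (\<Union>j. {x 0<..x j}) = omega N e"
    by (intro ty_omega[OF fin x]) auto
  with c(1) show ?thesis by (rule that)
qed

lemma glue_omega_rev:
  fixes x :: "nat \<Rightarrow> real"
  assumes x: "\<And>i j. i < j \<Longrightarrow> x j < x i" and bound: "\<And>y l. P y l \<Longrightarrow> l < L"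
    and blocks: "\<And>i. \<exists>C. (\<forall>y. P y (C y)) \<and> ty C N {x (Suc i)<..x i} = e"
    and e: "cat N e e = e"
  obtains c where "\<And>y. P y (c y)" "ty c N (\<Union>j. {x j<..x 0}) = omega_rev N e"
proof -
  have le: "x b \<le> x a" if "a \<le> b" for a b using x[of a b] that by (cases "a = b") auto
  have disj: "i = j" if "y \<in> {x (Suc i)<..x i}" "y \<in> {x (Suc j)<..x j}" for y i j
  proof (rule ccontr)
    assume "i \<noteq> j"
    then have "Suc i \<le> j \<or> Suc j \<le> i" by auto
    then show False using le[of "Suc i" j] le[of "Suc j" i] that by auto
  qed
  have "\<forall>i. \<exists>C. (\<forall>y. P y (C y)) \<and> ty C N {x (Suc i)<..x i} = e" using blocks by blast
  from choice[OF this] obtain C where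
    C: "\<And>i y. P y (C i y)" "\<And>i. ty (C i) N {x (Suc i)<..x i} = e" by blast
  obtain c where c: "\<And>y. P y (c y)" "\<And>i y. y \<in> {x (Suc i)<..x i} \<Longrightarrow> c y = C i y"
    by (rule glue[of "\<lambda>i. {x (Suc i)<..x i}" P C]) (use disj C(1) in blast)+
  have fin: "finite (range c)" using bound[OF c(1)] by (rule finite_range_bounded)
  have "ty c N {x j<..x i} = e" if "i < j" for i j
    using that
  proof (induction rule: less_Suc_induct)
    case (1 i)
    have "ty c N {x (Suc i)<..x i} = ty (C i) N {x (Suc i)<..x i}" by (rule ty_cong[OF c(2)])
    then show ?case using C(2) by simp
  next
    case (2 i j k)
    have "x k \<le> x j" "x j \<le> x i" using le 2 by simp_all
    then show ?case using ty_interval_Un[OF fin, of "x k" "x j" "x i" N] 2 e by simp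
  qed
  then have "ty c N (\<Union>j. {x j<..x 0}) = omega_rev N e"
    by (intro ty_omega_rev[OF fin x]) auto
  with c(1) show ?thesis by (rule that)
qed

lemma noninteger_colouringI: "(\<And>x. c x < L \<and> even (c x)) \<Longrightarrow> noninteger_colouring L c"
  by (simp add: noninteger_colouring_def)

lemma finite_noninteger_colouring: "noninteger_colouring L c \<Longrightarrow> finite (range c)"
  by (rule finite_range_bounded[of c L]) (simp add: noninteger_colouring_def)

lemma interval_types_cat:
  assumes "s \<in> interval_types L N" "t \<in> interval_types L N" shows "cat N s t \<in> interval_types L N"
proof -
  obtain c1 where c1: "noninteger_colouring L c1" "ty c1 N {0<..1} = s" using interval_types_on[OF assms(1), of 0 1] by auto
  obtain c2 where c2: "noninteger_colouring L c2" "ty c2 N {1<..2} = t" using interval_types_on[OF assms(2), of 1 2] by auto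
  let ?c = "\<lambda>x. if x \<le> 1 then c1 x else c2 x"
  have h: "noninteger_colouring L ?c" using c1(1) c2(1) by (simp add: noninteger_colouring_def)
  have "ty ?c N {0<..1} = ty c1 N {0<..1}" "ty ?c N {1<..2} = ty c2 N {1<..2}"
    by (rule ty_cong; simp)+
  then have "ty ?c N {0<..2} = cat N s t"
    using ty_interval_Un[OF finite_noninteger_colouring[OF h], of 0 1 2 N] c1 c2 by simp
  then show ?thesis using interval_types_interval[OF h, of 0 2 N] by simp
qed

lemma interval_types_omegal:
  assumes "e \<in> interval_types L N" "cat N e e = e" shows "omega_rev N e \<in> interval_types L N"
proof -
  \<comment> \<open>The cut points descend from 1 to 0, so the blocks exactly fill
    \<open>{0<..1}\<close>.\<close>
  define x :: "nat \<Rightarrow> real" where "x i = inverse (real (Suc i))" for i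
  have x: "x j < x i" if "i < j" for i j using that by (simp add: x_def)
  obtain c where c: "\<And>y. c y < L \<and> even (c y)" "ty c N (\<Union>j. {x j<..x 0}) = omega_rev N e"
  proof (rule glue_omega_rev[of x "\<lambda>y l. l < L \<and> even l" L N e, OF x])
    show "\<exists>C. (\<forall>y. C y < L \<and> even (C y)) \<and> ty C N {x (Suc i)<..x i} = e" for i
      using interval_types_on[OF assms(1) x[of i "Suc i"]] by (simp add: noninteger_colouring_def)
  qed (use assms in auto)
  have "(\<Union>j. {x j<..x 0}) = {0<..1}"
  proof (intro equalityI subsetI)
    fix y assume y: "y \<in> {0<..1::real}"
    then obtain n where "x n < y" using reals_Archimedean[of y] by (auto simp: x_def)
    then show "y \<in> (\<Union>j. {x j<..x 0})" using y by (auto simp: x_def)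
  next
    fix y assume "y \<in> (\<Union>j. {x j<..x 0})"
    then obtain j where "x j < y" "y \<le> x 0" by auto
    moreover have "0 < x j" "x 0 = 1" by (simp_all add: x_def)
    ultimately show "y \<in> {0<..1}" by simp
  qed
  moreover have "noninteger_colouring L c" using c(1) by (rule noninteger_colouringI)
  ultimately show ?thesis using c(2) interval_types_interval[of L c 0 1 N] by simp
qed

lemma glue_omega_interval:
  assumes "e \<in> interval_types L N" "cat N e e = e" "a < (b::real)"
  obtains c where "noninteger_colouring L c" "ty c N {a<..<b} = omega N e"
proof -
  define x :: "nat \<Rightarrow> real" where "x i = b - (b - a) * inverse (real (Suc i))" for i
  have x: "x i < x j" if "i < j" for i j
    using that assms(3) by (simp add: x_def)
  then have xm: "strict_mono x" by (simp add: strict_mono_def)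
  obtain c where c: "\<And>y. c y < L \<and> even (c y)" "ty c N (\<Union>j. {x 0<..x j}) = omega N e"
  proof (rule glue_omega[of x "\<lambda>y l. l < L \<and> even l" L N e, OF xm])
    show "\<exists>C. (\<forall>y. C y < L \<and> even (C y)) \<and> ty C N {x i<..x (Suc i)} = e" for i
      using interval_types_on[OF assms(1) x[of i "Suc i"]] by (simp add: noninteger_colouring_def)
  qed (use assms in auto)
  have "(\<Union>j. {x 0<..x j}) = {a<..<b}"
  proof (intro equalityI subsetI)
    fix y assume y: "y \<in> {a<..<b}"
    then obtain n where "inverse (real (Suc n)) < (b - y) / (b - a)"
      using reals_Archimedean[of "(b - y) / (b - a)"] by auto
    then have "(b - a) * inverse (real (Suc n)) < b - y"
      using assms(3) by (simp add: pos_less_divide_eq mult.commute)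
    then have "y \<le> x n" by (simp add: x_def)
    then show "y \<in> (\<Union>j. {x 0<..x j})" using y by (auto simp: x_def)
  next
    fix y assume "y \<in> (\<Union>j. {x 0<..x j})"
    then obtain j where "x 0 < y" "y \<le> x j" by auto
    moreover have "x j < b" "x 0 = a" using assms(3) by (simp_all add: x_def)
    ultimately show "y \<in> {a<..<b}" by simp
  qed
  with c(2) show ?thesis using that[OF noninteger_colouringI[OF c(1)]] by simp
qed

lemma ty_append_point:
  assumes "finite (range c)" "0 < N" "a < b"
  shows "ty (c(b := l)) N {a<..b} = cat N (ty c N {a<..<b}) (point_type l)"
proof -
  have "finite (range (c(b := l)))"
    by (rule finite_subset[of _ "insert l (range c)"]) (use assms(1) in auto)
  then have "ty (c(b := l)) N ({a<..<b} \<union> {b}) =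
      cat N (ty (c(b := l)) N {a<..<b}) (ty (c(b := l)) N {b})"
    by (rule ty_Un) (auto simp: below_def)
  moreover have "{a<..<b} \<union> {b} = {a<..b}" using assms(3) by auto
  moreover have "ty (c(b := l)) N {a<..<b} = ty c N {a<..<b}" by (rule ty_cong) auto
  ultimately show ?thesis using ty_singleton_pos[OF assms(2)] by simp
qed

lemma interval_types_omega:
  assumes "e \<in> interval_types L N" "cat N e e = e" "0 < N" "l < L" "even l"
  shows "cat N (omega N e) (point_type l) \<in> interval_types L N"
proof -
  obtain c where c: "noninteger_colouring L c" "ty c N {0<..<1} = omega N e"
    by (rule glue_omega_interval[OF assms(1,2), of 0 1]) auto
  have "ty (c(1 := l)) N {0<..1} = cat N (omega N e) (point_type l)"
    using ty_append_point[OF finite_noninteger_colouring[OF c(1)] assms(3), of 0 1 l] c(2) by simp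
  moreover have "noninteger_colouring L (c(1 := l))" using c(1) assms by (simp add: noninteger_colouring_def)
  ultimately show ?thesis using interval_types_interval[of L "c(1 := l)" 0 1 N] by simp
qed

text \<open>Give every real a component type so that each type is dense, then blow up the reals with
  a nondegenerate type to closed intervals. The fibres of the resulting staircase, coloured by
  chosen witnesses, form the shuffle.\<close>

lemma interval_types_shuf:
  assumes N: "0 < N" and fin: "finite D"
    and legal: "\<And>d. d \<in> D \<Longrightarrow> \<exists>l<L. even l \<and> (d = point_type l \<or> (\<exists>s\<in>interval_types L N. d = cat N (point_type l) s))"
    and l0: "l0 < L" "even l0" "point_type l0 \<in> D" and l: "l < L" "even l"
    and E: "set_decode E = (\<Union>d\<in>D. set_decode d)"
  shows "cat N (shuffle N E) (point_type l) \<in> interval_types L N"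
proof -
  obtain k :: "real \<Rightarrow> nat" where k: "\<And>x. k x \<in> D" "countable {x. k x \<noteq> point_type l0}"
    "\<And>a b d. a < b \<Longrightarrow> d \<in> D \<Longrightarrow> \<exists>x. a < x \<and> x < b \<and> k x = d"
    using dense_colouring[OF fin, of "point_type l0"] unfolding insert_absorb[OF l0(3)] by metis
  define point where "point d \<longleftrightarrow> (\<exists>l<L. even l \<and> d = point_type l)" for d
  \<comment> \<open>The default of the dense colouring is a point type; hence only countably many
    reals have to be blown up, as \<open>staircase\<close> requires.\<close>
  have "{x. \<not> point (k x)} \<subseteq> {x. k x \<noteq> point_type l0}" using l0 by (auto simp: point_def)
  then have "countable {x. \<not> point (k x)}" using k(2) countable_subset by blast
  then obtain g lo hi where g: "mono g" "\<And>x. g -` {x} = {lo x..hi x :: real}" "\<And>x. lo x \<le> hi x"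
    "\<And>x. lo x < hi x \<longleftrightarrow> x \<in> {x. \<not> point (k x)}"
    using staircase by metis
  have glo: "g (lo x) = x" and ghi: "g (hi x) = x" for x
    using g(2)[of x] g(3)[of x] unfolding set_eq_iff by auto
  have "\<exists>C. noninteger_colouring L C \<and> ty C N (g -` {x}) = k x" for x
  proof (cases "point (k x)")
    case True
    then obtain l' where l': "l' < L" "even l'" "k x = point_type l'" by (auto simp: point_def)
    have "lo x = hi x" using g(3)[of x] g(4)[of x] True by simp
    then have "ty (\<lambda>_. l') N (g -` {x}) = k x" using g(2) l'(3) ty_singleton_pos[OF N] by simp
    then show ?thesis using l' by (intro exI[of _ "\<lambda>_. l'"]) (simp add: noninteger_colouring_def)
  next
    case False
    then have lt: "lo x < hi x" using g(4) by simp
    obtain l' s where l': "l' < L" "even l'" "s \<in> interval_types L N" "k x = cat N (point_type l') s"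
      using legal[OF k(1)[of x]] False by (auto simp: point_def)
    obtain C where C: "noninteger_colouring L C" "ty C N {lo x<..hi x} = s" using interval_types_on[OF l'(3) lt] by blast
    let ?C = "C(lo x := l')"
    have h: "noninteger_colouring L ?C" using C(1) l' by (simp add: noninteger_colouring_def)
    have "{lo x..hi x} = {lo x} \<union> {lo x<..hi x}" using lt by auto
    moreover have "ty ?C N {lo x<..hi x} = s" using C(2) ty_cong[of "{lo x<..hi x}" ?C C N] by simp
    moreover have "ty ?C N ({lo x} \<union> {lo x<..hi x}) = cat N (ty ?C N {lo x}) (ty ?C N {lo x<..hi x})"
      by (rule ty_Un[OF finite_noninteger_colouring[OF h]]) (auto simp: below_def)
    ultimately have "ty ?C N (g -` {x}) = k x"
      using ty_singleton_pos[OF N] by (simp add: g(2) l'(4))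
    with h show ?thesis by blast
  qed
  then obtain C where C: "\<And>x. noninteger_colouring L (C x)" "\<And>x. ty (C x) N (g -` {x}) = k x" by metis
  obtain c where c: "\<And>y. c y < L \<and> even (c y)" "\<And>i y. y \<in> g -` {i} \<Longrightarrow> c y = C i y"
    by (rule glue[of "\<lambda>x. g -` {x}" "\<lambda>y l. l < L \<and> even l" C]) (use l0 C(1) in \<open>auto simp: noninteger_colouring_def\<close>)
  have h: "noninteger_colouring L c" using c(1) by (rule noninteger_colouringI)
  have "ty c N (g -` {x}) = ty (C x) N (g -` {x})" for x by (rule ty_cong) (rule c(2))
  then have fibre: "ty c N (g -` {x}) = k x" for x using C(2) by simp
  have lt: "x < y" if "g x < g y" for x y using that g(1) by (meson leI monoD not_le)
  \<comment> \<open>The shuffle is taken over the reals strictly between 0 and 1, so it runs from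
    the right end of the fibre over 0 to the left end of the fibre over 1; the latter is afterwards
    recoloured as the final point.\<close>
  have "ty c N {x. g (lo 0) < g x \<and> g x < g (lo 1)} = shuffle N E"
  proof (rule ty_shuffle[OF finite_noninteger_colouring[OF h] g(1) _ order_refl])
    show "(\<Union>x\<in>{x. g u < g x \<and> g x < g v}. set_decode (ty c N (g -` {g x}))) = set_decode E"
      if "g u < g v" for u v
    proof -
      have img: "(\<lambda>x. k (g x)) ` {x. g u < g x \<and> g x < g v} = D"
      proof (intro equalityI subsetI)
        fix d assume "d \<in> D"
        then obtain x where "g u < x" "x < g v" "k x = d" using k(3)[OF \<open>g u < g v\<close>] by blast
        then show "d \<in> (\<lambda>x. k (g x)) ` {x. g u < g x \<and> g x < g v}"
          by (intro image_eqI[of _ _ "lo x"]) (simp_all add: glo)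
      qed (use k(1) in auto)
      show ?thesis by (simp add: fibre E img[symmetric])
    qed
  qed (auto simp: glo)
  moreover have "{x. g (lo 0) < g x \<and> g x < g (lo 1)} = {hi 0<..<lo 1}"
  proof (intro equalityI subsetI)
    fix x assume x: "x \<in> {x. g (lo 0) < g x \<and> g x < g (lo 1)}"
    then show "x \<in> {hi 0<..<lo 1}" using lt[of "hi 0" x] lt[of x "lo 1"] by (simp add: glo ghi)
  next
    fix x assume x: "x \<in> {hi 0<..<lo 1}"
    have "0 \<le> g x" "g x \<le> 1"
      using x monoD[OF g(1), of "hi 0" x] monoD[OF g(1), of x "lo 1"] by (simp_all add: glo ghi)
    moreover have "x \<notin> g -` {0}" "x \<notin> g -` {1}" using x unfolding g(2) by auto
    then have "g x \<noteq> 0" "g x \<noteq> 1" by auto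
    ultimately show "x \<in> {x. g (lo 0) < g x \<and> g x < g (lo 1)}" by (simp add: glo)
  qed
  ultimately have "ty (c(lo 1 := l)) N {hi 0<..lo 1} = cat N (shuffle N E) (point_type l)"
    using ty_append_point[OF finite_noninteger_colouring[OF h] N] lt[of "hi 0" "lo 1"] by (simp add: glo ghi)
  moreover have "noninteger_colouring L (c(lo 1 := l))" using h l by (simp add: noninteger_colouring_def)
  ultimately show ?thesis
    using interval_types_interval[of L "c(lo 1 := l)" "hi 0" "lo 1" N] lt[of "hi 0" "lo 1"] by (simp add: glo ghi)
qed

text \<open>A realised type lies in every closed set by \<open>inS_interval\<close>; conversely the
  set of realised types is itself closed, by the constructions above.\<close>

theorem interval_type_iff:
  assumes "0 < N" shows "interval_type N L h \<longleftrightarrow> h \<in> interval_types L N"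
proof
  assume "h \<in> interval_types L N"
  then obtain c where c: "noninteger_colouring L c" "h = ty c N {0<..1}" unfolding interval_types_def by blast
  show "interval_type N L h"
    unfolding interval_type_def
  proof (intro allI impI)
    fix S assume "interval_closed N L S"
    then interpret closed_types c L N S
      using c(1) assms by unfold_locales (auto simp: noninteger_colouring_def)
    show "h \<in> set_decode S" using inS_interval[of 0 1] c(2) by simp
  qed
next
  have sub: "interval_types L N \<subseteq> {..<tbound L N}"
    unfolding interval_types_def using ty_less[OF range_bounded] by (auto simp: noninteger_colouring_def)
  define S where "S = set_encode (interval_types L N)"
  have S: "set_decode S = interval_types L N"
    unfolding S_def using finite_subset[OF sub] by simp
  have "interval_closed N L S"
    unfolding interval_closed_def S
  proof (intro conjI ballI allI impI)
    fix D l
    assume D: "\<forall>d\<in>set_decode D. \<exists>l. l < L \<and> even l \<and> (d = point_type l \<or> (\<exists>s\<in>interval_types L N. d = cat N (point_type l) s))"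
      "\<exists>l. l < L \<and> even l \<and> point_type l \<in> set_decode D" and l: "l < L" "even l"
    from D(2) obtain l0 where l0: "l0 < L" "even l0" "point_type l0 \<in> set_decode D" by blast
    show "cat N (shuffle N (set_encode {e. e < D \<and> (\<exists>d\<in>set_decode D. e \<in> set_decode d)})) (point_type l) \<in> interval_types L N"
      by (rule interval_types_shuf[OF assms _ _ l0 l]) (use D(1) in \<open>auto dest: set_decode_less intro: less_trans\<close>)
  qed (auto intro: interval_types_cat interval_types_omegal interval_types_omega assms)
  moreover have "S < 2 ^ tbound L N" unfolding S_def by (rule set_encode_less[OF sub])
  moreover assume "interval_type N L h"
  ultimately show "h \<in> interval_types L N" unfolding interval_type_def S[symmetric] by blast
qed

lemma interval_type_interval: "0 < N \<Longrightarrow> noninteger_colouring L c \<Longrightarrow> a < b \<Longrightarrow> interval_type N L (ty c N {a<..b})"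
  by (simp add: interval_type_iff interval_types_interval)

section \<open>Intervals between integers and the whole line\<close>

definition integer_colouring :: "nat \<Rightarrow> (real \<Rightarrow> nat) \<Rightarrow> bool" where
  "integer_colouring L c \<longleftrightarrow> (\<forall>x. c x < L \<and> (odd (c x) \<longleftrightarrow> x \<in> \<int>))"

definition integral_types :: "nat \<Rightarrow> nat \<Rightarrow> nat set" where
  "integral_types L N = {ty c N {0<..real m} | c m. integer_colouring L c \<and> 0 < m}"

text \<open>The generators are the types of a unit interval ending in an integer: an integer-free
  half-open part of type \<open>h\<close>, a homogeneous approach to the integer of type
  \<open>omega N e\<close>, and the integer with its odd letter.\<close>

definition integral_closed :: "nat \<Rightarrow> nat \<Rightarrow> nat \<Rightarrow> bool" where
  "integral_closed N L S \<longleftrightarrow>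
    (\<forall>h. h < tbound L N \<longrightarrow> (\<forall>e. e < tbound L N \<longrightarrow> interval_type N L h \<longrightarrow> interval_type N L e \<longrightarrow> cat N e e = e \<longrightarrow>
      (\<forall>l. l < L \<longrightarrow> odd l \<longrightarrow> cat N (cat N h (omega N e)) (point_type l) \<in> set_decode S))) \<and>
    (\<forall>s\<in>set_decode S. \<forall>t\<in>set_decode S. cat N s t \<in> set_decode S)"

definition integral_type :: "nat \<Rightarrow> nat \<Rightarrow> nat \<Rightarrow> bool" where
  "integral_type N L h \<longleftrightarrow> (\<forall>S. S < 2 ^ tbound L N \<longrightarrow> integral_closed N L S \<longrightarrow> h \<in> set_decode S)"

text \<open>Cutting the line at suitable integers leaves a homogeneous sum in each direction and a
  finite middle stretch of type \<open>w\<close>.\<close>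

definition line_type :: "nat \<Rightarrow> nat \<Rightarrow> nat \<Rightarrow> bool" where
  "line_type N L t \<longleftrightarrow> (\<exists>u. u < tbound L N \<and> (\<exists>w. w < tbound L N \<and> (\<exists>v. v < tbound L N \<and>
    integral_type N L u \<and> integral_type N L w \<and> integral_type N L v \<and> cat N u u = u \<and> cat N v v = v \<and>
    t = cat N (cat N (omega_rev N u) w) (omega N v))))"

lemma finite_integer_colouring: "integer_colouring L c \<Longrightarrow> finite (range c)"
  by (rule finite_range_bounded[of c L]) (simp add: integer_colouring_def)

lemma ty_shift: "ty (\<lambda>x. c (x - k)) N {a + k<..b + k} = ty c N {a<..b}" for k :: real
proof -
  have "(\<lambda>x. x + k) ` {a<..b} = {a + k<..b + k}"
    by (auto intro!: image_eqI[of _ _ "y - k" for y])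
  then show ?thesis using ty_iso[of "{a<..b}" "\<lambda>x. x + k" "\<lambda>x. c (x - k)" c N] by simp
qed

lemma integer_colouring_shift: "integer_colouring L c \<Longrightarrow> k \<in> \<int> \<Longrightarrow> integer_colouring L (\<lambda>x. c (x - k))"
proof -
  assume *: "integer_colouring L c" "k \<in> \<int>"
  have "x - k \<in> \<int> \<longleftrightarrow> x \<in> \<int>" for x
    using Ints_diff[of x k] Ints_add[of "x - k" k] *(2) by auto
  then show "integer_colouring L (\<lambda>x. c (x - k))" using *(1) by (simp add: integer_colouring_def)
qed

lemma ty_shift0: "ty (\<lambda>x. c (x - k)) N {k<..k + m} = ty c N {0<..m}" for k :: real
  using ty_shift[of c k N 0 m] by (simp add: add.commute)

lemma integral_types_cat:
  assumes "s \<in> integral_types L N" "t \<in> integral_types L N" shows "cat N s t \<in> integral_types L N"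
proof -
  obtain c1 m1 where w1: "integer_colouring L c1" "0 < m1" "ty c1 N {0<..real m1} = s"
    using assms(1) unfolding integral_types_def by blast
  have w1_3: "integer_colouring L (\<lambda>x. c1 (x - k))" if "k \<in> \<int>" for k by (rule integer_colouring_shift[OF w1(1) that])
  have w1_4: "ty (\<lambda>x. c1 (x - k)) N {k<..k + real m1} = s" for k
    unfolding ty_shift0 by (rule w1(3))
  obtain c2 m2 where w2: "integer_colouring L c2" "0 < m2" "ty c2 N {0<..real m2} = t"
    using assms(2) unfolding integral_types_def by blast
  have w2_3: "integer_colouring L (\<lambda>x. c2 (x - k))" if "k \<in> \<int>" for k by (rule integer_colouring_shift[OF w2(1) that])
  have w2_4: "ty (\<lambda>x. c2 (x - k)) N {k<..k + real m2} = t" for k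
    unfolding ty_shift0 by (rule w2(3))
  let ?c = "\<lambda>x. if x \<le> real m1 then c1 x else c2 (x - real m1)"
  have v: "integer_colouring L ?c" using w1(1) w2_3[of "real m1"] by (simp add: integer_colouring_def)
  have "ty ?c N {0<..real m1} = ty c1 N {0<..real m1}" by (rule ty_cong) simp
  then have s: "ty ?c N {0<..real m1} = s" using w1_4[of 0] by simp
  have "ty ?c N {real m1<..real m1 + real m2} = ty (\<lambda>x. c2 (x - real m1)) N {real m1<..real m1 + real m2}"
    by (rule ty_cong) simp
  then have "ty ?c N {real m1<..real m1 + real m2} = t" using w2_4 by simp
  then have "ty ?c N {0<..real (m1 + m2)} = cat N s t"
    using ty_interval_Un[OF finite_integer_colouring[OF v], of 0 "real m1" "real m1 + real m2" N] s by simp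
  then show ?thesis
    using v w2(2) unfolding integral_types_def by (intro CollectI exI[of _ ?c] exI[of _ "m1 + m2"]) simp
qed

lemma integral_types_base:
  assumes "h \<in> interval_types L N" "e \<in> interval_types L N" "cat N e e = e" "l < L" "odd l" "0 < N"
  shows "cat N (cat N h (omega N e)) (point_type l) \<in> integral_types L N"
proof -
  obtain c1 where c1: "noninteger_colouring L c1" "ty c1 N {0<..1/2} = h" using interval_types_on[OF assms(1), of 0 "1/2"] by auto
  obtain c2 where c2: "noninteger_colouring L c2" "ty c2 N {1/2<..<1} = omega N e"
    by (rule glue_omega_interval[OF assms(2,3), of "1/2" 1]) auto
  \<comment> \<open>Every integer, not only 1, receives the odd letter, because
    \<open>integer_colouring\<close> constrains the whole line.\<close>
  let ?c = "\<lambda>x. if x \<in> \<int> then l else if x \<le> 1/2 then c1 x else c2 x"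
  have v: "integer_colouring L ?c" using c1(1) c2(1) assms(4,5) by (auto simp: integer_colouring_def noninteger_colouring_def)
  have ni: "x \<notin> \<int>" if "0 < x" "x < 1" for x :: real
    using that by (auto elim!: Ints_cases)
  have "ty ?c N {0<..1/2} = ty c1 N {0<..1/2}" "ty ?c N {1/2<..<1} = ty c2 N {1/2<..<1}"
    by (rule ty_cong; use ni in force)+
  moreover have "ty ?c N ({0<..1/2} \<union> {1/2<..<1}) = cat N (ty ?c N {0<..1/2}) (ty ?c N {1/2<..<1})"
    by (rule ty_Un[OF finite_integer_colouring[OF v]]) (auto simp: below_def)
  moreover have "ty ?c N (({0<..1/2} \<union> {1/2<..<1}) \<union> {1}) =
      cat N (ty ?c N ({0<..1/2} \<union> {1/2<..<1})) (ty ?c N {1})"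
    by (rule ty_Un[OF finite_integer_colouring[OF v]]) (auto simp: below_def)
  moreover have "({0<..1/2} \<union> {1/2<..<1}) \<union> {1} = {0<..real 1}" by auto
  ultimately have "ty ?c N {0<..real 1} = cat N (cat N h (omega N e)) (point_type l)"
    using c1(2) c2(2) ty_singleton_pos[OF assms(6), of ?c 1] by simp
  then show ?thesis
    using v unfolding integral_types_def by (intro CollectI exI[of _ ?c] exI[of _ 1]) simp
qed

lemma integer_colouring_unit:
  assumes v: "integer_colouring L c" and k: "k \<in> \<int>" and N: "0 < N"
  obtains h e l where "interval_type N L h" "interval_type N L e" "cat N e e = e" "l < L" "odd l"
    "ty c N {k<..k + 1} = cat N (cat N h (omega N e)) (point_type l)"
proof -
  have fin: "finite (range c)" using v by (rule finite_integer_colouring)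
  \<comment> \<open>Recolouring the integers by an even letter makes
    \<open>interval_type_interval\<close> applicable; inside the open unit interval nothing
    changes.\<close>
  define c' where "c' x = (if x \<in> \<int> then 0 else c x)" for x
  have "0 < L" using v by (auto simp: integer_colouring_def dest: spec[of _ 0])
  then have h: "noninteger_colouring L c'" using v by (auto simp: noninteger_colouring_def integer_colouring_def c'_def)
  have ni: "x \<notin> \<int>" if "k < x" "x < k + 1" for x
  proof
    assume "x \<in> \<int>"
    then obtain i j where "x = of_int i" "k = of_int j" using k by (auto elim!: Ints_cases)
    then show False using that by auto
  qed
  have eq: "ty c N X = ty c' N X" if "X \<subseteq> {k<..<k + 1}" for X
    by (rule ty_cong) (use ni that in \<open>auto simp: c'_def subset_iff\<close>)
  define x :: "nat \<Rightarrow> real" where "x i = k + 1 - inverse (real (i + 2))" for i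
  have x: "x i < x j" if "i < j" for i j using that by (simp add: x_def)
  have xb: "k < x i" "x i < k + 1" for i
    unfolding x_def by (auto simp: inverse_less_1_iff)
  have less: "ty c N {x i<..x j} < tbound L N" for i j
    by (rule ty_less[OF range_bounded]) (use v in \<open>simp add: integer_colouring_def\<close>)
  obtain f :: "nat \<Rightarrow> nat" and e where f: "strict_mono f"
    and e0: "\<forall>i j. i < j \<longrightarrow> ty c N {x (f i)<..x (f j)} = e"
    using homogeneous_subsequence[of "\<lambda>i j. ty c N {x i<..x j}", OF less] .
  have e: "ty c N {x (f i)<..x (f j)} = e" if "i < j" for i j using e0 that by simp
  have xf: "strict_mono (\<lambda>i. x (f i))" using f x by (simp add: strict_mono_def)
  have le: "x (f 0) \<le> x (f 1)" "x (f 1) \<le> x (f 2)"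
    using strict_monoD[OF xf, of 0 1] strict_monoD[OF xf, of 1 2] by simp_all
  have "cat N e e = e"
    using ty_interval_Un[OF fin le, of N] e[of 0 1] e[of 1 2] e[of 0 2] by simp
  moreover have "interval_type N L e"
  proof -
    have "e = ty c' N {x (f 0)<..x (f 1)}"
    proof -
      have "{x (f 0)<..x (f 1)} \<subseteq> {k<..<k + 1}"
        using xb(1)[of "f 0"] xb(2)[of "f 1"] by (intro subsetI) simp
      from eq[OF this] show ?thesis using e[of 0 1] by simp
    qed
    then show ?thesis using interval_type_interval[OF N h, of "x (f 0)" "x (f 1)"] strict_monoD[OF xf, of 0 1] by simp
  qed
  moreover have "interval_type N L (ty c N {k<..x (f 0)})"
  proof -
    have "{k<..x (f 0)} \<subseteq> {k<..<k + 1}" using xb(2)[of "f 0"] by (intro subsetI) simp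
    from eq[OF this] show ?thesis using interval_type_interval[OF N h xb(1)[of "f 0"]] by simp
  qed
  moreover have "c (k + 1) < L" "odd (c (k + 1))" using v k by (auto simp: integer_colouring_def)
  moreover have "ty c N {k<..k + 1} = cat N (cat N (ty c N {k<..x (f 0)}) (omega N e)) (point_type (c (k + 1)))"
  proof -
    have U: "(\<Union>j. {x (f 0)<..x (f j)}) = {x (f 0)<..<k + 1}"
    proof (intro equalityI subsetI)
      fix y assume y: "y \<in> {x (f 0)<..<k + 1}"
      obtain n where "inverse (real (Suc n)) < k + 1 - y" using reals_Archimedean[of "k + 1 - y"] y by auto
      moreover have "inverse (real (n + 2)) \<le> inverse (real (Suc n))" by simp
      ultimately have "inverse (real (n + 2)) < k + 1 - y" by linarith
      then have "y \<le> x n" by (simp add: x_def)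
      moreover have "x n \<le> x (f n)" using x[of n "f n"] seq_suble[OF f, of n] by (cases "n = f n") auto
      ultimately have "y \<le> x (f n)" by simp
      then show "y \<in> (\<Union>j. {x (f 0)<..x (f j)})" using y by auto
    next
      fix y assume "y \<in> (\<Union>j. {x (f 0)<..x (f j)})"
      then obtain j where "x (f 0) < y" "y \<le> x (f j)" by auto
      then show "y \<in> {x (f 0)<..<k + 1}" using xb(2)[of "f j"] by simp
    qed
    have o: "ty c N {x (f 0)<..<k + 1} = omega N e"
      using ty_omega[where x = "\<lambda>i. x (f i)" and i = 0, OF fin xf e order_refl] U by simp
    have "ty c N (({k<..x (f 0)} \<union> {x (f 0)<..<k + 1}) \<union> {k + 1}) =
        cat N (ty c N ({k<..x (f 0)} \<union> {x (f 0)<..<k + 1})) (ty c N {k + 1})"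
      by (rule ty_Un[OF fin]) (use xb[of "f 0"] in \<open>auto simp: below_def\<close>)
    moreover have "ty c N ({k<..x (f 0)} \<union> {x (f 0)<..<k + 1}) =
        cat N (ty c N {k<..x (f 0)}) (ty c N {x (f 0)<..<k + 1})"
      by (rule ty_Un[OF fin]) (auto simp: below_def)
    moreover have "({k<..x (f 0)} \<union> {x (f 0)<..<k + 1}) \<union> {k + 1} = {k<..k + 1}"
      using xb[of "f 0"] by auto
    ultimately show ?thesis using o ty_singleton_pos[OF N] by simp
  qed
  ultimately show ?thesis by (intro that[of "ty c N {k<..x (f 0)}" e "c (k + 1)"])
qed

lemma interval_type_less:
  assumes "0 < N" "interval_type N L h" shows "h < tbound L N"
proof -
  obtain c where "noninteger_colouring L c" "h = ty c N {0<..1}" using assms by (auto simp: interval_type_iff interval_types_def)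
  then show ?thesis using ty_less[OF range_bounded, of c L] by (auto simp: noninteger_colouring_def)
qed

lemma integral_type_interval:
  assumes v: "integer_colouring L c" and k: "k \<in> \<int>" and N: "0 < N" and m: "0 < m"
  shows "integral_type N L (ty c N {k<..k + real m})"
  unfolding integral_type_def
proof (intro allI impI)
  fix S assume S: "integral_closed N L S"
  have fin: "finite (range c)" using v by (rule finite_integer_colouring)
  have unit: "ty c N {k<..k + 1} \<in> set_decode S" if kZ: "k \<in> \<int>" for k
  proof -
    obtain h e l where "interval_type N L h" "interval_type N L e" "cat N e e = e" "l < L" "odd l"
      "ty c N {k<..k + 1} = cat N (cat N h (omega N e)) (point_type l)" using integer_colouring_unit[OF v kZ N] .
    then show ?thesis
      using S[unfolded integral_closed_def, THEN conjunct1] interval_type_less[OF N] by simp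
  qed
  have "ty c N {k<..k + real (Suc n)} \<in> set_decode S" for n
  proof (induction n)
    case 0
    show ?case using unit[OF k] by simp
  next
    case (Suc n)
    have "k + real (Suc n) \<in> \<int>" using k by (metis Ints_add Ints_of_nat)
    from unit[OF this] have "cat N (ty c N {k<..k + real (Suc n)})
        (ty c N {k + real (Suc n)<..k + real (Suc n) + 1}) \<in> set_decode S"
      using Suc S[unfolded integral_closed_def, THEN conjunct2] by blast
    also have "cat N (ty c N {k<..k + real (Suc n)}) (ty c N {k + real (Suc n)<..k + real (Suc n) + 1}) =
        ty c N {k<..k + real (Suc n) + 1}"
      by (rule ty_interval_Un[OF fin, symmetric]) simp_all
    also have "k + real (Suc n) + 1 = k + real (Suc (Suc n))" by simp
    finally show ?case .
  qed
  from this[of "m - 1"] show "ty c N {k<..k + real m} \<in> set_decode S" using m by simp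
qed

lemma integral_type_iff:
  assumes N: "0 < N" shows "integral_type N L t \<longleftrightarrow> t \<in> integral_types L N"
proof
  assume "t \<in> integral_types L N"
  then show "integral_type N L t" using integral_type_interval[OF _ _ N, of L _ 0] by (auto simp: integral_types_def)
next
  have sub: "integral_types L N \<subseteq> {..<tbound L N}"
    unfolding integral_types_def using ty_less[OF range_bounded] by (auto simp: integer_colouring_def)
  define S where "S = set_encode (integral_types L N)"
  have S: "set_decode S = integral_types L N"
    unfolding S_def using finite_subset[OF sub] by simp
  have "integral_closed N L S"
    unfolding integral_closed_def S interval_type_iff[OF N] using integral_types_cat integral_types_base N by blast
  moreover have "S < 2 ^ tbound L N" unfolding S_def by (rule set_encode_less[OF sub])
  moreover assume "integral_type N L t"
  ultimately show "t \<in> integral_types L N" unfolding integral_type_def S[symmetric] by blast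
qed

lemma integral_type_less:
  assumes "0 < N" "integral_type N L t" shows "t < tbound L N"
proof -
  obtain c m where "integer_colouring L c" "t = ty c N {0<..real m}" using assms by (auto simp: integral_type_iff integral_types_def)
  then show ?thesis using ty_less[OF range_bounded, of c L] by (auto simp: integer_colouring_def)
qed

lemma line_type_sound:
  assumes N: "0 < N" and L: "1 < L" and t: "line_type N L t"
  shows "\<exists>c. integer_colouring L c \<and> t = ty c N UNIV"
proof -
  obtain u w v where uwv: "u \<in> integral_types L N" "w \<in> integral_types L N" "v \<in> integral_types L N" "cat N u u = u" "cat N v v = v"
    and t: "t = cat N (cat N (omega_rev N u) w) (omega N v)"
    using t unfolding line_type_def integral_type_iff[OF N] by blast
  let ?P = "\<lambda>x l. l < L \<and> (odd l \<longleftrightarrow> x \<in> (\<int> :: real set))"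
  obtain cu mu where u: "integer_colouring L cu" "0 < mu" "ty cu N {0<..real mu} = u"
    using uwv(1) unfolding integral_types_def by blast
  have u_3: "integer_colouring L (\<lambda>x. cu (x - k))" if "k \<in> \<int>" for k by (rule integer_colouring_shift[OF u(1) that])
  have u_4: "ty (\<lambda>x. cu (x - k)) N {k<..k + real mu} = u" for k
    unfolding ty_shift0 by (rule u(3))
  obtain cw mw where w: "integer_colouring L cw" "0 < mw" "ty cw N {0<..real mw} = w"
    using uwv(2) unfolding integral_types_def by blast
  have w_3: "integer_colouring L (\<lambda>x. cw (x - k))" if "k \<in> \<int>" for k by (rule integer_colouring_shift[OF w(1) that])
  have w_4: "ty (\<lambda>x. cw (x - k)) N {k<..k + real mw} = w" for k
    unfolding ty_shift0 by (rule w(3))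
  obtain cv mv where v: "integer_colouring L cv" "0 < mv" "ty cv N {0<..real mv} = v"
    using uwv(3) unfolding integral_types_def by blast
  have v_3: "integer_colouring L (\<lambda>x. cv (x - k))" if "k \<in> \<int>" for k by (rule integer_colouring_shift[OF v(1) that])
  have v_4: "ty (\<lambda>x. cv (x - k)) N {k<..k + real mv} = v" for k
    unfolding ty_shift0 by (rule v(3))
  \<comment> \<open>The cut points are spaced by the lengths of the witnesses, hence integers:
    translating a colouring by an integer preserves integrality.\<close>
  define x where "x i = - (real i * real mu)" for i
  define z where "z i = real mw + real i * real mv" for i
  have xm: "x j < x i" if "i < j" for i j using that u(2) by (simp add: x_def)
  have zm: "strict_mono z" using v(2) by (simp add: strict_mono_def z_def)
  obtain c1 where c1: "\<And>y. ?P y (c1 y)" "ty c1 N (\<Union>j. {x j<..x 0}) = omega_rev N u"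
  proof (rule glue_omega_rev[of x ?P L N u, OF xm])
    fix i
    have "x (Suc i) \<in> \<int>" "x i = x (Suc i) + real mu" by (auto simp: x_def algebra_simps)
    then show "\<exists>C. (\<forall>y. ?P y (C y)) \<and> ty C N {x (Suc i)<..x i} = u"
      using u_3[of "x (Suc i)"] u_4[of "x (Suc i)"] unfolding integer_colouring_def by metis
  qed (use uwv in auto)
  obtain c2 where c2: "\<And>y. ?P y (c2 y)" "ty c2 N (\<Union>j. {z 0<..z j}) = omega N v"
  proof (rule glue_omega[of z ?P L N v, OF zm])
    fix i
    have "z i \<in> \<int>" "z (Suc i) = z i + real mv" by (auto simp: z_def algebra_simps)
    then show "\<exists>C. (\<forall>y. ?P y (C y)) \<and> ty C N {z i<..z (Suc i)} = v"
      using v_3[of "z i"] v_4[of "z i"] unfolding integer_colouring_def by metis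
  qed (use uwv in auto)
  have X: "(\<Union>j. {x j<..x 0}) = {..0}"
  proof (intro equalityI subsetI)
    fix y assume y: "y \<in> {..0::real}"
    obtain n where "- y < real n * real mu" using reals_Archimedean3[of "real mu"] u(2) by auto
    then have "x n < y" "y \<le> x 0" using y by (simp_all add: x_def)
    then show "y \<in> (\<Union>j. {x j<..x 0})" by auto
  qed (auto simp: x_def)
  have Z: "(\<Union>j. {z 0<..z j}) = {real mw<..}"
  proof (intro equalityI subsetI)
    fix y assume y: "y \<in> {real mw<..}"
    obtain n where "y - real mw < real n * real mv" using reals_Archimedean3[of "real mv"] v(2) by auto
    then show "y \<in> (\<Union>j. {z 0<..z j})" using y by (auto simp: z_def intro!: exI[of _ n])
  qed (auto simp: z_def)
  let ?c = "\<lambda>y. if y \<le> 0 then c1 y else if y \<le> real mw then cw y else c2 y"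
  have vc: "integer_colouring L ?c" using c1(1) c2(1) w(1) by (auto simp: integer_colouring_def)
  have "ty ?c N {..0} = omega_rev N u"
    using c1(2) ty_cong[of "{..0}" ?c c1 N] unfolding X by simp
  moreover have "ty ?c N {0<..real mw} = w"
    using w_4[of 0] ty_cong[of "{0<..real mw}" ?c cw N] by simp
  moreover have "ty ?c N {real mw<..} = omega N v"
    using c2(2) ty_cong[of "{real mw<..}" ?c c2 N] unfolding Z by simp
  moreover have "ty ?c N ({..0} \<union> {0<..real mw}) = cat N (ty ?c N {..0}) (ty ?c N {0<..real mw})"
    by (rule ty_Un[OF finite_integer_colouring[OF vc]]) (auto simp: below_def)
  moreover have "ty ?c N (({..0} \<union> {0<..real mw}) \<union> {real mw<..}) =
      cat N (ty ?c N ({..0} \<union> {0<..real mw})) (ty ?c N {real mw<..})"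
    by (rule ty_Un[OF finite_integer_colouring[OF vc]]) (auto simp: below_def)
  moreover have "({..0} \<union> {0<..real mw}) \<union> {real mw<..} = UNIV" by auto
  ultimately have "t = ty ?c N UNIV" using t by simp
  with vc show ?thesis by blast
qed

text \<open>Ramsey's theorem is applied separately to the positive and to the negative integers,
  which makes both ends homogeneous; the middle stretch joins the first chosen integer on either
  side.\<close>

lemma line_type_complete:
  assumes N: "0 < N" and v: "integer_colouring L c"
  shows "line_type N L (ty c N UNIV)"
proof -
  have fin: "finite (range c)" using v by (rule finite_integer_colouring)
  have less: "ty c N X < tbound L N" for X
    by (rule ty_less[OF range_bounded]) (use v in \<open>simp add: integer_colouring_def\<close>)
  define x where "x i = - real (Suc i)" for i
  define z where "z i = real (Suc i)" for i
  have seg: "integral_type N L (ty c N {a<..b})" if "a \<in> \<int>" "b \<in> \<int>" "a < b" for a b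
  proof -
    have "b - a \<in> \<int>" using that by simp
    then obtain i where "b - a = of_int i" by (auto elim: Ints_cases)
    then have "b = a + real (nat i)" "0 < nat i" using that by auto
    then show ?thesis using integral_type_interval[OF v that(1) N, of "nat i"] by simp
  qed
  have zZ: "z i \<in> \<int>" and xZ: "x i \<in> \<int>" for i by (simp_all add: z_def x_def)
  obtain f :: "nat \<Rightarrow> nat" and e where f: "strict_mono f"
    and e0: "\<forall>i j. i < j \<longrightarrow> ty c N {z (f i)<..z (f j)} = e"
    using homogeneous_subsequence[of "\<lambda>i j. ty c N {z i<..z j}", OF less] .
  obtain g :: "nat \<Rightarrow> nat" and d where g: "strict_mono g"
    and d0: "\<forall>i j. i < j \<longrightarrow> ty c N {x (g j)<..x (g i)} = d"
    using homogeneous_subsequence[of "\<lambda>i j. ty c N {x j<..x i}", OF less] .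
  have e: "ty c N {z (f i)<..z (f j)} = e" if "i < j" for i j using e0 that by simp
  have d: "ty c N {x (g j)<..x (g i)} = d" if "i < j" for i j using d0 that by simp
  have zf: "strict_mono (\<lambda>i. z (f i))" using f by (simp add: strict_mono_def z_def)
  have xg: "x (g j) < x (g i)" if "i < j" for i j using strict_monoD[OF g that] by (simp add: x_def)
  have zle: "z (f 0) < z (f 1)" "z (f 1) < z (f 2)"
    using strict_monoD[OF zf, of 0 1] strict_monoD[OF zf, of 1 2] by simp_all
  have "cat N e e = e"
    using ty_interval_Un[OF fin, of "z (f 0)" "z (f 1)" "z (f 2)" N] zle e[of 0 1] e[of 1 2] e[of 0 2] by simp
  moreover have "cat N d d = d"
    using ty_interval_Un[OF fin, of "x (g 2)" "x (g 1)" "x (g 0)" N] xg[of 0 1] xg[of 1 2]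
      d[of 0 1] d[of 1 2] d[of 0 2] by simp
  moreover have "integral_type N L e" using seg[OF zZ zZ zle(1)] e[of 0 1] by simp
  moreover have "integral_type N L d" using seg[OF xZ xZ xg[of 0 1]] d[of 0 1] by simp
  moreover have xz: "x (g 0) < z (f 0)" by (simp add: x_def z_def)
  then have "integral_type N L (ty c N {x (g 0)<..z (f 0)})" by (rule seg[OF xZ zZ])
  moreover have "ty c N UNIV = cat N (cat N (omega_rev N d) (ty c N {x (g 0)<..z (f 0)})) (omega N e)"
  proof -
    have X: "(\<Union>j. {x (g j)<..x (g 0)}) = {..x (g 0)}"
    proof (intro equalityI subsetI)
      fix y assume y: "y \<in> {..x (g 0)}"
      obtain n where "- y < real n" using reals_Archimedean2 by blast
      then have "x (g n) < y" using seq_suble[OF g, of n] by (simp add: x_def)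
      then show "y \<in> (\<Union>j. {x (g j)<..x (g 0)})" using y by auto
    qed auto
    have Z: "(\<Union>j. {z (f 0)<..z (f j)}) = {z (f 0)<..}"
    proof (intro equalityI subsetI)
      fix y assume y: "y \<in> {z (f 0)<..}"
      obtain n where "y < real n" using reals_Archimedean2 by blast
      then have "y \<le> z (f n)" using seq_suble[OF f, of n] by (simp add: z_def)
      then show "y \<in> (\<Union>j. {z (f 0)<..z (f j)})" using y by auto
    qed auto
    have "ty c N {..x (g 0)} = omega_rev N d"
      using ty_omega_rev[where x = "\<lambda>i. x (g i)" and i = 0, OF fin xg d order_refl] X by simp
    moreover have "ty c N {z (f 0)<..} = omega N e"
      using ty_omega[where x = "\<lambda>i. z (f i)" and i = 0, OF fin zf e order_refl] Z by simp
    moreover have "ty c N ({..x (g 0)} \<union> {x (g 0)<..z (f 0)}) =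
        cat N (ty c N {..x (g 0)}) (ty c N {x (g 0)<..z (f 0)})"
      by (rule ty_Un[OF fin]) (auto simp: below_def)
    moreover have "ty c N (({..x (g 0)} \<union> {x (g 0)<..z (f 0)}) \<union> {z (f 0)<..}) =
        cat N (ty c N ({..x (g 0)} \<union> {x (g 0)<..z (f 0)})) (ty c N {z (f 0)<..})"
      by (rule ty_Un[OF fin]) (use xz in \<open>auto simp: below_def\<close>)
    moreover have "({..x (g 0)} \<union> {x (g 0)<..z (f 0)}) \<union> {z (f 0)<..} = UNIV" by auto
    ultimately show ?thesis by simp
  qed
  ultimately show ?thesis unfolding line_type_def using integral_type_less[OF N] by blast
qed

theorem line_type_iff:
  "0 < N \<Longrightarrow> 1 < L \<Longrightarrow> line_type N L t \<longleftrightarrow> (\<exists>c. integer_colouring L c \<and> t = ty c N UNIV)"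
  using line_type_sound line_type_complete by blast


section \<open>Evaluating formulas on types\<close>

text \<open>A configuration codes finitely many marked points \<open>p 0 < \<dots> < p (m - 1)\<close>: the types of the
  \<open>m + 1\<close> gaps between them (gap \<open>i\<close> lies directly below \<open>p i\<close>), their letters, and the index of
  the point assigned to each variable below \<open>K\<close>.\<close>

definition cvars :: "nat \<Rightarrow> nat" where "cvars w = pfst w"
definition csize :: "nat \<Rightarrow> nat" where "csize w = pfst (psnd w)"
definition cgap :: "nat \<Rightarrow> nat \<Rightarrow> nat" where "cgap w i = look (pfst (psnd (psnd w))) i"
definition cletter :: "nat \<Rightarrow> nat \<Rightarrow> nat" where "cletter w i = look (pfst (psnd (psnd (psnd w)))) i"
definition cenv :: "nat \<Rightarrow> nat \<Rightarrow> nat" where "cenv w x = look (psnd (psnd (psnd (psnd w)))) x"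

definition config :: "nat \<Rightarrow> nat \<Rightarrow> (nat \<Rightarrow> nat) \<Rightarrow> (nat \<Rightarrow> nat) \<Rightarrow> (nat \<Rightarrow> nat) \<Rightarrow> nat" where
  "config K m t l e = pair K (pair m (pair (tab (Suc m) t) (pair (tab m l) (tab K e))))"

lemma config_simps [simp]:
  "cvars (config K m t l e) = K" "csize (config K m t l e) = m"
  "i \<le> m \<Longrightarrow> cgap (config K m t l e) i = t i" "i < m \<Longrightarrow> cletter (config K m t l e) i = l i"
  "x < K \<Longrightarrow> cenv (config K m t l e) x = e x"
  by (simp_all add: config_def cvars_def csize_def cgap_def cletter_def cenv_def)

definition assign_old :: "nat \<Rightarrow> nat \<Rightarrow> nat \<Rightarrow> nat" where
  "assign_old x i w = config (cvars w) (csize w) (cgap w) (cletter w)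
     (\<lambda>y. if y = x then i else cenv w y)"

text \<open>A quantifier move to a new point: choosing a triple \<open>e\<close> of the type of gap
  \<open>i\<close> splits that gap into parts of types \<open>fst3 e\<close> and
  \<open>trd3 e\<close>, one level lower, and shifts all later indices.\<close>

definition assign_new :: "nat \<Rightarrow> nat \<Rightarrow> nat \<Rightarrow> nat \<Rightarrow> nat" where
  "assign_new x i e w = config (cvars w) (Suc (csize w))
     (\<lambda>j. if j < i then cgap w j else if j = i then fst3 e else if j = Suc i then trd3 e else cgap w (j - 1))
     (\<lambda>j. if j < i then cletter w j else if j = i then snd3 e else cletter w (j - 1))
     (\<lambda>y. if y = x then i else if cenv w y < i then cenv w y else Suc (cenv w y))"

text \<open>Integers are chosen from left to right, each step passing to the part above the chosen
  one; this uses up one level of the type per integer.\<close>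

primrec atleast_ints :: "nat \<Rightarrow> nat \<Rightarrow> bool" where
  "atleast_ints 0 t \<longleftrightarrow> True"
| "atleast_ints (Suc k) t \<longleftrightarrow> (\<exists>e\<in>set_decode t. 0 \<in> set_decode (snd3 e) \<and> atleast_ints k (trd3 e))"

definition count_ints :: "nat \<Rightarrow> nat \<Rightarrow> nat" where
  "count_ints M t = (\<Sum>k<M. if atleast_ints (Suc k) t then 1 else 0)"

text \<open>For \<open>a \<le> b\<close>, the number of integers above mark \<open>a\<close> and up
  to mark \<open>b\<close>, where the count inside each gap is cut off at \<open>M\<close>. For
  \<open>b \<le> a\<close> it is 0.\<close>

definition distance :: "nat \<Rightarrow> nat \<Rightarrow> nat \<Rightarrow> nat \<Rightarrow> nat" where
  "distance M w a b = (\<Sum>k<b - a. count_ints M (cgap w (Suc (a + k))) +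
     (if 0 \<in> set_decode (cletter w (Suc (a + k))) then 1 else 0))"

definition ncmp :: "nat \<Rightarrow> nat \<Rightarrow> nat \<Rightarrow> bool" where
  "ncmp k a b \<longleftrightarrow> (if k = 0 then a < b else if k = 1 then a \<le> b else if k = 2 then a = b
     else if k = 3 then b \<le> a else b < a)"

text \<open>\<open>z\<close> is \<open>int_encode\<close> of the constant: an even \<open>z\<close>
  stands for \<open>z div 2\<close>, an odd one for \<open>- Suc (z div 2)\<close>. Negative parts
  move to the other side to stay within the naturals. At least one of the two distances is 0, and
  the cut-off at \<open>Suc z\<close> exceeds the absolute value of the constant, so it does not
  change the comparison.\<close>

definition diff_eval :: "nat \<Rightarrow> nat \<Rightarrow> nat \<Rightarrow> nat \<Rightarrow> nat \<Rightarrow> bool" where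
  "diff_eval i k j z w \<longleftrightarrow>
     ncmp k (distance (Suc z) w j i + (if even z then 0 else Suc (z div 2)))
            (distance (Suc z) w i j + (if even z then z div 2 else 0))"

text \<open>A superset of the calls made by \<open>ev_step\<close>, uniform in the connective:
  \<open>psnd c\<close> serves negation, its two components the binary connectives, and the images
  the quantifier moves. The bound on \<open>z\<close> is justified by
  \<open>cgap_le\<close>.\<close>

definition ev_calls :: "nat \<Rightarrow> nat \<Rightarrow> nat" where
  "ev_calls c w = (if pfst c \<le> 3 then 0 else
     uni (2 ^ pair (psnd c) w) (uni (2 ^ pair (pfst (psnd c)) w) (uni (2 ^ pair (psnd (psnd c)) w)
       (uni (simage (\<lambda>i. pair (psnd (psnd c)) (assign_old (pfst (psnd c)) i w)) (2 ^ csize w - 1))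
         (simage (\<lambda>z. pair (psnd (psnd c)) (assign_new (pfst (psnd c)) (pfst z) (psnd z) w))
           (set_encode {z. z < Suc (pair (csize w) w) \<and>
              pfst z \<le> csize w \<and> psnd z \<in> set_decode (cgap w (pfst z))}))))))"

text \<open>The recursive calls are abstracted as \<open>E\<close>, so that one body serves both the
  recursive function \<open>ev\<close> and its evaluation from a finite table.\<close>

definition ev_step :: "(nat \<Rightarrow> nat \<Rightarrow> bool) \<Rightarrow> nat \<Rightarrow> nat \<Rightarrow> bool" where
  "ev_step E c w \<longleftrightarrow>
    (if pfst c = 0 then Suc (pfst (psnd c)) \<in> set_decode (cletter w (cenv w (psnd (psnd c))))
     else if pfst c = 1 then 0 \<in> set_decode (cletter w (cenv w (psnd c)))
     else if pfst c = 2 then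
       ncmp (pfst (psnd (psnd c))) (cenv w (pfst (psnd c))) (cenv w (psnd (psnd (psnd c))))
     else if pfst c = 3 then
       diff_eval (cenv w (pfst (psnd c))) (pfst (psnd (psnd c)))
         (cenv w (pfst (psnd (psnd (psnd c))))) (psnd (psnd (psnd (psnd c)))) w
     else if pfst c = 4 then \<not> E (psnd c) w
     else if pfst c = 5 then E (pfst (psnd c)) w \<and> E (psnd (psnd c)) w
     else if pfst c = 6 then E (pfst (psnd c)) w \<or> E (psnd (psnd c)) w
     else if pfst c = 7 then E (pfst (psnd c)) w \<longrightarrow> E (psnd (psnd c)) w
     else if pfst c = 8 then E (pfst (psnd c)) w \<longleftrightarrow> E (psnd (psnd c)) w
     else if pfst c = 9 then
       (\<forall>i. i < csize w \<longrightarrow> E (psnd (psnd c)) (assign_old (pfst (psnd c)) i w)) \<and>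
       (\<forall>i. i \<le> csize w \<longrightarrow> (\<forall>e\<in>set_decode (cgap w i). E (psnd (psnd c)) (assign_new (pfst (psnd c)) i e w)))
     else
       (\<exists>i. i < csize w \<and> E (psnd (psnd c)) (assign_old (pfst (psnd c)) i w)) \<or>
       (\<exists>i. i \<le> csize w \<and> (\<exists>e\<in>set_decode (cgap w i). E (psnd (psnd c)) (assign_new (pfst (psnd c)) i e w))))"

lemma set_decode_power2 [simp]: "set_decode (2 ^ a) = {a}"
proof -
  have "set_encode {a} = 2 ^ a" by (simp add: set_encode_def)
  then show ?thesis by (metis finite.emptyI finite_insert set_encode_inverse)
qed

lemma ev_calls_less: "d \<in> set_decode (ev_calls c w) \<Longrightarrow> pfst d < c"
  using psnd_less[of c] psnd_le[of "psnd c"] pfst_le[of "psnd c"]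
  by (auto simp: ev_calls_def split: if_splits)

lemma cgap_le: "cgap w i \<le> w"
proof -
  have "cgap w i \<le> pfst (psnd (psnd w))" unfolding cgap_def look_def by (rule Least_le) simp
  then show ?thesis using pfst_le[of "psnd (psnd w)"] psnd_le[of "psnd w"] psnd_le[of w] by linarith
qed

lemma set_decode_ev_calls:
  assumes "\<not> pfst c \<le> 3"
  shows "set_decode (ev_calls c w) = {pair (psnd c) w, pair (pfst (psnd c)) w, pair (psnd (psnd c)) w} \<union>
    (\<lambda>i. pair (psnd (psnd c)) (assign_old (pfst (psnd c)) i w)) ` {..<csize w} \<union>
    (\<lambda>z. pair (psnd (psnd c)) (assign_new (pfst (psnd c)) (pfst z) (psnd z) w)) `
      {z. z < Suc (pair (csize w) w) \<and> pfst z \<le> csize w \<and> psnd z \<in> set_decode (cgap w (pfst z))}"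
  using assms by (simp add: ev_calls_def set_decode_range[unfolded One_nat_def] insert_commute)

text \<open>As a \<open>fundef_cong\<close> rule it tells the function package that the calls of
  \<open>ev\<close> are those in \<open>ev_calls\<close>; it also justifies replacing
  \<open>ev\<close> by a table lookup.\<close>

lemma ev_step_cong [fundef_cong]:
  assumes "c = c'" "w = w'" and E: "\<And>a b. pair a b \<in> set_decode (ev_calls c' w') \<Longrightarrow> E a b = E' a b"
  shows "ev_step E c w = ev_step E' c' w'"
proof (cases "pfst c' \<le> 3")
  case True
  then show ?thesis unfolding assms(1,2) ev_step_def by auto
next
  case False
  have 1: "E (psnd c') w' = E' (psnd c') w'" "E (pfst (psnd c')) w' = E' (pfst (psnd c')) w'"
    "E (psnd (psnd c')) w' = E' (psnd (psnd c')) w'"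
    by (rule E; simp add: set_decode_ev_calls False)+
  have 2: "E (psnd (psnd c')) (assign_old (pfst (psnd c')) i w') =
      E' (psnd (psnd c')) (assign_old (pfst (psnd c')) i w')" if "i < csize w'" for i
    by (rule E) (use that in \<open>unfold set_decode_ev_calls[OF False], blast\<close>)
  have 3: "E (psnd (psnd c')) (assign_new (pfst (psnd c')) i e w') =
      E' (psnd (psnd c')) (assign_new (pfst (psnd c')) i e w')"
    if "i \<le> csize w'" "e \<in> set_decode (cgap w' i)" for i e
  proof (rule E)
    have "e \<le> w'" using set_decode_less[OF that(2)] cgap_le[of w' i] by simp
    then have "pair i e < Suc (pair (csize w') w')" using pair_mono[OF that(1)] by (simp add: less_Suc_eq_le)
    then have "pair i e \<in> {z. z < Suc (pair (csize w') w') \<and> pfst z \<le> csize w' \<and>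
        psnd z \<in> set_decode (cgap w' (pfst z))}"
      using that by simp
    from imageI[OF this, of "\<lambda>z. pair (psnd (psnd c')) (assign_new (pfst (psnd c')) (pfst z) (psnd z) w')"]
    show "pair (psnd (psnd c')) (assign_new (pfst (psnd c')) i e w') \<in> set_decode (ev_calls c' w')"
      unfolding set_decode_ev_calls[OF False] pfst_pair psnd_pair by blast
  qed
  show ?thesis
    unfolding assms(1,2) ev_step_def using 1 2 3 by (simp cong: conj_cong)
qed

function ev :: "nat \<Rightarrow> nat \<Rightarrow> bool" where
  "ev c w \<longleftrightarrow> ev_step ev c w"
  by auto
termination
  by (relation "measure fst") (auto dest: ev_calls_less)

declare ev.simps [simp del]

section \<open>Correctness of the evaluation\<close>

definition gap :: "nat \<Rightarrow> (nat \<Rightarrow> real) \<Rightarrow> nat \<Rightarrow> real set" where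
  "gap m p i = {a. (0 < i \<longrightarrow> p (i - 1) < a) \<and> (i < m \<longrightarrow> a < p i)}"

definition represents :: "(real \<Rightarrow> nat) \<Rightarrow> nat \<Rightarrow> nat \<Rightarrow> (nat \<Rightarrow> real) \<Rightarrow> (nat \<Rightarrow> real) \<Rightarrow> bool" where
  "represents c n w p v \<longleftrightarrow>
    (\<forall>j<csize w. \<forall>i<j. p i < p j) \<and>
    (\<forall>i\<le>csize w. rep c n (cgap w i) (gap (csize w) p i)) \<and>
    (\<forall>i<csize w. cletter w i = c (p i)) \<and>
    (\<forall>x<cvars w. cenv w x < csize w \<and> v x = p (cenv w x))"

lemma represents_mono: "represents c n w p v \<Longrightarrow> n' \<le> n \<Longrightarrow> represents c n' w p v"
  unfolding represents_def by (auto intro: rep_mono)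

lemma represents_old:
  assumes "represents c n w p v" "i < csize w"
  shows "represents c n (assign_old x i w) p (v(x := p i))"
  using assms by (simp add: represents_def assign_old_def)

lemma represents_new:
  assumes w: "represents c n w p v" and i: "i \<le> csize w" and a: "a \<in> gap (csize w) p i"
    and e: "snd3 e = c a" "rep c n (fst3 e) (gap (csize w) p i \<inter> {..<a})"
      "rep c n (trd3 e) (gap (csize w) p i \<inter> {a<..})"
  shows "represents c n (assign_new x i e w) (\<lambda>j. if j < i then p j else if j = i then a else p (j - 1)) (v(x := a))"
proof -
  let ?m = "csize w" and ?p = "\<lambda>j. if j < i then p j else if j = i then a else p (j - 1)"
  have mono: "p j < p k" if "j < k" "k < ?m" for j k using w that by (simp add: represents_def)
  have ends: "0 < i \<Longrightarrow> p (i - 1) < a" "i < ?m \<Longrightarrow> a < p i" using a by (simp_all add: gap_def)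
  have lo: "p k < a" if "k < i" for k
  proof (cases "k = i - 1")
    case False
    then have "p k < p (i - 1)" using that i by (intro mono) linarith+
    then show ?thesis using ends(1) that by simp
  qed (use ends(1) that in simp)
  have hi: "a < p k" if "i \<le> k" "k < ?m" for k
    using that ends(2) mono[of i k] by (cases "k = i") auto
  have 1: "?p j < ?p k" if "j < k" "k < Suc ?m" for j k
  proof -
    consider "k < i" | "k = i" | "i < k" "j < i" | "i < k" "j = i" | "i < k" "i < j" by linarith
    then show ?thesis
    proof cases
      case 1
      then show ?thesis using mono[of j k] that i by simp
    next
      case 2
      then show ?thesis using lo[of j] that by simp
    next
      case 3
      then show ?thesis using mono[of j "k - 1"] that by simp
    next
      case 4
      then show ?thesis using hi[of "k - 1"] that by simp
    next
      case 5
      then show ?thesis using mono[of "j - 1" "k - 1"] that by simp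
    qed
  qed
  have g: "gap (Suc ?m) ?p j = (if j < i then gap ?m p j else if j = i then gap ?m p i \<inter> {..<a}
      else if j = Suc i then gap ?m p i \<inter> {a<..} else gap ?m p (j - 1))" if "j \<le> Suc ?m" for j
  proof -
    consider "j < i" | "j = i" | "j = Suc i" | "Suc i < j" by linarith
    then show ?thesis
    proof cases
      case 1
      then show ?thesis using i by (auto simp: gap_def)
    next
      case 2
      then show ?thesis using i ends by (auto simp: gap_def)
    next
      case 3
      then show ?thesis using i ends by (auto simp: gap_def)
    next
      case 4
      then have "j - 1 - 1 = j - 2" "\<not> j - 1 < i" "j - 1 \<noteq> i" "\<not> j < i" "j \<noteq> i" "0 < j - 1" "j < Suc ?m \<longleftrightarrow> j - 1 < ?m"
        by auto
      then show ?thesis using 4 by (simp add: gap_def)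
    qed
  qed
  show ?thesis
    unfolding represents_def
  proof (intro conjI allI impI)
    fix j assume "j \<le> csize (assign_new x i e w)"
    then have j: "j \<le> Suc ?m" by (simp add: assign_new_def)
    have "rep c n (cgap w k) (gap ?m p k)" if "k \<le> ?m" for k using w that by (simp add: represents_def)
    then show "rep c n (cgap (assign_new x i e w) j) (gap (csize (assign_new x i e w)) ?p j)"
      using j e i by (auto simp: assign_new_def g)
  qed (use 1 w i e in \<open>auto simp: assign_new_def represents_def\<close>)
qed

lemma locate:
  obtains i where "i < m" "a = p i" | i where "i \<le> m" "a \<in> gap m p i"
proof -
  define i where "i = (LEAST k. k = m \<or> a \<le> p k)"
  have i: "i = m \<or> a \<le> p i" unfolding i_def by (rule LeastI[of _ m]) simp
  have "i \<le> m" unfolding i_def by (rule Least_le) simp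
  have least: "k \<noteq> m \<and> p k < a" if "k < i" for k
    using not_less_Least[of k "\<lambda>k. k = m \<or> a \<le> p k"] that by (simp add: i_def not_le)
  show ?thesis
  proof (cases "i < m \<and> a = p i")
    case True
    then show ?thesis using that(1) by blast
  next
    case False
    have "a \<in> gap m p i" using i \<open>i \<le> m\<close> least[of "i - 1"] False by (auto simp: gap_def)
    then show ?thesis using that(2) \<open>i \<le> m\<close> by blast
  qed
qed

text \<open>One move of an Ehrenfeucht-Fraisse game: a real is an old mark or lies in a gap, where
  its triple says all that matters; the level drops by one. \<open>E\<close> and \<open>Q\<close>
  are arbitrary, so universal quantifiers are covered by passing to negations.\<close>

lemma ex_assign:
  assumes fin: "finite (range c)" and w: "represents c (Suc n) w p v"
    and E: "\<And>w' p' v'. represents c n w' p' v' \<Longrightarrow> cvars w' = cvars w \<Longrightarrow> E w' \<longleftrightarrow> Q v'"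
  shows "(\<exists>a. Q (v(x := a))) \<longleftrightarrow> (\<exists>i. i < csize w \<and> E (assign_old x i w)) \<or>
    (\<exists>i. i \<le> csize w \<and> (\<exists>e\<in>set_decode (cgap w i). E (assign_new x i e w)))"
proof -
  have w': "represents c n w p v" using represents_mono[OF w] by simp
  have old: "E (assign_old x i w) \<longleftrightarrow> Q (v(x := p i))" if "i < csize w" for i
    by (rule E[OF represents_old[OF w' that]]) (simp add: assign_old_def)
  have new: "\<exists>f. set_decode (cgap w i) = f ` gap (csize w) p i \<and>
      (\<forall>a\<in>gap (csize w) p i. E (assign_new x i (f a) w) \<longleftrightarrow> Q (v(x := a)))" if i: "i \<le> csize w" for i
  proof -
    let ?X = "gap (csize w) p i"
    have "rep c (Suc n) (cgap w i) ?X" using w i by (simp add: represents_def)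
    then obtain k where k: "n \<le> k" "cgap w i = ty c (Suc k) ?X" by (rule rep_SucE)
    let ?f = "\<lambda>a. pr3 (ty c k (?X \<inter> {..<a})) (c a) (ty c k (?X \<inter> {a<..}))"
    have "E (assign_new x i (?f a) w) \<longleftrightarrow> Q (v(x := a))" if "a \<in> ?X" for a
      by (rule E[OF represents_new[OF w' i that]]) (use k(1) in \<open>simp_all add: rep_ty assign_new_def\<close>)
    then show ?thesis using set_decode_ty[OF fin, of k ?X] k(2) by (intro exI[of _ ?f]) (simp del: ty.simps)
  qed
  show ?thesis
  proof
    assume "\<exists>a. Q (v(x := a))"
    then obtain a where a: "Q (v(x := a))" by blast
    show "(\<exists>i. i < csize w \<and> E (assign_old x i w)) \<or>
      (\<exists>i. i \<le> csize w \<and> (\<exists>e\<in>set_decode (cgap w i). E (assign_new x i e w)))"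
    proof (rule locate[of "csize w" a p])
      fix i assume "i < csize w" "a = p i"
      then show ?thesis using old[of i] a by auto
    next
      fix i assume i: "i \<le> csize w" "a \<in> gap (csize w) p i"
      then show ?thesis using new[OF i(1)] a by force
    qed
  next
    assume "(\<exists>i. i < csize w \<and> E (assign_old x i w)) \<or>
      (\<exists>i. i \<le> csize w \<and> (\<exists>e\<in>set_decode (cgap w i). E (assign_new x i e w)))"
    then show "\<exists>a. Q (v(x := a))"
    proof
      assume "\<exists>i. i < csize w \<and> E (assign_old x i w)"
      then show ?thesis using old by blast
    next
      assume "\<exists>i. i \<le> csize w \<and> (\<exists>e\<in>set_decode (cgap w i). E (assign_new x i e w))"
      then obtain i e where i: "i \<le> csize w" "e \<in> set_decode (cgap w i)" "E (assign_new x i e w)" by blast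
      then show ?thesis using new[OF i(1)] by force
    qed
  qed
qed

text \<open>\<open>Suc k\<close> points with odd letters consist of a leftmost one and
  \<open>k\<close> above it, which is the recursion of \<open>atleast_ints\<close>.\<close>

lemma atleast_ints_iff:
  assumes "finite (range c)" "rep c n t X" "k \<le> n"
  shows "atleast_ints k t \<longleftrightarrow> (\<exists>F. finite F \<and> F \<subseteq> {a \<in> X. odd (c a)} \<and> card F = k)"
  using assms(2,3)
proof (induction k arbitrary: n t X)
  case 0
  have "\<exists>F. finite F \<and> F \<subseteq> {a \<in> X. odd (c a)} \<and> card F = 0" by (rule exI[of _ "{}"]) simp
  then show ?case by simp
next
  case (Suc k)
  obtain n' where n': "n = Suc n'" using Suc.prems by (cases n) auto
  obtain m where m: "n' \<le> m" "t = ty c (Suc m) X" using Suc.prems(1) unfolding n' by (rule rep_SucE)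
  have IH: "atleast_ints k (ty c m (X \<inter> {a<..})) \<longleftrightarrow>
      (\<exists>F. finite F \<and> F \<subseteq> {b \<in> X \<inter> {a<..}. odd (c b)} \<and> card F = k)" for a
    using Suc.IH[of n' "ty c m (X \<inter> {a<..})" "X \<inter> {a<..}"] Suc.prems n' m rep_ty by auto
  have "atleast_ints (Suc k) t \<longleftrightarrow>
      (\<exists>a\<in>X. odd (c a) \<and> (\<exists>F. finite F \<and> F \<subseteq> {b \<in> X \<inter> {a<..}. odd (c b)} \<and> card F = k))"
    unfolding m(2) by (simp add: set_decode_ty[OF assms(1)] IH del: ty.simps)
  also have "\<dots> \<longleftrightarrow> (\<exists>F. finite F \<and> F \<subseteq> {a \<in> X. odd (c a)} \<and> card F = Suc k)"
  proof
    assume "\<exists>a\<in>X. odd (c a) \<and> (\<exists>F. finite F \<and> F \<subseteq> {b \<in> X \<inter> {a<..}. odd (c b)} \<and> card F = k)"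
    then obtain a F where *: "a \<in> X" "odd (c a)" "finite F" "F \<subseteq> {b \<in> X \<inter> {a<..}. odd (c b)}" "card F = k"
      by blast
    then have "a \<notin> F" by auto
    then show "\<exists>F. finite F \<and> F \<subseteq> {a \<in> X. odd (c a)} \<and> card F = Suc k"
      using * by (intro exI[of _ "insert a F"]) auto
  next
    assume "\<exists>F. finite F \<and> F \<subseteq> {a \<in> X. odd (c a)} \<and> card F = Suc k"
    then obtain F where F: "finite F" "F \<subseteq> {a \<in> X. odd (c a)}" "card F = Suc k" by blast
    then have "F \<noteq> {}" by auto
    then have M: "Min F \<in> F" "\<And>b. b \<in> F \<Longrightarrow> Min F \<le> b" using F(1) by auto
    have "F - {Min F} \<subseteq> {b \<in> X \<inter> {Min F<..}. odd (c b)}" using F(2) M(2) by force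
    moreover have "finite (F - {Min F})" "card (F - {Min F}) = k" using F M(1) by auto
    ultimately show "\<exists>a\<in>X. odd (c a) \<and> (\<exists>F. finite F \<and> F \<subseteq> {b \<in> X \<inter> {a<..}. odd (c b)} \<and> card F = k)"
      using F(2) M(1) by blast
  qed
  finally show ?case .
qed

lemma count_ints_eq:
  assumes c: "finite (range c)" and X: "rep c n t X" and M: "M \<le> n" and fin: "finite {a \<in> X. odd (c a)}"
  shows "count_ints M t = min M (card {a \<in> X. odd (c a)})"
proof -
  let ?z = "card {a \<in> X. odd (c a)}"
  have "atleast_ints (Suc k) t \<longleftrightarrow> Suc k \<le> ?z" if "k < M" for k
  proof -
    have "atleast_ints (Suc k) t \<longleftrightarrow> (\<exists>F. finite F \<and> F \<subseteq> {a \<in> X. odd (c a)} \<and> card F = Suc k)"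
      using that M by (intro atleast_ints_iff[OF c X]) simp
    also have "\<dots> \<longleftrightarrow> Suc k \<le> ?z"
    proof
      assume "\<exists>F. finite F \<and> F \<subseteq> {a \<in> X. odd (c a)} \<and> card F = Suc k"
      then show "Suc k \<le> ?z" using card_mono[OF fin] by metis
    next
      assume "Suc k \<le> ?z"
      then obtain F where "F \<subseteq> {a \<in> X. odd (c a)}" "card F = Suc k" "finite F"
        by (rule obtain_subset_with_card_n)
      then show "\<exists>F. finite F \<and> F \<subseteq> {a \<in> X. odd (c a)} \<and> card F = Suc k" by blast
    qed
    finally show ?thesis .
  qed
  then have "count_ints M t = (\<Sum>k<M. if Suc k \<le> ?z then 1 else 0)"
    unfolding count_ints_def by (intro sum.cong) auto
  also have "(\<Sum>k<M. if Suc k \<le> z then 1 else 0) = min M z" for z :: nat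
    by (induction M) auto
  finally show ?thesis .
qed

lemma finite_ints: "finite (\<int> \<inter> {a<..b :: real})"
  by (rule finite_subset[OF _ finite_int_segment[of a b]]) auto

lemma card_ints:
  assumes "a \<in> \<int>" "b \<in> \<int>" "a \<le> (b :: real)"
  shows "real (card (\<int> \<inter> {a<..b})) = b - a"
proof -
  obtain i j where ij: "a = of_int i" "b = of_int j" using assms by (auto elim!: Ints_cases)
  have "\<int> \<inter> {a<..b} = of_int ` {i<..j}" unfolding ij by (auto elim!: Ints_cases)
  then have "card (\<int> \<inter> {a<..b}) = nat (j - i)" by (simp add: card_image inj_on_def)
  then show ?thesis using assms(3) by (simp add: ij)
qed

text \<open>The computed sum is exact as long as no gap was cut off, and a gap that was cut off
  contributes \<open>M\<close> on its own.\<close>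

lemma distance_ints:
  assumes w: "represents c n w p v" and fin: "finite (range c)" and c: "\<And>x. odd (c x) \<longleftrightarrow> x \<in> \<int>"
    and M: "M \<le> n" and d: "a + d < csize w"
  shows "distance M w a (a + d) \<le> card (\<int> \<inter> {p a<..p (a + d)}) \<and>
    (distance M w a (a + d) = card (\<int> \<inter> {p a<..p (a + d)}) \<or> M \<le> distance M w a (a + d))"
  using d
proof (induction d)
  case (Suc d)
  let ?b = "a + d"
  let ?g = "{x \<in> gap (csize w) p (Suc ?b). odd (c x)}"
  have mono: "p j < p k" if "j < k" "k < csize w" for j k using w that by (simp add: represents_def)
  have ab: "p a \<le> p ?b" using mono[of a ?b] Suc.prems by (cases "d = 0") auto
  have bb: "p ?b < p (Suc ?b)" using mono[of ?b "Suc ?b"] Suc.prems by simp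
  have g: "?g = \<int> \<inter> {p ?b<..<p (Suc ?b)}" using Suc.prems by (auto simp: gap_def c)
  have fing: "finite ?g" unfolding g by (rule finite_subset[OF _ finite_ints[of "p ?b" "p (Suc ?b)"]]) auto
  have "rep c n (cgap w (Suc ?b)) (gap (csize w) p (Suc ?b))" using w Suc.prems by (simp add: represents_def)
  from count_ints_eq[OF fin this M fing]
  have cnt: "count_ints M (cgap w (Suc ?b)) = min M (card ?g)" .
  have lett: "0 \<in> set_decode (cletter w (Suc ?b)) \<longleftrightarrow> p (Suc ?b) \<in> \<int>"
    using w Suc.prems c by (simp add: represents_def)
  have "\<int> \<inter> {p a<..p (Suc ?b)} = (\<int> \<inter> {p a<..p ?b}) \<union> (?g \<union> (\<int> \<inter> {p (Suc ?b)}))"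
    unfolding g using ab bb by auto
  moreover have "card ((\<int> \<inter> {p a<..p ?b}) \<union> (?g \<union> (\<int> \<inter> {p (Suc ?b)}))) =
      card (\<int> \<inter> {p a<..p ?b}) + (card ?g + card (\<int> \<inter> {p (Suc ?b)}))"
    using fing finite_ints[of "p a" "p ?b"] bb
    by (subst card_Un_disjoint, simp_all, auto simp: g)+
  moreover have "card (\<int> \<inter> {p (Suc ?b)}) = (if p (Suc ?b) \<in> \<int> then 1 else 0)" by simp
  ultimately have card: "card (\<int> \<inter> {p a<..p (a + Suc d)}) =
      card (\<int> \<inter> {p a<..p ?b}) + (card ?g + (if p (Suc ?b) \<in> \<int> then 1 else 0))" by simp
  have "distance M w a (a + Suc d) = distance M w a ?b + (count_ints M (cgap w (Suc ?b)) +
      (if 0 \<in> set_decode (cletter w (Suc ?b)) then 1 else 0))"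
    unfolding distance_def by simp
  then show ?case
    unfolding card cnt lett using Suc.IH Suc.prems by auto
qed (simp add: distance_def)

lemma ncmp_iff: "ncmp (cmp_code r) a b \<longleftrightarrow> cmp_rel r (real a) (real b)"
  by (cases r) (auto simp: ncmp_def)

lemma int_encode_split:
  "q = int (if even (int_encode q) then int_encode q div 2 else 0) -
       int (if even (int_encode q) then 0 else Suc (int_encode q div 2))"
  by (subst int_encode_inverse[symmetric]) (auto simp: int_decode_def sum_decode_def)

lemma diff_eval_iff:
  assumes w: "represents c n w p v" and fin: "finite (range c)" and c: "\<And>x. odd (c x) \<longleftrightarrow> x \<in> \<int>"
    and n: "int_encode q < n" and ij: "i < csize w" "j < csize w" and ints: "p i \<in> \<int>" "p j \<in> \<int>"
  shows "diff_eval i (cmp_code r) j (int_encode q) w \<longleftrightarrow> cmp_rel r (p i - p j) (of_int q)"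
proof -
  let ?z = "int_encode q"
  define P where "P = (if even ?z then ?z div 2 else 0)"
  define Q where "Q = (if even ?z then 0 else Suc (?z div 2))"
  have q: "real_of_int q = real P - real Q"
    using arg_cong[OF int_encode_split[of q], of real_of_int] by (simp only: P_def Q_def of_int_diff of_int_of_nat_eq)
  have PQ: "P < Suc ?z" "Q < Suc ?z" unfolding P_def Q_def by (auto elim!: oddE)
  have mono: "p a \<le> p b" if "a \<le> b" "b < csize w" for a b
    using w that by (cases "a = b") (auto simp: represents_def less_imp_le)
  have D: "\<exists>D. real D = p b - p a \<and> distance (Suc ?z) w a b \<le> D \<and>
      (distance (Suc ?z) w a b = D \<or> Suc ?z \<le> distance (Suc ?z) w a b)"
    if "a \<le> b" "b < csize w" "p a \<in> \<int>" "p b \<in> \<int>" for a b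
  proof -
    have "a + (b - a) = b" using that by simp
    then show ?thesis
      using distance_ints[OF w fin c, of "Suc ?z" a "b - a"] n that card_ints[OF that(3,4) mono[OF that(1,2)]]
      by (intro exI[of _ "card (\<int> \<inter> {p a<..p b})"]) auto
  qed
  \<comment> \<open>A comparison depends only on the order of its two sides. An exact distance
    preserves their difference; a cut-off one exceeds the constant, as does the true distance, so
    the same side is larger.\<close>
  have cmp: "cmp_rel r a b \<longleftrightarrow> cmp_rel r a' b'" if "a > b \<and> a' > b' \<or> a < b \<and> a' < b' \<or> a - b = a' - b'"
    for a b a' b' :: real using that by (cases r) auto
  show ?thesis
  proof (cases "j \<le> i")
    case True
    obtain D where "real D = p i - p j" "distance (Suc ?z) w j i \<le> D"
      "distance (Suc ?z) w j i = D \<or> Suc ?z \<le> distance (Suc ?z) w j i"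
      using D[OF True ij(1) ints(2,1)] by blast
    moreover have "distance (Suc ?z) w i j = 0" using True by (simp add: distance_def)
    ultimately show ?thesis
      unfolding diff_eval_def ncmp_iff P_def[symmetric] Q_def[symmetric] using PQ q by (intro cmp) auto
  next
    case False
    obtain D where "real D = p j - p i" "distance (Suc ?z) w i j \<le> D"
      "distance (Suc ?z) w i j = D \<or> Suc ?z \<le> distance (Suc ?z) w i j"
      using D[of i j] False ij ints by auto
    moreover have "distance (Suc ?z) w j i = 0" using False by (simp add: distance_def)
    ultimately show ?thesis
      unfolding diff_eval_def ncmp_iff P_def[symmetric] Q_def[symmetric] using PQ q by (intro cmp) auto
  qed
qed

lemma pair_gt: "0 < a \<Longrightarrow> b < pair a b"
  using pair_ge(3)[of a b] by simp

lemma fm_code_pair: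
  "fm_code (Pred P x) = pair 0 (pair P x)"
  "fm_code (IsInt x) = pair 1 x"
  "fm_code (Ord x r y) = pair 2 (pair x (pair (cmp_code r) y))"
  "fm_code (Diff x r y z) = pair 3 (pair x (pair (cmp_code r) (pair y (int_encode z))))"
  "fm_code (Neg \<phi>) = pair 4 (fm_code \<phi>)"
  "fm_code (And \<phi> \<psi>) = pair 5 (pair (fm_code \<phi>) (fm_code \<psi>))"
  "fm_code (Or \<phi> \<psi>) = pair 6 (pair (fm_code \<phi>) (fm_code \<psi>))"
  "fm_code (Imp \<phi> \<psi>) = pair 7 (pair (fm_code \<phi>) (fm_code \<psi>))"
  "fm_code (Iff \<phi> \<psi>) = pair 8 (pair (fm_code \<phi>) (fm_code \<psi>))"
  "fm_code (All x \<phi>) = pair 9 (pair x (fm_code \<phi>))"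
  "fm_code (Ex x \<phi>) = pair 10 (pair x (fm_code \<phi>))"
  by (simp_all add: pair_def)

lemma ev_pair:
  "ev (pair 0 (pair P x)) w \<longleftrightarrow> Suc P \<in> set_decode (cletter w (cenv w x))"
  "ev (pair 1 x) w \<longleftrightarrow> 0 \<in> set_decode (cletter w (cenv w x))"
  "ev (pair 2 (pair x (pair r y))) w \<longleftrightarrow> ncmp r (cenv w x) (cenv w y)"
  "ev (pair 3 (pair x (pair r (pair y z)))) w \<longleftrightarrow> diff_eval (cenv w x) r (cenv w y) z w"
  "ev (pair 4 a) w \<longleftrightarrow> \<not> ev a w"
  "ev (pair 5 (pair a b)) w \<longleftrightarrow> ev a w \<and> ev b w"
  "ev (pair 6 (pair a b)) w \<longleftrightarrow> ev a w \<or> ev b w"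
  "ev (pair 7 (pair a b)) w \<longleftrightarrow> (ev a w \<longrightarrow> ev b w)"
  "ev (pair 8 (pair a b)) w \<longleftrightarrow> (ev a w \<longleftrightarrow> ev b w)"
  "ev (pair 9 (pair x a)) w \<longleftrightarrow> (\<forall>i. i < csize w \<longrightarrow> ev a (assign_old x i w)) \<and>
     (\<forall>i. i \<le> csize w \<longrightarrow> (\<forall>e\<in>set_decode (cgap w i). ev a (assign_new x i e w)))"
  "ev (pair 10 (pair x a)) w \<longleftrightarrow> (\<exists>i. i < csize w \<and> ev a (assign_old x i w)) \<or>
     (\<exists>i. i \<le> csize w \<and> (\<exists>e\<in>set_decode (cgap w i). ev a (assign_new x i e w)))"
  by (subst ev.simps, simp add: ev_step_def)+

lemma pair_less: "0 < k \<Longrightarrow> a < pair k (pair a b)" "0 < k \<Longrightarrow> b < pair k (pair a b)" "0 < k \<Longrightarrow> a < pair k a"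
  using pair_gt[of k "pair a b"] pair_gt[of k a] pair_ge[of a b] by linarith+

lemma code_bounds:
  "P \<le> fm_code (Pred P x)" "x \<le> fm_code (Pred P x)" "x \<le> fm_code (IsInt x)"
  "x \<le> fm_code (Ord x r y)" "y \<le> fm_code (Ord x r y)"
  "x < fm_code (Diff x r y z)" "y < fm_code (Diff x r y z)" "int_encode z < fm_code (Diff x r y z)"
  "fm_code \<phi> < fm_code (Neg \<phi>)" "fm_code \<phi> < fm_code (And \<phi> \<psi>)" "fm_code \<psi> < fm_code (And \<phi> \<psi>)"
  "fm_code \<phi> < fm_code (Or \<phi> \<psi>)" "fm_code \<psi> < fm_code (Or \<phi> \<psi>)"
  "fm_code \<phi> < fm_code (Imp \<phi> \<psi>)" "fm_code \<psi> < fm_code (Imp \<phi> \<psi>)"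
  "fm_code \<phi> < fm_code (Iff \<phi> \<psi>)" "fm_code \<psi> < fm_code (Iff \<phi> \<psi>)"
  "fm_code \<phi> < fm_code (All x \<phi>)" "x < fm_code (All x \<phi>)" "fm_code \<phi> < fm_code (Ex x \<phi>)" "x < fm_code (Ex x \<phi>)"
proof -
  let ?y = "pair y (int_encode z)"
  show "x < fm_code (Diff x r y z)" "y < fm_code (Diff x r y z)" "int_encode z < fm_code (Diff x r y z)"
    using pair_less(1)[of 3 x "pair (cmp_code r) ?y"] pair_less(2)[of 3 "pair (cmp_code r) ?y" x]
      pair_ge[of "cmp_code r" ?y] pair_ge[of y "int_encode z"] unfolding fm_code_pair by linarith+
  show "x \<le> fm_code (Ord x r y)" "y \<le> fm_code (Ord x r y)"
    using pair_less(1)[of 2 x "pair (cmp_code r) y"] pair_less(2)[of 2 "pair (cmp_code r) y" x]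
      pair_ge[of "cmp_code r" y] unfolding fm_code_pair by linarith+
  show "P \<le> fm_code (Pred P x)" "x \<le> fm_code (Pred P x)" "x \<le> fm_code (IsInt x)"
    using pair_ge[of 0 "pair P x"] pair_ge[of P x] pair_ge[of 1 x] unfolding fm_code_pair by linarith+
qed (simp_all only: fm_code_pair pair_less zero_less_numeral)

text \<open>The code of the formula bounds everything it needs: quantifier depth and constants by
  the level \<open>n\<close>, variables by \<open>cvars w\<close>, predicates by \<open>k\<close>. A
  difference is treated in one step with its guard, since \<open>diff_eval\<close> is meaningful
  only for integers.\<close>

lemma ev_correct:
  assumes fin: "finite (range c)" and odd: "\<And>x. odd (c x) \<longleftrightarrow> x \<in> \<int>"
    and I: "\<And>P a. P < k \<Longrightarrow> Suc P \<in> set_decode (c a) \<longleftrightarrow> a \<in> I P"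
    and \<phi>: "\<phi> \<in> UF_IDL_IRO"
  shows "represents c n w p v \<Longrightarrow> fm_code \<phi> \<le> n \<Longrightarrow> fm_code \<phi> < cvars w \<Longrightarrow> fm_code \<phi> < k \<Longrightarrow>
    ev (fm_code \<phi>) w \<longleftrightarrow> satisfies I v \<phi>"
  using \<phi>
proof (induction arbitrary: n w p v rule: UF_IDL_IRO.induct)
  case (1 P x)
  then have "P < k" "cenv w x < csize w" "v x = p (cenv w x)" "cletter w (cenv w x) = c (v x)"
    using code_bounds(1,2)[of P x] code_bounds(2)[of x P] by (auto simp: represents_def)
  then show ?case using I[of P "v x"] unfolding fm_code_pair ev_pair by simp
next
  case (2 x)
  then have "cenv w x < csize w" "v x = p (cenv w x)" "cletter w (cenv w x) = c (v x)"
    using code_bounds(3)[of x] by (auto simp: represents_def)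
  then show ?case using odd[of "v x"] unfolding fm_code_pair ev_pair by simp
next
  case (3 x r y)
  then have xy: "cenv w x < csize w" "v x = p (cenv w x)" "cenv w y < csize w" "v y = p (cenv w y)"
    using code_bounds(4)[of x r y] code_bounds(5)[of y x r] by (auto simp: represents_def)
  have mono: "p i < p j" if "i < j" "j < csize w" for i j using 3(1) that by (simp add: represents_def)
  have "ncmp (cmp_code r) (cenv w x) (cenv w y) \<longleftrightarrow> cmp_rel r (p (cenv w x)) (p (cenv w y))"
    using mono[of "cenv w x" "cenv w y"] mono[of "cenv w y" "cenv w x"] xy
    by (cases r; cases "cenv w x" "cenv w y" rule: linorder_cases) (auto simp: ncmp_def)
  then show ?case using xy unfolding fm_code_pair ev_pair by simp
next
  case (4 x y r z)
  let ?D = "fm_code (Diff x r y z)"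
  have less: "?D < fm_code (And (And (IsInt x) (IsInt y)) (Diff x r y z))" using code_bounds(11)[of "Diff x r y z" "And (IsInt x) (IsInt y)"] by (auto intro: less_trans)
  then have xy: "cenv w x < csize w" "v x = p (cenv w x)" "cletter w (cenv w x) = c (v x)"
      "cenv w y < csize w" "v y = p (cenv w y)" "cletter w (cenv w y) = c (v y)"
    using 4 code_bounds(6)[of x r y z] code_bounds(7)[of y x r z] by (auto simp: represents_def)
  \<comment> \<open>Counting integers up to the cut-off \<open>Suc (int_encode z)\<close> needs that
    many levels of the gap types.\<close>
  have "int_encode z < n" using 4(2) less code_bounds(8)[of z x r y] by linarith
  from diff_eval_iff[OF 4(1) fin odd this xy(1,4), of r]
  show ?case unfolding fm_code_pair ev_pair using odd xy by auto
next
  case (5 x y r z)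
  let ?D = "fm_code (Diff x r y z)"
  have less: "?D < fm_code (And (IsInt x) (And (IsInt y) (Diff x r y z)))" using code_bounds(11)[of "Diff x r y z" "IsInt y"] code_bounds(11)[of "And (IsInt y) (Diff x r y z)" "IsInt x"] by (auto intro: less_trans)
  then have xy: "cenv w x < csize w" "v x = p (cenv w x)" "cletter w (cenv w x) = c (v x)"
      "cenv w y < csize w" "v y = p (cenv w y)" "cletter w (cenv w y) = c (v y)"
    using 5 code_bounds(6)[of x r y z] code_bounds(7)[of y x r z] by (auto simp: represents_def)
  have "int_encode z < n" using 5(2) less code_bounds(8)[of z x r y] by linarith
  from diff_eval_iff[OF 5(1) fin odd this xy(1,4), of r]
  show ?case unfolding fm_code_pair ev_pair using odd xy by auto
next
  case (6 x y r z)
  let ?D = "fm_code (Diff x r y z)"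
  have less: "?D < fm_code (Imp (And (IsInt x) (IsInt y)) (Diff x r y z))" using code_bounds(15)[of "Diff x r y z" "And (IsInt x) (IsInt y)"] by (auto intro: less_trans)
  then have xy: "cenv w x < csize w" "v x = p (cenv w x)" "cletter w (cenv w x) = c (v x)"
      "cenv w y < csize w" "v y = p (cenv w y)" "cletter w (cenv w y) = c (v y)"
    using 6 code_bounds(6)[of x r y z] code_bounds(7)[of y x r z] by (auto simp: represents_def)
  have "int_encode z < n" using 6(2) less code_bounds(8)[of z x r y] by linarith
  from diff_eval_iff[OF 6(1) fin odd this xy(1,4), of r]
  show ?case unfolding fm_code_pair ev_pair using odd xy by auto
next
  case (7 \<phi>)
  then show ?case using code_bounds(9)[of \<phi>] unfolding fm_code_pair(5) ev_pair by simp
next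
  case (8 \<phi> \<psi>)
  then show ?case
    using code_bounds(10)[of \<phi> \<psi>] code_bounds(11)[of \<psi> \<phi>] unfolding fm_code_pair(6) ev_pair by simp
next
  case (9 \<phi> \<psi>)
  then show ?case
    using code_bounds(12)[of \<phi> \<psi>] code_bounds(13)[of \<psi> \<phi>] unfolding fm_code_pair(7) ev_pair by simp
next
  case (10 \<phi> \<psi>)
  then show ?case
    using code_bounds(14)[of \<phi> \<psi>] code_bounds(15)[of \<psi> \<phi>] unfolding fm_code_pair(8) ev_pair by simp
next
  case (11 \<phi> \<psi>)
  then show ?case
    using code_bounds(16)[of \<phi> \<psi>] code_bounds(17)[of \<psi> \<phi>] unfolding fm_code_pair(9) ev_pair by simp
next
  case (12 \<phi> x)
  have less: "fm_code \<phi> < fm_code (All x \<phi>)" by (rule code_bounds)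
  obtain n' where n': "n = Suc n'" "fm_code \<phi> \<le> n'" using less 12 by (cases n) auto
  have "\<not> ev (fm_code \<phi>) w' \<longleftrightarrow> \<not> satisfies I v' \<phi>" if "represents c n' w' p' v'" "cvars w' = cvars w" for w' p' v'
    using 12(2)[OF that(1) n'(2)] that(2) 12(4,5,6) less by simp
  then have "(\<exists>a. \<not> satisfies I (v(x := a)) \<phi>) \<longleftrightarrow>
      (\<exists>i. i < csize w \<and> \<not> ev (fm_code \<phi>) (assign_old x i w)) \<or>
      (\<exists>i. i \<le> csize w \<and> (\<exists>e\<in>set_decode (cgap w i). \<not> ev (fm_code \<phi>) (assign_new x i e w)))"
    by (rule ex_assign[OF fin 12(3)[unfolded n'(1)], where E = "\<lambda>w. \<not> ev (fm_code \<phi>) w"])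
  then show ?case unfolding fm_code_pair(10) ev_pair by auto
next
  case (13 \<phi> x)
  have less: "fm_code \<phi> < fm_code (Ex x \<phi>)" by (rule code_bounds)
  obtain n' where n': "n = Suc n'" "fm_code \<phi> \<le> n'" using less 13 by (cases n) auto
  have "ev (fm_code \<phi>) w' \<longleftrightarrow> satisfies I v' \<phi>" if "represents c n' w' p' v'" "cvars w' = cvars w" for w' p' v'
    using 13(2)[OF that(1) n'(2)] that(2) 13(4,5,6) less by simp
  then have "(\<exists>a. satisfies I (v(x := a)) \<phi>) \<longleftrightarrow>
      (\<exists>i. i < csize w \<and> ev (fm_code \<phi>) (assign_old x i w)) \<or>
      (\<exists>i. i \<le> csize w \<and> (\<exists>e\<in>set_decode (cgap w i). ev (fm_code \<phi>) (assign_new x i e w)))"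
    by (rule ex_assign[OF fin 13(3)[unfolded n'(1)], where E = "\<lambda>w. ev (fm_code \<phi>) w"])
  then show ?case unfolding fm_code_pair(11) ev_pair by auto
qed


section \<open>The decision procedure\<close>

lemma computable_pr3 [comp_intros]:
    "computable f \<Longrightarrow> computable g \<Longrightarrow> computable h \<Longrightarrow> computable (\<lambda>x. pr3 (f x) (g x) (h x))"
  and computable_fst3 [comp_intros]: "computable f \<Longrightarrow> computable (\<lambda>x. fst3 (f x))"
  and computable_snd3 [comp_intros]: "computable f \<Longrightarrow> computable (\<lambda>x. snd3 (f x))"
  and computable_trd3 [comp_intros]: "computable f \<Longrightarrow> computable (\<lambda>x. trd3 (f x))"
  and computable_uni [comp_intros]: "computable f \<Longrightarrow> computable g \<Longrightarrow> computable (\<lambda>x. uni (f x) (g x))"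
  unfolding pr3_def fst3_def snd3_def trd3_def uni_def by (intro comp_intros; assumption)+

lemma dec_even [comp_intros]:
  assumes "computable f" shows "dec (\<lambda>x. even (f x))"
proof -
  have "dec (\<lambda>x. \<not> 0 \<in> set_decode (f x))" by (intro comp_intros assms)
  then show ?thesis by simp
qed

lemma computable_half [comp_intros]:
  assumes "computable f" shows "computable (\<lambda>x. f x div 2)"
proof -
  have "computable (\<lambda>z. LEAST q. z < 2 * Suc q)"
  proof (intro computable_Least comp_intros)
    show "\<exists>q. z < 2 * Suc q" for z by (rule exI[of _ z]) simp
  qed
  moreover have "(LEAST q. z < 2 * Suc q) = z div 2" for z :: nat
    by (rule Least_equality) auto
  ultimately show ?thesis using computable_comp[OF _ assms, of "\<lambda>z. z div 2"] by simp
qed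

lemma computable_point_type [comp_intros]:
  assumes "computable f" shows "computable (\<lambda>x. point_type (f x))"
proof -
  have "point_type l = 2 ^ pr3 0 l 0" for l by (simp add: point_type_def set_encode_def)
  then show ?thesis by (simp only:) (intro comp_intros assms)
qed

lemma computable_tbound [comp_intros]:
  assumes "computable f" "computable g" shows "computable (\<lambda>x. tbound (f x) (g x))"
proof -
  have *: "tbound L n = rec_nat 1 (\<lambda>n r. 2 ^ pr3 r L r) n" for L n by (induction n) simp_all
  have "computable (\<lambda>z. tbound (pfst z) (psnd z))" unfolding * by (intro comp_intros)
  from computable_app2[OF this assms] show ?thesis .
qed

text \<open>All three arguments vary in the recursion, so \<open>computable_wfrec\<close> takes the
  place of primitive recursion; \<open>D\<close> lists the four kinds of calls.\<close>

lemma computable_cat [comp_intros]: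
  assumes "computable f" "computable g" "computable h"
  shows "computable (\<lambda>x. cat (f x) (g x) (h x))"
proof -
  let ?n = "\<lambda>x. pfst x - 1" and ?s = "\<lambda>x. pfst (psnd x)" and ?t = "\<lambda>x. psnd (psnd x)"
  let ?l = "\<lambda>T n s t. look T (pair n (pair s t))"
  define D where "D x = (if pfst x = 0 then 0 else
    uni (uni (simage (\<lambda>e. pair (?n x) (pair 0 (fst3 e))) (?s x))
             (simage (\<lambda>e. pair (?n x) (pair (trd3 e) (?t x))) (?s x)))
        (uni (simage (\<lambda>e. pair (?n x) (pair (?s x) (fst3 e))) (?t x))
             (simage (\<lambda>e. pair (?n x) (pair (trd3 e) 0)) (?t x))))" for x
  define G where "G x T = (if pfst x = 0 then 0 else
    uni (simage (\<lambda>e. pr3 (?l T (?n x) 0 (fst3 e)) (snd3 e) (?l T (?n x) (trd3 e) (?t x))) (?s x))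
        (simage (\<lambda>e. pr3 (?l T (?n x) (?s x) (fst3 e)) (snd3 e) (?l T (?n x) (trd3 e) 0)) (?t x)))" for x T
  have "computable (\<lambda>x. cat (pfst x) (pfst (psnd x)) (psnd (psnd x)))"
  proof (rule computable_wfrec[where m = pfst])
    show "computable D" unfolding D_def by (intro comp_intros)
    show "computable (\<lambda>z. G (pfst z) (psnd z))" unfolding G_def by (intro comp_intros)
    show "pfst d < pfst x" if "d \<in> set_decode (D x)" for x d
      using that by (auto simp: D_def split: if_splits)
    show "G x T = cat (pfst x) (pfst (psnd x)) (psnd (psnd x))"
      if l: "\<And>d. d \<in> set_decode (D x) \<Longrightarrow> look T d = cat (pfst d) (pfst (psnd d)) (psnd (psnd d))" for x T
    proof (cases "pfst x")
      case 0
      then show ?thesis by (simp add: G_def)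
    next
      case (Suc n)
      have "?l T n a b = cat n a b" if "pair n (pair a b) \<in> set_decode (D x)" for a b
        using l[OF that] by simp
      then have "?l T n 0 (fst3 e) = cat n 0 (fst3 e)" "?l T n (trd3 e) (?t x) = cat n (trd3 e) (?t x)"
        if "e \<in> set_decode (?s x)" for e
        using that by (auto simp: D_def Suc)
      moreover have "?l T n (?s x) (fst3 e) = cat n (?s x) (fst3 e)" "?l T n (trd3 e) 0 = cat n (trd3 e) 0"
        if "e \<in> set_decode (?t x)" for e
        using \<open>\<And>b a. pair n (pair a b) \<in> set_decode (D x) \<Longrightarrow> ?l T n a b = cat n a b\<close> that
        by (auto simp: D_def Suc)
      ultimately show ?thesis
        unfolding G_def Suc by (simp add: simage_def cong: image_cong_simp)
    qed
  qed
  from computable_app3[OF this assms] show ?thesis .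
qed

lemma computable_ext [comp_intros]:
  assumes "computable f" "computable p" "computable q" "computable g"
  shows "computable (\<lambda>x. ext (f x) (p x) (q x) (g x))"
  by (rule computable_app4[OF _ assms]) (unfold ext_def, intro comp_intros)

lemma computable_omega [comp_intros]:
    "computable f \<Longrightarrow> computable g \<Longrightarrow> computable (\<lambda>x. omega (f x) (g x))"
  and computable_omega_rev [comp_intros]:
    "computable f \<Longrightarrow> computable g \<Longrightarrow> computable (\<lambda>x. omega_rev (f x) (g x))"
  and computable_shuffle [comp_intros]:
    "computable f \<Longrightarrow> computable g \<Longrightarrow> computable (\<lambda>x. shuffle (f x) (g x))"
proof -
  have *: "omega n e = rec_nat 0 (\<lambda>n r. uni (ext n 0 r e) (ext n e r e)) n"
    "omega_rev n e = rec_nat 0 (\<lambda>n r. uni (ext n r 0 e) (ext n r e e)) n"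
    "shuffle n e = rec_nat 0 (\<lambda>n r. ext n r r e) n" for n e
    by (induction n) simp_all
  have "computable (\<lambda>z. omega (pfst z) (psnd z))" "computable (\<lambda>z. omega_rev (pfst z) (psnd z))"
    "computable (\<lambda>z. shuffle (pfst z) (psnd z))"
    unfolding * by (intro comp_intros)+
  note app = this[THEN computable_app2]
  show "computable f \<Longrightarrow> computable g \<Longrightarrow> computable (\<lambda>x. omega (f x) (g x))"
    "computable f \<Longrightarrow> computable g \<Longrightarrow> computable (\<lambda>x. omega_rev (f x) (g x))"
    "computable f \<Longrightarrow> computable g \<Longrightarrow> computable (\<lambda>x. shuffle (f x) (g x))"
    by (rule app; assumption)+
qed

lemma dec_interval_closed [comp_intros]:
  assumes "computable f" "computable g" "computable h" shows "dec (\<lambda>x. interval_closed (f x) (g x) (h x))"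
  by (rule dec_app3[OF _ assms]) (unfold interval_closed_def, intro comp_intros)

lemma dec_interval_type [comp_intros]:
  assumes "computable f" "computable g" "computable h" shows "dec (\<lambda>x. interval_type (f x) (g x) (h x))"
  by (rule dec_app3[OF _ assms]) (unfold interval_type_def, intro comp_intros)

lemma dec_integral_closed [comp_intros]:
  assumes "computable f" "computable g" "computable h" shows "dec (\<lambda>x. integral_closed (f x) (g x) (h x))"
  by (rule dec_app3[OF _ assms]) (unfold integral_closed_def, intro comp_intros)

lemma dec_integral_type [comp_intros]:
  assumes "computable f" "computable g" "computable h" shows "dec (\<lambda>x. integral_type (f x) (g x) (h x))"
  by (rule dec_app3[OF _ assms]) (unfold integral_type_def, intro comp_intros)

lemma dec_line_type [comp_intros]:
  assumes "computable f" "computable g" "computable h" shows "dec (\<lambda>x. line_type (f x) (g x) (h x))"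
  by (rule dec_app3[OF _ assms]) (unfold line_type_def, intro comp_intros)

lemma computable_csize [comp_intros]: "computable f \<Longrightarrow> computable (\<lambda>x. csize (f x))"
  and computable_cvars [comp_intros]: "computable f \<Longrightarrow> computable (\<lambda>x. cvars (f x))"
  and computable_cgap [comp_intros]: "computable f \<Longrightarrow> computable g \<Longrightarrow> computable (\<lambda>x. cgap (f x) (g x))"
  and computable_cletter [comp_intros]: "computable f \<Longrightarrow> computable g \<Longrightarrow> computable (\<lambda>x. cletter (f x) (g x))"
  and computable_cenv [comp_intros]: "computable f \<Longrightarrow> computable g \<Longrightarrow> computable (\<lambda>x. cenv (f x) (g x))"
  unfolding csize_def cvars_def cgap_def cletter_def cenv_def by (intro comp_intros; assumption)+

lemma computable_config [comp_intros]:
  assumes "computable K" "computable m" "computable (\<lambda>z. t (pfst z) (psnd z))"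
    "computable (\<lambda>z. l (pfst z) (psnd z))" "computable (\<lambda>z. e (pfst z) (psnd z))"
  shows "computable (\<lambda>x. config (K x) (m x) (t x) (l x) (e x))"
  unfolding config_def by (intro comp_intros assms)

lemma computable_assign_old [comp_intros]:
  assumes "computable f" "computable g" "computable h"
  shows "computable (\<lambda>x. assign_old (f x) (g x) (h x))"
  by (rule computable_app3[OF _ assms]) (unfold assign_old_def, intro comp_intros)

lemma computable_assign_new [comp_intros]:
  assumes "computable f" "computable g" "computable h" "computable k"
  shows "computable (\<lambda>x. assign_new (f x) (g x) (h x) (k x))"
  by (rule computable_app4[OF _ assms]) (unfold assign_new_def, intro comp_intros)

text \<open>The argument \<open>t\<close> changes along the recursion, whereas primitive recursion
  keeps its parameters. Instead the set of all codes below \<open>B\<close> satisfying the predicate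
  is computed level by level; the components of a triple in \<open>t\<close> stay below
  \<open>B\<close>.\<close>

lemma dec_atleast_ints [comp_intros]:
  assumes "computable f" "computable g"
  shows "dec (\<lambda>x. atleast_ints (f x) (g x))"
proof -
  let ?A = "\<lambda>B k. rec_nat (2 ^ B - 1) (\<lambda>_ r. set_encode {t. t < B \<and>
    (\<exists>e\<in>set_decode t. 0 \<in> set_decode (snd3 e) \<and> trd3 e \<in> set_decode r)}) k"
  have A: "t \<in> set_decode (?A B k) \<longleftrightarrow> atleast_ints k t" if "t < B" for t B k
    using that
  proof (induction k arbitrary: t)
    case 0
    then show ?case by (simp add: set_decode_range[unfolded One_nat_def])
  next
    case (Suc k)
    have "trd3 e < B" if "e \<in> set_decode t" for e
      using set_decode_less[OF that] psnd_le[of "psnd e"] psnd_le[of e] Suc.prems by (simp add: trd3_def)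
    then show ?case using Suc by auto
  qed
  have "dec (\<lambda>z. psnd z \<in> set_decode (?A (Suc (psnd z)) (pfst z)))"
    by (intro comp_intros)
  then have "dec (\<lambda>z. atleast_ints (pfst z) (psnd z))" by (simp only: A lessI)
  from dec_app2[OF this assms] show ?thesis .
qed

lemma computable_distance [comp_intros]:
  assumes "computable f" "computable g" "computable h" "computable k"
  shows "computable (\<lambda>x. distance (f x) (g x) (h x) (k x))"
  by (rule computable_app4[OF _ assms]) (unfold distance_def count_ints_def, intro comp_intros)

lemma dec_ncmp [comp_intros]:
  assumes "computable f" "computable g" "computable h" shows "dec (\<lambda>x. ncmp (f x) (g x) (h x))"
  unfolding ncmp_def by (intro comp_intros assms)

lemma computable_ev_calls [comp_intros]:
  assumes "computable f" "computable g" shows "computable (\<lambda>x. ev_calls (f x) (g x))"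
  by (rule computable_app2[OF _ assms]) (unfold ev_calls_def, intro comp_intros)

lemma dec_ev [comp_intros]:
  assumes "computable f" "computable g" shows "dec (\<lambda>x. ev (f x) (g x))"
proof -
  have "computable (\<lambda>x. if ev (pfst x) (psnd x) then 1 else 0)"
  proof (rule computable_wfrec[where m = pfst and D = "\<lambda>x. ev_calls (pfst x) (psnd x)"
        and G = "\<lambda>x T. if ev_step (\<lambda>a b. look T (pair a b) = 1) (pfst x) (psnd x) then 1 else 0"])
    show "computable (\<lambda>x. ev_calls (pfst x) (psnd x))" by (intro comp_intros)
    show "computable (\<lambda>z. if ev_step (\<lambda>a b. look (psnd z) (pair a b) = 1) (pfst (pfst z)) (psnd (pfst z)) then 1 else 0)"
      unfolding ev_step_def diff_eval_def by (intro comp_intros)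
    show "pfst d < pfst x" if "d \<in> set_decode (ev_calls (pfst x) (psnd x))" for x d
      using ev_calls_less[OF that] .
    show "(if ev_step (\<lambda>a b. look T (pair a b) = 1) (pfst x) (psnd x) then 1 else 0) =
        (if ev (pfst x) (psnd x) then 1 else (0 :: nat))"
      if "\<And>d. d \<in> set_decode (ev_calls (pfst x) (psnd x)) \<Longrightarrow> look T d = (if ev (pfst d) (psnd d) then 1 else 0)"
      for x T
    proof -
      have "ev_step (\<lambda>a b. look T (pair a b) = 1) (pfst x) (psnd x) = ev_step ev (pfst x) (psnd x)"
        by (rule ev_step_cong) (use that in auto)
      then show ?thesis by (simp add: ev.simps[of "pfst x"])
    qed
  qed
  then have "dec (\<lambda>z. ev (pfst z) (psnd z))" unfolding dec_def .
  from dec_app2[OF this assms] show ?thesis .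
qed

section \<open>Closing a formula and searching the types of the line\<close>

primrec ex_closure :: "nat \<Rightarrow> fm \<Rightarrow> fm" where
  "ex_closure 0 \<phi> = \<phi>"
| "ex_closure (Suc i) \<phi> = Ex i (ex_closure i \<phi>)"

lemma ex_closure_fragment: "\<phi> \<in> UF_IDL_IRO \<Longrightarrow> ex_closure N \<phi> \<in> UF_IDL_IRO"
  by (induction N) (auto intro: UF_IDL_IRO.intros)

lemma satisfies_ex_closure:
  "satisfies I v (ex_closure N \<phi>) \<longleftrightarrow> (\<exists>u. (\<forall>x\<ge>N. u x = v x) \<and> satisfies I u \<phi>)"
proof (induction N arbitrary: v)
  case 0
  have "u = v" if "\<forall>x\<ge>0. u x = v x" for u using that by auto
  then show ?case by auto
next
  case (Suc N)
  have *: "(\<exists>a. \<forall>x\<ge>N. u x = (v(N := a)) x) \<longleftrightarrow> (\<forall>x\<ge>Suc N. u x = v x)" for u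
  proof
    assume "\<forall>x\<ge>Suc N. u x = v x"
    then show "\<exists>a. \<forall>x\<ge>N. u x = (v(N := a)) x" by (intro exI[of _ "u N"]) simp
  qed auto
  have "satisfies I v (ex_closure (Suc N) \<phi>) \<longleftrightarrow>
      (\<exists>a u. (\<forall>x\<ge>N. u x = (v(N := a)) x) \<and> satisfies I u \<phi>)"
    by (simp only: ex_closure.simps satisfies.simps Suc)
  also have "\<dots> \<longleftrightarrow> (\<exists>u. (\<exists>a. \<forall>x\<ge>N. u x = (v(N := a)) x) \<and> satisfies I u \<phi>)" by blast
  finally show ?case unfolding * .
qed

lemma satisfies_cong:
  "(\<And>x. x \<le> fm_code \<phi> \<Longrightarrow> u x = v x) \<Longrightarrow> satisfies I u \<phi> \<longleftrightarrow> satisfies I v \<phi>"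
proof (induction \<phi> arbitrary: u v)
  case (Pred P x)
  then show ?case using code_bounds(2)[of x P] by simp
next
  case (IsInt x)
  then show ?case using code_bounds(3)[of x] by simp
next
  case (Ord x r y)
  then show ?case using code_bounds(4)[of x r y] code_bounds(5)[of y x r] by simp
next
  case (Diff x r y z)
  then show ?case using code_bounds(6)[of x r y z] code_bounds(7)[of y x r z] by simp
next
  case (Neg \<phi>)
  then show ?case using code_bounds(9)[of \<phi>] by (metis less_imp_le order_trans satisfies.simps(5))
next
  case (And \<phi> \<psi>)
  have "satisfies I u \<phi> = satisfies I v \<phi>" "satisfies I u \<psi> = satisfies I v \<psi>"
    by (rule And; use code_bounds(10)[of \<phi> \<psi>] code_bounds(11)[of \<psi> \<phi>] And.prems in simp)+
  then show ?case by simp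
next
  case (Or \<phi> \<psi>)
  have "satisfies I u \<phi> = satisfies I v \<phi>" "satisfies I u \<psi> = satisfies I v \<psi>"
    by (rule Or; use code_bounds(12)[of \<phi> \<psi>] code_bounds(13)[of \<psi> \<phi>] Or.prems in simp)+
  then show ?case by simp
next
  case (Imp \<phi> \<psi>)
  have "satisfies I u \<phi> = satisfies I v \<phi>" "satisfies I u \<psi> = satisfies I v \<psi>"
    by (rule Imp; use code_bounds(14)[of \<phi> \<psi>] code_bounds(15)[of \<psi> \<phi>] Imp.prems in simp)+
  then show ?case by simp
next
  case (Iff \<phi> \<psi>)
  have "satisfies I u \<phi> = satisfies I v \<phi>" "satisfies I u \<psi> = satisfies I v \<psi>"
    by (rule Iff; use code_bounds(16)[of \<phi> \<psi>] code_bounds(17)[of \<psi> \<phi>] Iff.prems in simp)+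
  then show ?case by simp
next
  case (All x \<phi>)
  have "satisfies I (u(x := a)) \<phi> = satisfies I (v(x := a)) \<phi>" for a
    by (rule All.IH) (use code_bounds(18)[of \<phi> x] All.prems in simp)
  then show ?case by simp
next
  case (Ex x \<phi>)
  have "satisfies I (u(x := a)) \<phi> = satisfies I (v(x := a)) \<phi>" for a
    by (rule Ex.IH) (use code_bounds(20)[of \<phi> x] Ex.prems in simp)
  then show ?case by simp
qed

text \<open>Every variable of a formula is at most its code, so quantifying the variables up to the
  code closes it, and the valuation \<open>v\<close> may be fixed in advance.\<close>

lemma satisfiable_ex_closure:
  "satisfiable \<phi> \<longleftrightarrow> (\<exists>I. satisfies I v (ex_closure (Suc (fm_code \<phi>)) \<phi>))"
proof -
  have "(\<exists>u. satisfies I u \<phi>) \<longleftrightarrow> satisfies I v (ex_closure (Suc (fm_code \<phi>)) \<phi>)" for I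
    unfolding satisfies_ex_closure
  proof
    assume "\<exists>u. satisfies I u \<phi>"
    then obtain u where u: "satisfies I u \<phi>" by blast
    let ?u = "\<lambda>x. if x \<le> fm_code \<phi> then u x else v x"
    have "satisfies I ?u \<phi>" using u satisfies_cong[of \<phi> ?u u I] by simp
    then show "\<exists>u. (\<forall>x\<ge>Suc (fm_code \<phi>). u x = v x) \<and> satisfies I u \<phi>"
      by (intro exI[of _ ?u]) simp
  qed blast
  then show ?thesis unfolding satisfiable_def by blast
qed

definition closure_code :: "nat \<Rightarrow> nat" where
  "closure_code x = rec_nat x (\<lambda>i r. pair 10 (pair i r)) (Suc x)"

lemma closure_code: "closure_code (fm_code \<phi>) = fm_code (ex_closure (Suc (fm_code \<phi>)) \<phi>)"
proof -
  have "rec_nat (fm_code \<phi>) (\<lambda>i r. pair 10 (pair i r)) N = fm_code (ex_closure N \<phi>)" for N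
    by (induction N) (simp_all only: fm_code_pair ex_closure.simps nat.rec)
  then show ?thesis unfolding closure_code_def .
qed

text \<open>A closed formula does not depend on the valuation, so the search may start from the
  configuration in which every variable denotes the same arbitrary point of the line.\<close>

definition initial :: "nat \<Rightarrow> nat \<Rightarrow> nat" where
  "initial C e = config (Suc C) 1 (\<lambda>i. if i = 0 then fst3 e else trd3 e) (\<lambda>_. snd3 e) (\<lambda>_. 0)"

text \<open>A letter has bit 0 for integrality and one bit for each of the predicates
  \<open>0\<close> to \<open>C\<close>, hence \<open>C + 2\<close> bits. The level is
  \<open>Suc C\<close> because marking the initial point costs one level and the evaluation needs
  level \<open>C\<close>.\<close>

definition decide :: "nat \<Rightarrow> bool" where
  "decide C \<longleftrightarrow> (\<exists>t. t < tbound (2 ^ (C + 2)) (Suc C) \<and> line_type (Suc C) (2 ^ (C + 2)) t \<and>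
    (\<exists>e\<in>set_decode t. ev C (initial C e)))"

lemma dec_decide: "dec (\<lambda>x. decide (closure_code x))"
proof -
  have 1: "computable closure_code" unfolding closure_code_def by (intro comp_intros)
  have "dec decide" unfolding decide_def initial_def by (intro comp_intros)
  from dec_comp[OF this 1] show ?thesis .
qed

lemma decide_iff:
  assumes \<phi>: "\<phi> \<in> UF_IDL_IRO"
  shows "decide (fm_code \<phi>) \<longleftrightarrow> (\<exists>I a. satisfies I (\<lambda>_. a) \<phi>)"
proof -
  let ?C = "fm_code \<phi>" and ?L = "2 ^ (fm_code \<phi> + 2) :: nat"
  have L: "1 < ?L" by (rule one_less_power) simp_all
  have key: "\<exists>f. set_decode (ty c (Suc ?C) UNIV) = range f \<and>
      (\<forall>a. ev ?C (initial ?C (f a)) \<longleftrightarrow> satisfies I (\<lambda>_. a) \<phi>)"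
    if c: "integer_colouring ?L c" and I: "\<And>P a. P < Suc ?C \<Longrightarrow> Suc P \<in> set_decode (c a) \<longleftrightarrow> a \<in> I P" for c I
  proof -
    let ?f = "\<lambda>a. pr3 (ty c ?C {..<a}) (c a) (ty c ?C {a<..})"
    have fin: "finite (range c)" using c by (rule finite_integer_colouring)
    have "ev ?C (initial ?C (?f a)) \<longleftrightarrow> satisfies I (\<lambda>_. a) \<phi>" for a
    proof (rule ev_correct[OF fin _ I \<phi>])
      show "odd (c x) \<longleftrightarrow> x \<in> \<int>" for x using c by (simp add: integer_colouring_def)
      have "gap 1 (\<lambda>_. a) 0 = {..<a}" "gap 1 (\<lambda>_. a) 1 = {a<..}" by (auto simp: gap_def)
      then show "represents c ?C (initial ?C (?f a)) (\<lambda>_. a) (\<lambda>_. a)"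
        unfolding represents_def initial_def by (auto simp: rep_ty le_Suc_eq)
      show "?C < Suc ?C" by (rule lessI)
    qed (simp_all add: initial_def)
    then show ?thesis using set_decode_ty[OF fin, of ?C UNIV] by (intro exI[of _ ?f]) (simp del: ty.simps)
  qed
  show ?thesis
  proof
    assume "decide ?C"
    then obtain t e where t: "line_type (Suc ?C) ?L t" "e \<in> set_decode t" "ev ?C (initial ?C e)"
      unfolding decide_def by blast
    then obtain c where c: "integer_colouring ?L c" "t = ty c (Suc ?C) UNIV" using line_type_iff[OF _ L] by auto
    from key[OF c(1), of "\<lambda>P. {a. Suc P \<in> set_decode (c a)}"] show "\<exists>I a. satisfies I (\<lambda>_. a) \<phi>"
      using t c(2) by force
  next
    assume "\<exists>I a. satisfies I (\<lambda>_. a) \<phi>"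
    then obtain I a where I: "satisfies I (\<lambda>_. a) \<phi>" by blast
    define A where "A x = {i. i = 0 \<and> x \<in> \<int>} \<union> {Suc P | P. P < Suc ?C \<and> x \<in> I P}" for x
    define c where "c x = set_encode (A x)" for x
    have sub: "A x \<subseteq> {..<?C + 2}" for x by (auto simp: A_def)
    have dec: "set_decode (c x) = A x" for x
      using finite_subset[OF sub] by (simp add: c_def)
    have "c x < ?L" for x unfolding c_def by (rule set_encode_less[OF sub])
    moreover have "odd (c x) \<longleftrightarrow> x \<in> \<int>" for x
    proof -
      have "odd (c x) \<longleftrightarrow> 0 \<in> set_decode (c x)" by simp
      then show ?thesis unfolding dec by (auto simp: A_def)
    qed
    ultimately have c: "integer_colouring ?L c" by (simp add: integer_colouring_def)
    have "Suc P \<in> set_decode (c a) \<longleftrightarrow> a \<in> I P" if "P < Suc ?C" for P a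
      using that unfolding dec by (auto simp: A_def)
    from key[OF c this] obtain f where f: "set_decode (ty c (Suc ?C) UNIV) = range f"
      "\<And>a. ev ?C (initial ?C (f a)) \<longleftrightarrow> satisfies I (\<lambda>_. a) \<phi>" by blast
    have "f a \<in> set_decode (ty c (Suc ?C) UNIV)" "ev ?C (initial ?C (f a))"
      using f I by auto
    moreover have "line_type (Suc ?C) ?L (ty c (Suc ?C) UNIV)" using line_type_iff[OF _ L] c by blast
    moreover have "ty c (Suc ?C) UNIV < tbound ?L (Suc ?C)"
      by (rule ty_less[OF range_bounded]) (use c in \<open>simp add: integer_colouring_def\<close>)
    ultimately show "decide ?C" unfolding decide_def by blast
  qed
qed

theorem theorem1:
  "decidable_on UF_IDL_IRO satisfiable \<and> decidable_on UF_IRO satisfiable"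
proof -
  obtain p where p: "\<And>x. computes p [x] (if decide (closure_code x) then 1 else 0)"
    using dec_decide unfolding dec_def computable_def by blast
  have "decide (closure_code (fm_code \<phi>)) \<longleftrightarrow> satisfiable \<phi>" if \<phi>: "\<phi> \<in> UF_IDL_IRO" for \<phi>
  proof -
    let ?\<psi> = "ex_closure (Suc (fm_code \<phi>)) \<phi>"
    have "decide (closure_code (fm_code \<phi>)) \<longleftrightarrow> (\<exists>I a. satisfies I (\<lambda>_. a) ?\<psi>)"
      unfolding closure_code by (rule decide_iff[OF ex_closure_fragment[OF \<phi>]])
    then show ?thesis using satisfiable_ex_closure[of \<phi>] by blast
  qed
  then have "computes p [fm_code \<phi>] (if satisfiable \<phi> then 1 else 0)" if "\<phi> \<in> UF_IDL_IRO" for \<phi>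
    using p[of "fm_code \<phi>"] that by simp
  then show ?thesis unfolding decidable_on_def using UF_IRO_subset by blast
qed

end
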